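(* Let $\mu_0\in(0,1/10)$ and let $\omega_0$, the vorticity of an initial velocity $u_0$, satisfy $$\sum_{i+j\le 2}\|\partial_x^i(y\partial_y)^j\omega_0\|_{X_{\mu_0,0}}+\sum_{i+j\le 2}\|\partial_x^i(y\partial_y)^j\omega_0\|_{Y_{\mu_0}}+\sum_{i+j\le 3}\|\partial_x^i(y\partial_y)^j\omega_0\|_{S}\le M<\infty .$$ For $\nu\in(0,1)$ let $u^\nu$ be the solution of the Navier–Stokes equations on $\mathbb H$ with viscosity $\nu$, no-slip boundary condition and initial datum $u_0$, and let $\omega^\nu$ be its vorticity. Let $T>0$ be a time, depending on $M$ and $\mu_0$ but not on $\nu$, such that for some sufficiently large $\gamma>0$ (depending on $M$ and $\mu_0$) and some $C>0$ independent of $\nu$ one has $\sup_{t\in[0,T]}|||\omega^\nu(t)|||_t\le CM$ for all $\nu\in(0,1)$ (such a $T$ exists whenever $\sum_{i+j\le 2}\|\partial_x^i(y\partial_y)^j\omega_0\|_{X_{\mu_0,0}}+\sum_{i+j\le 2}\|\partial_x^i(y\partial_y)^j\omega_0\|_{Y_{\mu_0}}+\sum_{i+j\le 3}\|\partial_x^i(y\partial_y)^j\omega_0\|_{S}\le M<\infty$). Let $\bar u$ be the solution of the Euler equations on $\mathbb H$ with initial datum $u_0$. Then $$\lim_{\nu\to0}\ \sup_{t\in[0,T]}\|u^\nu(t)-\bar u(t)\|_{L^2(\mathbb H)}=0 .$$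
   Context: Equations. $\mathbb H=\mathbb T\times\mathbb R_+=\{(x,y)\in\mathbb T\times\mathbb R:\ y\ge 0\}$, $\mathbb T=[-\pi,\pi]$ (periodic in $x$). The Navier–Stokes solution $u=u^\nu=(u_1,u_2)$ satisfies $\partial_t u-\nu\Delta u+u\cdot\nabla u+\nabla p=0$, $\operatorname{div}u=0$, $u|_{t=0}=u_0$, $u|_{y=0}=0$. The Euler solution satisfies $\partial_t\bar u+\bar u\cdot\nabla\bar u+\nabla\bar p=0$, $\operatorname{div}\bar u=0$, $\bar u|_{t=0}=u_0$, with the slip condition $\bar u_2|_{y=0}=0$. The vorticity is $\omega=\partial_xu_2-\partial_yu_1$. Fixed parameters. $\beta\in(0,1/4)$, $\alpha\in(0,1/2)$, and $\epsilon_0\in(0,1)$ is a fixed sufficiently small constant. Notation. $f_\xi(y)$, $\xi\in\mathbb Z$, is the Fourier coefficient in $x$: $f(x,y)=\sum_{\xi}f_\xi(y)e^{ix\xi}$. The complex domain is $$\Omega_\mu=\{0\le\operatorname{Re}z\le1,\ |\operatorname{Im}z|\le\mu\operatorname{Re}z\}\cup\{1\le\operatorname{Re}z\le1+\mu,\ |\operatorname{Im}z|\le1+\mu-\operatorname{Re}z\}.$$ Functions measured in the analytic norms below have Fourier coefficients $f_\xi$ that extend analytically in $y$ to $\Omega_\mu$. For complex $y$, $w_t(y)$ and $(1+\mu-y)_+$ mean $w_t(\operatorname{Re}y)$ and $(1+\mu-\operatorname{Re}y)_+$. Weight. $w(y)=\sqrt\nu$ for $0\le y\le\sqrt\nu$,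 $w(y)=y$ for $\sqrt\nu\le y\le1$, $w(y)=1$ for $y\ge1$. Then $w_0(y)=1$; $$w_t(y)=w\!\left(y\Big(\tfrac{\nu^2}{t\gamma^2}\Big)^{\beta}\right)+\Big(1-\tfrac{\gamma^2t}{\nu^2}\Big)_+\quad\text{for }0<t\le\nu^2/\gamma^2,\qquad w_t(y)=w(y)\quad\text{for }t>\nu^2/\gamma^2 .$$ Norms. $\|g\|_{\mathcal L^\infty_{\mu,\nu,t}}=\sup_{y\in\Omega_\mu}w_t(y)|g(y)|$; $\|f\|_{X_{\mu,t}}=\sum_{\xi\in\mathbb Z}\|e^{\epsilon_0(1+\mu-y)_+|\xi|}f_\xi\|_{\mathcal L^\infty_{\mu,\nu,t}}$; $$\|f\|_{X(t)}=\sup_{\mu<\mu_0-\gamma\sqrt t}\Big(\sum_{0\le i+j\le1}\|\partial_x^i(y\partial_y)^jf\|_{X_{\mu,t}}+\sum_{i+j=2}(\mu_0-\mu-\gamma\sqrt t)^{1/2+\alpha}\|\partial_x^i(y\partial_y)^jf\|_{X_{\mu,t}}\Big).$$ $\|g\|_{\mathcal L^1_\mu}=\sup_{0\le\theta<\mu}\|g\|_{L^1(\partial\Omega_\theta)}$; $\|f\|_{Y_\mu}=\sum_\xi\|e^{\epsilon_0(1+\mu-y)_+|\xi|}f_\xi\|_{\mathcal L^1_\mu}$; $$\|f\|_{Y(t)}=\sup_{\mu<\mu_0-\gamma t}\Big(\sum_{0\le i+j\le1}\|\partial_x^i(y\partial_y)^jf\|_{Y_\mu}+\sum_{i+j=2}(\mu_0-\mu-\gamma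 t)^{\alpha}\|\partial_x^i(y\partial_y)^jf\|_{Y_\mu}\Big)$$ (suprema over positive $\mu$). $\|f\|_S^2=\sum_\xi\|yf_\xi\|^2_{L^2(y\ge1/2)}$; $\|f\|_Z=\sum_{0\le i+j\le3}\|\partial_x^i\partial_y^jf\|_S$. Finally $|||\omega|||_t=\|\omega\|_{X(t)}+\|\omega\|_{Y(t)}+\|\omega\|_Z$. *)

theory Defs
  imports "HOL-Analysis.Analysis"
begin

text \<open>
  A function on the half-plane \<open>\<bbbH>\<close> is a curried function \<open>f x y\<close> that is \<open>2 * pi\<close>-periodic in \<open>x\<close>;
  only its values for \<open>y \<ge> 0\<close> matter. Time-dependent functions are written \<open>u t x y\<close>.
  All norms take values in \<open>ennreal\<close>; they are infinite on functions for which an analytic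
  extension or a weak derivative needed to form them does not exist.
\<close>

type_synonym sfield = "real \<Rightarrow> real \<Rightarrow> real"
type_synonym vfield = "real \<Rightarrow> real \<Rightarrow> real \<times> real"


section \<open>Differential operators\<close>

definition dx :: "(real \<Rightarrow> real \<Rightarrow> 'a::real_normed_vector) \<Rightarrow> real \<Rightarrow> real \<Rightarrow> 'a" where
  "dx f x y = vector_derivative (\<lambda>s. f s y) (at x)"

text \<open>One-sided at the boundary \<open>y = 0\<close>.\<close>

definition dy :: "(real \<Rightarrow> real \<Rightarrow> 'a::real_normed_vector) \<Rightarrow> real \<Rightarrow> real \<Rightarrow> 'a" where
  "dy f x y = vector_derivative (f x) (at y within {0..})"

text \<open>One-sided at those end points of the time interval \<open>J\<close> that belong to \<open>J\<close>.\<close>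

definition dt :: "real set \<Rightarrow> (real \<Rightarrow> real \<Rightarrow> real \<Rightarrow> 'a::real_normed_vector)
    \<Rightarrow> real \<Rightarrow> real \<Rightarrow> real \<Rightarrow> 'a" where
  "dt J f t x y = vector_derivative (\<lambda>s. f s x y) (at t within J)"

definition divergence :: "vfield \<Rightarrow> sfield" where
  "divergence u x y = fst (dx u x y) + snd (dy u x y)"

definition vorticity :: "vfield \<Rightarrow> sfield" where
  "vorticity u x y = snd (dx u x y) - fst (dy u x y)"

definition laplacian :: "vfield \<Rightarrow> vfield" where
  "laplacian u x y = dx (dx u) x y + dy (dy u) x y"

definition convection :: "vfield \<Rightarrow> vfield" where
  "convection u x y = fst (u x y) *\<^sub>R dx u x y + snd (u x y) *\<^sub>R dy u x y"

definition gradient :: "sfield \<Rightarrow> vfield" where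
  "gradient p x y = (dx p x y, dy p x y)"


section \<open>The \<open>L\<^sup>2\<close> norm on the half-plane\<close>

definition ennsqrt :: "ennreal \<Rightarrow> ennreal" where
  "ennsqrt a = (if a = top then top else ennreal (sqrt (enn2real a)))"

definition L2_norm :: "(real \<Rightarrow> real \<Rightarrow> 'a::real_normed_vector) \<Rightarrow> ennreal" where
  "L2_norm f = ennsqrt
     (\<integral>\<^sup>+ q \<in> {-pi..pi} \<times> {0..}. ennreal ((norm (f (fst q) (snd q)))\<^sup>2) \<partial>lborel)"


section \<open>Solutions of the Navier--Stokes and Euler equations\<close>

definition periodic_x :: "(real \<Rightarrow> real \<Rightarrow> 'a) \<Rightarrow> bool" where
  "periodic_x f \<longleftrightarrow> (\<forall>x. \<forall>y\<ge>0. f (x + 2 * pi) y = f x y)"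

definition C1_space :: "real set \<Rightarrow> real set
    \<Rightarrow> (real \<Rightarrow> real \<Rightarrow> real \<Rightarrow> 'a::real_normed_vector) \<Rightarrow> bool" where
  "C1_space J Y f \<longleftrightarrow>
     (\<forall>t\<in>J. \<forall>x. \<forall>y\<in>Y. (\<lambda>s. f t s y) differentiable (at x) \<and>
                        f t x differentiable (at y within {0..})) \<and>
     continuous_on (J \<times> UNIV \<times> Y) (\<lambda>(t, x, y). f t x y) \<and>
     continuous_on (J \<times> UNIV \<times> Y) (\<lambda>(t, x, y). dx (f t) x y) \<and>
     continuous_on (J \<times> UNIV \<times> Y) (\<lambda>(t, x, y). dy (f t) x y)"

definition C1_spacetime :: "real set \<Rightarrow> real set
    \<Rightarrow> (real \<Rightarrow> real \<Rightarrow> real \<Rightarrow> 'a::real_normed_vector) \<Rightarrow> bool" where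
  "C1_spacetime J Y f \<longleftrightarrow>
     C1_space J Y f \<and>
     (\<forall>t\<in>J. \<forall>x. \<forall>y\<in>Y. (\<lambda>s. f s x y) differentiable (at t within J)) \<and>
     continuous_on (J \<times> UNIV \<times> Y) (\<lambda>(t, x, y). dt J f t x y)"

text \<open>\<open>f \<in> C(J; L\<^sup>2(\<bbbH>))\<close> and \<open>f \<in> L\<^sup>\<infinity>\<^sub>l\<^sub>o\<^sub>c(J; L\<^sup>2(\<bbbH>))\<close>.\<close>

definition continuous_L2 :: "real set
    \<Rightarrow> (real \<Rightarrow> real \<Rightarrow> real \<Rightarrow> 'a::real_normed_vector) \<Rightarrow> bool" where
  "continuous_L2 J f \<longleftrightarrow>
     (\<forall>t\<in>J. L2_norm (f t) < \<infinity> \<and>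
        ((\<lambda>s. L2_norm (\<lambda>x y. f s x y - f t x y)) \<longlongrightarrow> 0) (at t within J))"

definition locally_bounded_L2 :: "real set
    \<Rightarrow> (real \<Rightarrow> real \<Rightarrow> real \<Rightarrow> 'a::real_normed_vector) \<Rightarrow> bool" where
  "locally_bounded_L2 J f \<longleftrightarrow>
     (\<forall>K. compact K \<and> K \<subseteq> J \<longrightarrow> (\<exists>B::real. \<forall>t\<in>K. L2_norm (f t) \<le> ennreal B))"

text \<open>
  Finite-energy solutions that are classical up to the boundary for positive times: the initial
  datum is attained in \<open>L\<^sup>2\<close>, so no compatibility condition is imposed on it. This is the class
  to which the unique Leray solution belongs by parabolic smoothing.
\<close>

definition navier_stokes_solution :: "real \<Rightarrow> real \<Rightarrow> vfield \<Rightarrow> (real \<Rightarrow> vfield) \<Rightarrow> bool" where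
  "navier_stokes_solution \<nu> T u0 u \<longleftrightarrow>
     (\<forall>t\<in>{0..T}. periodic_x (u t)) \<and>
     (\<forall>x. \<forall>y\<ge>0. u 0 x y = u0 x y) \<and>
     continuous_L2 {0..T} u \<and>
     C1_spacetime {0<..T} {0..} u \<and>
     C1_space {0<..T} {0..} (\<lambda>t. dx (u t)) \<and>
     C1_space {0<..T} {0..} (\<lambda>t. dy (u t)) \<and>
     locally_bounded_L2 {0<..T} (dt {0<..T} u) \<and>
     locally_bounded_L2 {0<..T} (\<lambda>t. dx (u t)) \<and>
     locally_bounded_L2 {0<..T} (\<lambda>t. dy (u t)) \<and>
     locally_bounded_L2 {0<..T} (\<lambda>t. dx (dx (u t))) \<and>
     locally_bounded_L2 {0<..T} (\<lambda>t. dx (dy (u t))) \<and>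
     locally_bounded_L2 {0<..T} (\<lambda>t. dy (dy (u t))) \<and>
     (\<forall>t\<in>{0<..T}. \<forall>x. \<forall>y\<ge>0. divergence (u t) x y = 0) \<and>
     (\<forall>t\<in>{0<..T}. \<forall>x. u t x 0 = 0) \<and>
     (\<exists>p :: real \<Rightarrow> sfield.
        (\<forall>t\<in>{0<..T}. periodic_x (p t)) \<and>
        C1_space {0<..T} {0..} p \<and>
        locally_bounded_L2 {0<..T} (\<lambda>t. gradient (p t)) \<and>
        (\<forall>t\<in>{0<..T}. \<forall>x. \<forall>y\<ge>0.
           dt {0<..T} u t x y - \<nu> *\<^sub>R laplacian (u t) x y
             + convection (u t) x y + gradient (p t) x y = 0))"

text \<open>
  Finite-energy solutions that are classical in \<open>y > 0\<close>, continuous up to the boundary, and have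
  velocity gradient in \<open>L\<^sup>\<infinity>(0,T; L\<^sup>2 \<inter> L\<^sup>\<infinity>)\<close>. No continuity of the gradient up to \<open>y = 0\<close> is
  required, because the conormal assumptions on the initial vorticity do not provide it.
\<close>

definition euler_solution :: "real \<Rightarrow> vfield \<Rightarrow> (real \<Rightarrow> vfield) \<Rightarrow> bool" where
  "euler_solution T u0 u \<longleftrightarrow>
     (\<forall>t\<in>{0..T}. periodic_x (u t)) \<and>
     (\<forall>x. \<forall>y\<ge>0. u 0 x y = u0 x y) \<and>
     continuous_L2 {0..T} u \<and>
     continuous_on ({0..T} \<times> UNIV \<times> {0..}) (\<lambda>(t, x, y). u t x y) \<and>
     C1_spacetime {0..T} {0<..} u \<and>
     (\<exists>B. \<forall>t\<in>{0..T}. \<forall>x. \<forall>y>0. norm (dx (u t) x y) \<le> B \<and> norm (dy (u t) x y) \<le> B) \<and>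
     locally_bounded_L2 {0..T} (dt {0..T} u) \<and>
     locally_bounded_L2 {0..T} (\<lambda>t. dx (u t)) \<and>
     locally_bounded_L2 {0..T} (\<lambda>t. dy (u t)) \<and>
     (\<forall>t\<in>{0..T}. \<forall>x. \<forall>y>0. divergence (u t) x y = 0) \<and>
     (\<forall>t\<in>{0..T}. \<forall>x. snd (u t x 0) = 0) \<and>
     (\<exists>p :: real \<Rightarrow> sfield.
        (\<forall>t\<in>{0..T}. periodic_x (p t)) \<and>
        C1_space {0..T} {0<..} p \<and>
        locally_bounded_L2 {0..T} (\<lambda>t. gradient (p t)) \<and>
        (\<forall>t\<in>{0..T}. \<forall>x. \<forall>y>0.
           dt {0..T} u t x y + convection (u t) x y + gradient (p t) x y = 0))"


section \<open>Fourier coefficients and their analytic extension\<close>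

definition fourier :: "sfield \<Rightarrow> int \<Rightarrow> real \<Rightarrow> complex" where
  "fourier f \<xi> y =
     (LBINT x:{-pi..pi}. complex_of_real (f x y) * exp (- \<i> * of_int \<xi> * of_real x)) / (2 * pi)"

definition Omega :: "real \<Rightarrow> complex set" where
  "Omega \<mu> = {z. 0 \<le> Re z \<and> Re z \<le> 1 \<and> \<bar>Im z\<bar> \<le> \<mu> * Re z} \<union>
             {z. 1 \<le> Re z \<and> Re z \<le> 1 + \<mu> \<and> \<bar>Im z\<bar> \<le> 1 + \<mu> - Re z}"

text \<open>
  Holomorphy is required in the interior of the closed set \<open>Omega \<mu>\<close>, whose corner \<open>0\<close> is where
  the conormal derivative degenerates. Since the interior is connected, the extension is unique
  there.
\<close>

definition is_extension :: "real \<Rightarrow> (real \<Rightarrow> complex) \<Rightarrow> (complex \<Rightarrow> complex) \<Rightarrow> bool" where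
  "is_extension \<mu> g F \<longleftrightarrow>
     F holomorphic_on interior (Omega \<mu>) \<and> (\<forall>y\<in>{0<..<1 + \<mu>}. F (of_real y) = g y)"

definition extensible :: "real \<Rightarrow> sfield \<Rightarrow> bool" where
  "extensible \<mu> f \<longleftrightarrow> (\<forall>\<xi>. \<exists>F. is_extension \<mu> (fourier f \<xi>) F)"

definition extension :: "real \<Rightarrow> sfield \<Rightarrow> int \<Rightarrow> complex \<Rightarrow> complex" where
  "extension \<mu> f \<xi> = (SOME F. is_extension \<mu> (fourier f \<xi>) F)"

text \<open>\<open>\<partial>\<^sub>x\<^sup>i (y \<partial>\<^sub>y)\<^sup>j\<close> on families of extended Fourier coefficients.\<close>

definition conormal :: "nat \<Rightarrow> nat \<Rightarrow> (int \<Rightarrow> complex \<Rightarrow> complex) \<Rightarrow> int \<Rightarrow> complex \<Rightarrow> complex" where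
  "conormal i j F \<xi> z = (\<i> * of_int \<xi>) ^ i * (((\<lambda>g z. z * deriv g z) ^^ j) (F \<xi>)) z"


section \<open>The analytic norms\<close>

definition weight :: "real \<Rightarrow> real \<Rightarrow> real" where
  "weight \<nu> y = (if y \<le> sqrt \<nu> then sqrt \<nu> else if y \<le> 1 then y else 1)"

definition weight_t :: "real \<Rightarrow> real \<Rightarrow> real \<Rightarrow> real \<Rightarrow> real \<Rightarrow> real" where
  "weight_t \<beta> \<gamma> \<nu> t y =
     (if t = 0 then 1
      else if t \<le> \<nu>\<^sup>2 / \<gamma>\<^sup>2
      then weight \<nu> (y * (\<nu>\<^sup>2 / (t * \<gamma>\<^sup>2)) powr \<beta>) + max 0 (1 - \<gamma>\<^sup>2 * t / \<nu>\<^sup>2)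
      else weight \<nu> y)"

definition exp_factor :: "real \<Rightarrow> real \<Rightarrow> int \<Rightarrow> complex \<Rightarrow> real" where
  "exp_factor \<epsilon>0 \<mu> \<xi> z = exp (\<epsilon>0 * max 0 (1 + \<mu> - Re z) * of_int \<bar>\<xi>\<bar>)"

text \<open>
  The supremum over the interior equals the one over \<open>Omega \<mu>\<close> for functions continuous on
  \<open>Omega \<mu>\<close>, the weights being continuous.
\<close>

definition Linf_norm :: "(real \<Rightarrow> real) \<Rightarrow> real \<Rightarrow> (complex \<Rightarrow> complex) \<Rightarrow> ennreal" where
  "Linf_norm W \<mu> g = (SUP z\<in>interior (Omega \<mu>). ennreal (W (Re z) * cmod (g z)))"

definition X_norm :: "real \<Rightarrow> (real \<Rightarrow> real) \<Rightarrow> real \<Rightarrow> (int \<Rightarrow> complex \<Rightarrow> complex) \<Rightarrow> ennreal" where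
  "X_norm \<epsilon>0 W \<mu> F = (\<Sum>\<^sub>\<infinity>\<xi>. Linf_norm W \<mu> (\<lambda>z. exp_factor \<epsilon>0 \<mu> \<xi> z *\<^sub>R F \<xi> z))"

definition X_norm_deriv :: "real \<Rightarrow> (real \<Rightarrow> real) \<Rightarrow> real \<Rightarrow> nat \<Rightarrow> nat \<Rightarrow> sfield \<Rightarrow> ennreal" where
  "X_norm_deriv \<epsilon>0 W \<mu> i j f =
     (if extensible \<mu> f then X_norm \<epsilon>0 W \<mu> (conormal i j (extension \<mu> f)) else \<infinity>)"

definition Xt_norm :: "real \<Rightarrow> real \<Rightarrow> real \<Rightarrow> real \<Rightarrow> real \<Rightarrow> real \<Rightarrow> real \<Rightarrow> sfield \<Rightarrow> ennreal" where
  "Xt_norm \<alpha> \<beta> \<epsilon>0 \<mu>0 \<gamma> \<nu> t f =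
     (SUP \<mu>\<in>{0<..<\<mu>0 - \<gamma> * sqrt t}.
        (\<Sum>(i, j)\<in>{(i, j). i + j \<le> 1}. X_norm_deriv \<epsilon>0 (weight_t \<beta> \<gamma> \<nu> t) \<mu> i j f) +
        (\<Sum>(i, j)\<in>{(i, j). i + j = 2}.
           ennreal ((\<mu>0 - \<mu> - \<gamma> * sqrt t) powr (1/2 + \<alpha>)) *
           X_norm_deriv \<epsilon>0 (weight_t \<beta> \<gamma> \<nu> t) \<mu> i j f))"

text \<open>
  The arc-length integral over the boundary of \<open>Omega \<theta>\<close>: the segments from \<open>0\<close> to
  \<open>1 \<plusminus> \<i> \<theta>\<close> and from there to \<open>1 + \<theta>\<close>. For \<open>\<theta> = 0\<close> the segment \<open>[0, 1]\<close> is counted twice,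
  as in the limit \<open>\<theta> \<rightarrow> 0\<close>.
\<close>

definition L1_boundary :: "real \<Rightarrow> (complex \<Rightarrow> complex) \<Rightarrow> ennreal" where
  "L1_boundary \<theta> g =
     (\<Sum>\<sigma>\<in>{-1, 1::real}.
        (\<integral>\<^sup>+ s \<in> {0..1}. ennreal (sqrt (1 + \<theta>\<^sup>2) * cmod (g (Complex s (\<sigma> * \<theta> * s)))) \<partial>lborel) +
        (\<integral>\<^sup>+ s \<in> {1..1 + \<theta>}. ennreal (sqrt 2 * cmod (g (Complex s (\<sigma> * (1 + \<theta> - s))))) \<partial>lborel))"

definition L1_norm :: "real \<Rightarrow> (complex \<Rightarrow> complex) \<Rightarrow> ennreal" where
  "L1_norm \<mu> g = (SUP \<theta>\<in>{0..<\<mu>}. L1_boundary \<theta> g)"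

definition Y_norm :: "real \<Rightarrow> real \<Rightarrow> (int \<Rightarrow> complex \<Rightarrow> complex) \<Rightarrow> ennreal" where
  "Y_norm \<epsilon>0 \<mu> F = (\<Sum>\<^sub>\<infinity>\<xi>. L1_norm \<mu> (\<lambda>z. exp_factor \<epsilon>0 \<mu> \<xi> z *\<^sub>R F \<xi> z))"

definition Y_norm_deriv :: "real \<Rightarrow> real \<Rightarrow> nat \<Rightarrow> nat \<Rightarrow> sfield \<Rightarrow> ennreal" where
  "Y_norm_deriv \<epsilon>0 \<mu> i j f =
     (if extensible \<mu> f then Y_norm \<epsilon>0 \<mu> (conormal i j (extension \<mu> f)) else \<infinity>)"

definition Yt_norm :: "real \<Rightarrow> real \<Rightarrow> real \<Rightarrow> real \<Rightarrow> real \<Rightarrow> sfield \<Rightarrow> ennreal" where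
  "Yt_norm \<alpha> \<epsilon>0 \<mu>0 \<gamma> t f =
     (SUP \<mu>\<in>{0<..<\<mu>0 - \<gamma> * t}.
        (\<Sum>(i, j)\<in>{(i, j). i + j \<le> 1}. Y_norm_deriv \<epsilon>0 \<mu> i j f) +
        (\<Sum>(i, j)\<in>{(i, j). i + j = 2}.
           ennreal ((\<mu>0 - \<mu> - \<gamma> * t) powr \<alpha>) * Y_norm_deriv \<epsilon>0 \<mu> i j f))"


section \<open>The Sobolev norms away from the boundary\<close>

text \<open>
  \<open>h\<close> is the weak derivative of \<open>g\<close> on \<open>y \<ge> 1/2\<close>: up to null sets, \<open>g\<close> is locally absolutely
  continuous with derivative \<open>h\<close>. The notion does not see changes of \<open>g\<close> or \<open>h\<close> on null sets, so
  the choice in \<open>weak_dy\<close> is harmless, also under iteration.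
\<close>

definition is_weak_dy :: "(real \<Rightarrow> complex) \<Rightarrow> (real \<Rightarrow> complex) \<Rightarrow> bool" where
  "is_weak_dy g h \<longleftrightarrow>
     (\<forall>b. set_integrable lborel {1/2..b} h) \<and>
     (\<exists>c. AE y in lborel. 1/2 \<le> y \<longrightarrow> g y = c + (LBINT s:{1/2..y}. h s))"

definition weak_dy :: "(real \<Rightarrow> complex) \<Rightarrow> real \<Rightarrow> complex" where
  "weak_dy g = (SOME h. is_weak_dy g h)"

fun weakly_differentiable :: "nat \<Rightarrow> (real \<Rightarrow> complex) \<Rightarrow> bool" where
  "weakly_differentiable 0 g = True"
| "weakly_differentiable (Suc k) g =
     ((\<exists>h. is_weak_dy g h) \<and> weakly_differentiable k (weak_dy g))"

definition S_norm :: "(int \<Rightarrow> real \<Rightarrow> complex) \<Rightarrow> ennreal" where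
  "S_norm F = ennsqrt
     (\<Sum>\<^sub>\<infinity>\<xi>. \<integral>\<^sup>+ y \<in> {1/2..}. ennreal ((cmod (of_real y * F \<xi> y))\<^sup>2) \<partial>lborel)"

definition Z_norm :: "sfield \<Rightarrow> ennreal" where
  "Z_norm f =
     (if \<forall>\<xi>. weakly_differentiable 3 (fourier f \<xi>)
      then \<Sum>(i, j)\<in>{(i, j). i + j \<le> 3}.
             S_norm (\<lambda>\<xi> y. (\<i> * of_int \<xi>) ^ i * (weak_dy ^^ j) (fourier f \<xi>) y)
      else \<infinity>)"

definition S_conormal_norm :: "sfield \<Rightarrow> ennreal" where
  "S_conormal_norm f =
     (if \<forall>\<xi>. weakly_differentiable 3 (fourier f \<xi>)
      then \<Sum>(i, j)\<in>{(i, j). i + j \<le> 3}.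
             S_norm (\<lambda>\<xi> y. (\<i> * of_int \<xi>) ^ i *
                        ((\<lambda>g y. of_real y * weak_dy g y) ^^ j) (fourier f \<xi>) y)
      else \<infinity>)"


section \<open>The combined norms\<close>

definition triple_norm :: "real \<Rightarrow> real \<Rightarrow> real \<Rightarrow> real \<Rightarrow> real \<Rightarrow> real \<Rightarrow> real \<Rightarrow> sfield \<Rightarrow> ennreal" where
  "triple_norm \<alpha> \<beta> \<epsilon>0 \<mu>0 \<gamma> \<nu> t f =
     Xt_norm \<alpha> \<beta> \<epsilon>0 \<mu>0 \<gamma> \<nu> t f + Yt_norm \<alpha> \<epsilon>0 \<mu>0 \<gamma> t f + Z_norm f"

text \<open>The constant weight is \<open>weight_t \<beta> \<gamma> \<nu> 0\<close>, which does not depend on the parameters.\<close>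

definition initial_norm :: "real \<Rightarrow> real \<Rightarrow> sfield \<Rightarrow> ennreal" where
  "initial_norm \<epsilon>0 \<mu>0 f =
     (\<Sum>(i, j)\<in>{(i, j). i + j \<le> 2}. X_norm_deriv \<epsilon>0 (\<lambda>_. 1) \<mu>0 i j f) +
     (\<Sum>(i, j)\<in>{(i, j). i + j \<le> 2}. Y_norm_deriv \<epsilon>0 \<mu>0 i j f) +
     S_conormal_norm f"

end

theory Submission
  imports Defs
begin

text \<open>
  Write \<open>v = u - ubar\<close>. The transport term \<open>\<langle>u \<cdot> \<nabla>v, v\<rangle>\<close> and the pressure term vanish because \<open>u\<close> and
  \<open>v\<close> are divergence free and tangent to the wall, and \<open>\<langle>v \<cdot> \<nabla>ubar, v\<rangle>\<close> is controlled by the Lipschitz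
  bound of the Euler flow. In the viscous term \<open>\<nu> \<langle>\<Delta>u, v\<rangle>\<close> the dissipation absorbs
  \<open>\<nu> \<langle>\<nabla>u, \<nabla>ubar\<rangle>\<close> up to \<open>O(\<nu>)\<close> and leaves the wall integral of \<open>\<nu> \<omega> ubar\<^sub>1\<close>. The weight in the norm
  \<open>X(t)\<close> is at least \<open>sqrt \<nu>\<close>, so \<open>\<omega>\<close> is \<open>O(1 / sqrt \<nu>)\<close> on the wall and this integral is
  \<open>O(sqrt \<nu>)\<close>. Gronwall's inequality from time \<open>s > 0\<close> on, followed by \<open>s \<rightarrow> 0\<close>, gives the claim.
\<close>


section \<open>Absolutely summable Fourier coefficients\<close>

text \<open>The obstacle is that \<open>v\<close> does not vanish on the wall: the Navier-Stokes
  velocity does not slip, the Euler velocity may, so integrating the Laplacian by parts leaves a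
  boundary term that needs pointwise control of the vorticity at \<open>y = 0\<close>. The norm X(t)
  supplies it because it sums suprema of Fourier coefficients over all frequencies, with exponential
  factors at least 1; such a sum dominates the function itself, first for \<open>0 < y < 1\<close>
  and then on the wall by continuity. The squared L2 distance is then of order sqrt(\<nu>), the
  distance of order \<nu>^(1/4). The rest of the form comes from weak regularity at the ends. Euler
  gradients are bounded but need not have a trace at \<open>y = 0\<close>, only the gradients of the
  pressures are square integrable, and no pointwise decay for large \<open>y\<close> is given.
  Boundary fluxes are therefore shown to vanish only along well chosen sequences of heights.
  Likewise the viscous solution is classical only for positive times, so the common datum is reached
  through continuity in L2.\<close>

lemma integral_complex_of_real:
  fixes f :: "'a::euclidean_space \<Rightarrow> real"
  assumes "f integrable_on A"
  shows "integral A (\<lambda>x. complex_of_real (f x)) = complex_of_real (integral A f)"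
  using integral_linear[OF assms bounded_linear_of_real] by (simp add: o_def)

text \<open>For \<open>m \<noteq> 0\<close> the primitive takes equal values at \<open>-pi\<close>
  and \<open>pi\<close>. The shift lets the kernel below be centred at the point of
  evaluation.\<close>

lemma integral_cis_shifted:
  fixes m :: int and x0 :: real
  shows "integral {-pi..pi} (\<lambda>x. cis (of_int m * (x - x0))) = (if m = 0 then 2 * pi else 0)"
proof (cases "m = 0")
  case False
  have "((\<lambda>x. cis (of_int m * (x - x0))) has_integral
      cis (of_int m * (pi - x0)) / (\<i> * of_int m) - cis (of_int m * (- pi - x0)) / (\<i> * of_int m)) {-pi..pi}"
  proof (intro fundamental_theorem_of_calculus)
    fix x :: real
    have i_conj: "- (\<i> * (w * \<i>)) = w" for w
      by (simp add: complex_eq_iff)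
    have "((\<lambda>z. exp (\<i> * (of_int m * (z - of_real x0))) / (\<i> * of_int m)) has_field_derivative
        exp (\<i> * (of_int m * (of_real x - of_real x0)))) (at (of_real x))"
      using False by (auto intro!: derivative_eq_intros simp: i_conj)
    from has_vector_derivative_real_field[OF this]
    show "((\<lambda>x. cis (of_int m * (x - x0)) / (\<i> * of_int m)) has_vector_derivative cis (of_int m * (x - x0)))
        (at x within {-pi..pi})"
      by (simp add: cis_conv_exp)
  qed simp
  moreover have "cis (of_int m * (pi - x0)) = cis (of_int m * (- pi - x0))"
  proof -
    have "cis (of_int m * (pi - x0)) = cis (of_int m * (- pi - x0)) * cis (2 * pi * of_int m)"
      unfolding cis_mult by (simp add: algebra_simps)
    then show ?thesis by simp
  qed
  ultimately show ?thesis using False by (simp add: integral_unique)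
qed (simp add: scaleR_conv_of_real)

text \<open>
  The Fejer means of \<open>f\<close> at \<open>x0\<close> are bounded by \<open>S\<close> and converge to \<open>f x0\<close>. Since
  \<open>\<bar>f x0 - f x\<bar> \<le> \<epsilon> + C (1 - cos (x - x0))\<close>, the convergence reduces to the identity
  \<open>(1 - cos t) K\<^sub>N(t) = (1 - cos (N t)) / N\<close> for the Fejer kernel \<open>K\<^sub>N\<close>.
\<close>

lemma abs_le_sum_fourier_coefficients:
  fixes f :: "real \<Rightarrow> real" and c :: "int \<Rightarrow> complex"
  assumes f: "continuous_on {-pi..pi} f"
    and c: "\<And>\<xi>. c \<xi> = integral {-pi..pi} (\<lambda>x. f x *\<^sub>R cis (- of_int \<xi> * x)) / (2 * pi)"
    and S: "\<And>A. finite A \<Longrightarrow> (\<Sum>\<xi>\<in>A. cmod (c \<xi>)) \<le> S"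
    and x0: "x0 \<in> {-pi<..<pi}"
  shows "\<bar>f x0\<bar> \<le> S"
proof -
  \<comment> \<open>\<open>D\<close> is a geometric sum of \<open>N\<close> unit phases and
    \<open>K\<close> the Fejer kernel centred at \<open>x0\<close>, written as a squared modulus so
    that it is visibly nonnegative. For \<open>N = 0\<close> the division gives
    \<open>K = 0\<close>, hence the condition \<open>N > 0\<close> below.\<close>
  define D where "D = (\<lambda>N x. \<Sum>k<N. cis (of_nat k * (x - x0)))"
  define K where "K = (\<lambda>(N::nat) x. (cmod (D N x))\<^sup>2 / N)"
  have contD [continuous_intros]: "continuous_on A (D N)" for N A
    unfolding D_def by (intro continuous_intros)
  have contK [continuous_intros]: "continuous_on A (K N)" for N A
    unfolding K_def by (cases "N = 0") (auto intro!: continuous_intros)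
  have K_nonneg: "K N x \<ge> 0" for N x unfolding K_def by simp
  have K_eq: "complex_of_real (K N x) = (\<Sum>j<N. \<Sum>k<N. cis (of_int (int j - int k) * (x - x0))) / N" for N x
  proof -
    have "complex_of_real ((cmod (D N x))\<^sup>2) = D N x * cnj (D N x)"
      by (rule complex_norm_square)
    also have "\<dots> = (\<Sum>j<N. \<Sum>k<N. cis (of_nat j * (x - x0)) * cnj (cis (of_nat k * (x - x0))))"
      unfolding D_def by (simp add: sum_product)
    also have "\<dots> = (\<Sum>j<N. \<Sum>k<N. cis (of_int (int j - int k) * (x - x0)))"
      by (intro sum.cong refl) (simp add: cis_cnj cis_mult algebra_simps)
    finally show ?thesis unfolding K_def by simp
  qed
  have int_cis: "(\<lambda>x. cis (of_int m * (x - x0))) integrable_on {-pi..pi}" for m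
    by (intro integrable_continuous_interval continuous_intros)
  have int_fcis: "(\<lambda>x. f x *\<^sub>R cis (of_int m * (x - x0))) integrable_on {-pi..pi}" for m
    by (intro integrable_continuous_interval continuous_intros f)
  \<comment> \<open>Of the \<open>N * N\<close> phases only the \<open>N\<close> diagonal ones have
    frequency 0, which cancels the division by \<open>N\<close>.\<close>
  have mass: "integral {-pi..pi} (K N) = 2 * pi" if "N > 0" for N
  proof -
    have "complex_of_real (integral {-pi..pi} (K N)) = integral {-pi..pi} (\<lambda>x. complex_of_real (K N x))"
      by (rule integral_complex_of_real[symmetric]) (intro integrable_continuous_interval contK)
    also have "\<dots> = integral {-pi..pi} (\<lambda>x. (\<Sum>j<N. \<Sum>k<N. cis (of_int (int j - int k) * (x - x0))) / N)"
      by (simp only: K_eq)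
    also have "\<dots> = (\<Sum>j<N. \<Sum>k<N. integral {-pi..pi} (\<lambda>x. cis (of_int (int j - int k) * (x - x0)))) / N"
      by (simp only: integral_divide integral_sum integrable_sum finite_lessThan int_cis)
    also have "\<dots> = (\<Sum>j<N. \<Sum>k<N. if k = j then complex_of_real (2 * pi) else 0) / N"
      unfolding integral_cis_shifted by (intro arg_cong2[where f="(/)"] sum.cong refl) auto
    also have "\<dots> = complex_of_real (2 * pi)" using that by (simp add: sum.delta)
    finally show ?thesis unfolding of_real_eq_iff .
  qed
  \<comment> \<open>For fixed \<open>j\<close> the frequencies \<open>k - j\<close> are pairwise
    distinct, so the inner sum is at most \<open>S\<close>; averaging over the \<open>N\<close>
    values of \<open>j\<close> keeps that bound. The phase that recentres at \<open>x0\<close> has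
    modulus 1.\<close>
  have fK: "\<bar>integral {-pi..pi} (\<lambda>x. f x * K N x)\<bar> \<le> 2 * pi * S" if "N > 0" for N
  proof -
    have "complex_of_real (integral {-pi..pi} (\<lambda>x. f x * K N x))
        = integral {-pi..pi} (\<lambda>x. complex_of_real (f x * K N x))"
      by (rule integral_complex_of_real[symmetric])
        (intro integrable_continuous_interval continuous_on_mult f contK)
    also have "\<dots> = integral {-pi..pi} (\<lambda>x. (\<Sum>j<N. \<Sum>k<N. f x *\<^sub>R cis (of_int (int j - int k) * (x - x0))) / N)"
      by (simp only: of_real_mult K_eq times_divide_eq_right sum_distrib_left scaleR_conv_of_real)
    also have "\<dots> = (\<Sum>j<N. \<Sum>k<N. integral {-pi..pi} (\<lambda>x. f x *\<^sub>R cis (of_int (int j - int k) * (x - x0)))) / N"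
      by (simp only: integral_divide integral_sum integrable_sum finite_lessThan int_fcis)
    finally have "\<bar>integral {-pi..pi} (\<lambda>x. f x * K N x)\<bar> =
        cmod ((\<Sum>j<N. \<Sum>k<N. integral {-pi..pi} (\<lambda>x. f x *\<^sub>R cis (of_int (int j - int k) * (x - x0)))) / N)"
      by (metis norm_of_real real_norm_def)
    also have "\<dots> \<le> (\<Sum>j<N. \<Sum>k<N. cmod (integral {-pi..pi} (\<lambda>x. f x *\<^sub>R cis (of_int (int j - int k) * (x - x0))))) / N"
      unfolding norm_divide norm_of_nat
      by (intro divide_right_mono order.trans[OF norm_sum] sum_mono of_nat_0_le_iff order.refl)
    also have "\<dots> = (\<Sum>j<N. \<Sum>k<N. 2 * pi * cmod (c (int k - int j))) / N"
    proof -
      have "cmod (integral {-pi..pi} (\<lambda>x. f x *\<^sub>R cis (of_int m * (x - x0)))) = 2 * pi * cmod (c (- m))" for m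
      proof -
        have "(\<lambda>x. f x *\<^sub>R cis (of_int m * (x - x0)))
            = (\<lambda>x. cis (- of_int m * x0) * (f x *\<^sub>R cis (- of_int (- m) * x)))"
          by (intro ext) (simp add: cis_mult right_diff_distrib)
        then have "integral {-pi..pi} (\<lambda>x. f x *\<^sub>R cis (of_int m * (x - x0)))
            = cis (- of_int m * x0) * integral {-pi..pi} (\<lambda>x. f x *\<^sub>R cis (- of_int (- m) * x))"
          by (simp only: integral_mult_right)
        then show ?thesis by (simp add: c norm_mult norm_divide)
      qed
      from this[of "int _ - int _"] show ?thesis by (simp only: minus_diff_eq)
    qed
    also have "\<dots> \<le> (\<Sum>j<N. 2 * pi * S) / N"
    proof (intro divide_right_mono sum_mono)
      fix j :: nat
      have "(\<Sum>k<N. cmod (c (int k - int j))) = (\<Sum>\<xi>\<in>(\<lambda>k. int k - int j) ` {..<N}. cmod (c \<xi>))"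
        by (subst sum.reindex) (auto simp: inj_on_def)
      also have "\<dots> \<le> S" by (intro S) simp
      finally show "(\<Sum>k<N. 2 * pi * cmod (c (int k - int j))) \<le> 2 * pi * S"
        by (simp add: sum_distrib_left[symmetric])
    qed simp
    also have "\<dots> = 2 * pi * S" using that by simp
    finally show ?thesis .
  qed
  \<comment> \<open>Both factors are explicit: \<open>(1 - z) D = 1 - z ^ N\<close> has modulus at
    most 2, and \<open>|1 - z|^2 = 2 (1 - cos (x - x0))\<close>.\<close>
  have tail: "(1 - cos (x - x0)) * K N x \<le> 2 / N" for N x
  proof -
    define z where "z = cis (x - x0)"
    have "(1 - z) * D N x = 1 - z ^ N"
    proof -
      have "D N x = (\<Sum>k<N. z ^ k)" unfolding D_def z_def by (intro sum.cong refl) (simp only: Complex.DeMoivre)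
      then show ?thesis using sum_gp_basic[of z] by (cases N) (simp_all add: lessThan_Suc_atMost)
    qed
    moreover have "cmod (1 - z ^ N) \<le> 2"
      using norm_triangle_ineq4[of 1 "z ^ N"] by (simp add: norm_power z_def)
    ultimately have "(cmod (1 - z) * cmod (D N x))\<^sup>2 \<le> 2\<^sup>2"
      by (intro power_mono) (simp_all flip: norm_mult)
    moreover have "(cmod (1 - z))\<^sup>2 = 2 * (1 - cos (x - x0))"
      using sin_cos_squared_add[of "x - x0"]
      unfolding z_def cmod_power2 by (simp add: power2_eq_square algebra_simps)
    ultimately have "(1 - cos (x - x0)) * (cmod (D N x))\<^sup>2 \<le> 2" by (simp add: power_mult_distrib algebra_simps)
    then show ?thesis unfolding K_def by (simp add: divide_right_mono)
  qed
  have "\<bar>f x0\<bar> \<le> S + \<epsilon>" if "\<epsilon> > 0" for \<epsilon> :: real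
  proof -
    obtain C where C: "C \<ge> 0" "\<And>x. x \<in> {-pi..pi} \<Longrightarrow> \<bar>f x0 - f x\<bar> \<le> \<epsilon> / 2 + C * (1 - cos (x - x0))"
    proof -
      obtain \<delta> where \<delta>: "\<delta> > 0" "\<And>x. x \<in> {-pi..pi} \<Longrightarrow> \<bar>x - x0\<bar> < \<delta> \<Longrightarrow> \<bar>f x0 - f x\<bar> < \<epsilon> / 2"
      proof -
        have "x0 \<in> {-pi..pi}" "\<epsilon> / 2 > 0" using x0 \<open>\<epsilon> > 0\<close> by auto
        with f obtain \<delta> where "\<delta> > 0" "\<And>x. x \<in> {-pi..pi} \<Longrightarrow> dist x x0 < \<delta> \<Longrightarrow> dist (f x) (f x0) < \<epsilon> / 2"
          unfolding continuous_on_iff by blast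
        then show ?thesis using that by (simp add: dist_real_def abs_minus_commute)
      qed
      obtain B where B: "\<And>x. x \<in> {-pi..pi} \<Longrightarrow> \<bar>f x\<bar> \<le> B"
        using compact_imp_bounded[OF compact_continuous_image[OF f compact_Icc]]
        unfolding bounded_iff by (metis imageI real_norm_def)
      have B0: "B \<ge> 0" using B[of x0] x0 by auto
      \<comment> \<open>As \<open>x0\<close> is an interior point, \<open>|x - x0| < 2 pi\<close> on
        the whole interval, so \<open>1 - cos (x - x0)\<close> vanishes there only at
        \<open>x0\<close> and has a positive minimum \<open>m\<close> off the ball. With
        \<open>|f| \<le> B\<close>, the constant \<open>C = 2 B / m\<close> works.\<close>
      let ?A = "{-pi..pi} - ball x0 \<delta>"
      have "\<exists>m>0. \<forall>x\<in>?A. m \<le> 1 - cos (x - x0)"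
      proof (cases "?A = {}")
        case False
        have "compact ?A" by (intro compact_diff compact_Icc open_ball)
        moreover have "continuous_on ?A (\<lambda>x. 1 - cos (x - x0))" by (intro continuous_intros)
        ultimately obtain a where a: "a \<in> ?A" "\<forall>x\<in>?A. 1 - cos (a - x0) \<le> 1 - cos (x - x0)"
          using continuous_attains_inf[OF _ False] by metis
        have "\<bar>a - x0\<bar> < 2 * pi" "a - x0 \<noteq> 0" using a x0 \<delta>(1) by auto
        then have "cos (a - x0) \<noteq> 1"
        proof -
          assume *: "\<bar>a - x0\<bar> < 2 * pi" "a - x0 \<noteq> 0"
          show ?thesis
          proof
            assume "cos (a - x0) = 1"
            then obtain n :: int where n: "a - x0 = of_int n * (2 * pi)"
              using cos_one_2pi_int by auto
            then have "\<bar>of_int n :: real\<bar> < 1" using *(1) by (simp add: abs_mult)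
            then have "n = 0" by linarith
            with n * show False by simp
          qed
        qed
        then have "1 - cos (a - x0) > 0" using cos_le_one[of "a - x0"] by linarith
        with a show ?thesis by blast
      qed (auto intro: exI[of _ 1])
      then obtain m where m: "m > 0" "\<And>x. x \<in> ?A \<Longrightarrow> m \<le> 1 - cos (x - x0)" by blast
      have "\<bar>f x0 - f x\<bar> \<le> \<epsilon> / 2 + 2 * B / m * (1 - cos (x - x0))" if x: "x \<in> {-pi..pi}" for x
      proof (cases "\<bar>x - x0\<bar> < \<delta>")
        case True
        have "0 \<le> 2 * B / m * (1 - cos (x - x0))" using B0 m(1) by simp
        with \<delta>(2)[OF x True] show ?thesis by linarith
      next
        case False
        then have "x \<in> ?A" using x by (auto simp: dist_real_def)
        then have "2 * B / m * m \<le> 2 * B / m * (1 - cos (x - x0))"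
          using m B0 by (intro mult_left_mono) auto
        moreover have "\<bar>f x0 - f x\<bar> \<le> 2 * B" using B[OF x] B[of x0] x0 by auto
        ultimately show ?thesis using m(1) \<open>\<epsilon> > 0\<close> by simp
      qed
      moreover have "2 * B / m \<ge> 0" using m B0 by simp
      ultimately show ?thesis using that by blast
    qed
    obtain N :: nat where N: "N > 0" "2 * C / N < \<epsilon> / 2"
    proof -
      obtain N :: nat where N: "max 1 (4 * C / \<epsilon>) < N" using reals_Archimedean2 by blast
      then have "N > 0" by (intro gr0I) auto
      with N show ?thesis using that[of N] \<open>\<epsilon> > 0\<close> by (simp add: field_simps)
    qed
    have iK: "K N integrable_on {-pi..pi}" "(\<lambda>x. f x * K N x) integrable_on {-pi..pi}"
      by (intro integrable_continuous_interval continuous_intros f)+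
    have "2 * pi * f x0 - integral {-pi..pi} (\<lambda>x. f x * K N x)
        = integral {-pi..pi} (\<lambda>x. f x0 * K N x - f x * K N x)"
      by (subst integral_diff) (use iK mass[OF N(1)] in \<open>simp_all add: integrable_on_mult_right\<close>)
    moreover have "\<bar>\<dots>\<bar> \<le> integral {-pi..pi} (\<lambda>x. \<epsilon> / 2 * K N x + C * (2 / N))"
    proof (subst real_norm_def[symmetric], rule integral_norm_bound_integral)
      show "(\<lambda>x. f x0 * K N x - f x * K N x) integrable_on {-pi..pi}"
        by (intro integrable_continuous_interval continuous_intros f)
      show "(\<lambda>x. \<epsilon> / 2 * K N x + C * (2 / N)) integrable_on {-pi..pi}"
        by (intro integrable_continuous_interval continuous_intros)
      fix x assume x: "x \<in> {-pi..pi}"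
      have "norm (f x0 * K N x - f x * K N x) = \<bar>f x0 - f x\<bar> * K N x"
        using K_nonneg by (simp add: abs_mult flip: left_diff_distrib)
      also have "\<dots> \<le> (\<epsilon> / 2 + C * (1 - cos (x - x0))) * K N x"
        using C(2)[OF x] K_nonneg by (intro mult_right_mono)
      also have "\<dots> = \<epsilon> / 2 * K N x + C * ((1 - cos (x - x0)) * K N x)" by (simp add: algebra_simps)
      also have "\<dots> \<le> \<epsilon> / 2 * K N x + C * (2 / N)"
        using tail C(1) by (intro add_left_mono mult_left_mono)
      finally show "norm (f x0 * K N x - f x * K N x) \<le> \<epsilon> / 2 * K N x + C * (2 / N)" .
    qed
    moreover have "integral {-pi..pi} (\<lambda>x. \<epsilon> / 2 * K N x + C * (2 / N)) = \<epsilon> / 2 * (2 * pi) + 2 * pi * (C * (2 / N))"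
      by (subst integral_add) (use iK mass[OF N(1)] in \<open>simp_all add: integrable_on_mult_right integrable_const_ivl\<close>)
    ultimately have "2 * pi * \<bar>f x0\<bar> \<le> 2 * pi * S + (\<epsilon> / 2 * (2 * pi) + 2 * pi * (C * (2 / N)))"
      using fK[OF N(1)] abs_mult[of "2 * pi" "f x0"] by simp
    also have "\<dots> = 2 * pi * (S + (\<epsilon> / 2 + 2 * C / N))" by (simp add: algebra_simps)
    also have "\<dots> \<le> 2 * pi * (S + \<epsilon>)" using N(2) by (intro mult_left_mono) auto
    finally show ?thesis by simp
  qed
  then show ?thesis by (rule field_le_epsilon)
qed


section \<open>Integration over the half-plane\<close>

text \<open>
  Derivatives of the Euler velocity need not extend continuously to the wall, so regularity is only
  required for \<open>y > 0\<close>; the predicates \<open>hp_L1\<close> and \<open>hp_L2\<close> include continuity there.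
\<close>

definition hp_cont :: "(real \<Rightarrow> real \<Rightarrow> 'a::topological_space) \<Rightarrow> bool" where
  "hp_cont f \<longleftrightarrow> continuous_on (UNIV \<times> {0<..}) (\<lambda>q. f (fst q) (snd q))"

definition hp_L1 :: "sfield \<Rightarrow> bool" where
  "hp_L1 f \<longleftrightarrow> hp_cont f \<and> set_integrable lborel ({-pi..pi} \<times> {0<..}) (\<lambda>q. f (fst q) (snd q))"

definition hp_int :: "sfield \<Rightarrow> real" where
  "hp_int f = set_lebesgue_integral lborel ({-pi..pi} \<times> {0<..}) (\<lambda>q. f (fst q) (snd q))"

definition hp_L2 :: "(real \<Rightarrow> real \<Rightarrow> 'a::real_normed_vector) \<Rightarrow> bool" where
  "hp_L2 f \<longleftrightarrow> hp_cont f \<and> hp_L1 (\<lambda>x y. (norm (f x y))\<^sup>2)"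

section \<open>Closure properties of continuity, integrability and square integrability\<close>

lemma strip_sets [measurable]: "({-pi..pi} \<times> {0<..} :: (real \<times> real) set) \<in> sets borel"
  by (intro borel_Times) auto

lemma hp_cont_subset: "hp_cont f \<Longrightarrow> A \<subseteq> UNIV \<times> {0<..} \<Longrightarrow> continuous_on A (\<lambda>q. f (fst q) (snd q))"
  unfolding hp_cont_def by (rule continuous_on_subset)

lemma hp_cont_intros:
  fixes f g :: "real \<Rightarrow> real \<Rightarrow> 'a::real_normed_vector" and h :: sfield
    and v w :: "real \<Rightarrow> real \<Rightarrow> 'b::real_inner" and p :: "real \<Rightarrow> real \<Rightarrow> 'c::topological_space \<times> 'd::topological_space"
  shows "hp_cont f \<Longrightarrow> hp_cont g \<Longrightarrow> hp_cont (\<lambda>x y. f x y + g x y)"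
    "hp_cont f \<Longrightarrow> hp_cont g \<Longrightarrow> hp_cont (\<lambda>x y. f x y - g x y)"
    "hp_cont f \<Longrightarrow> hp_cont (\<lambda>x y. - f x y)"
    "hp_cont h \<Longrightarrow> hp_cont f \<Longrightarrow> hp_cont (\<lambda>x y. h x y *\<^sub>R f x y)"
    "hp_cont f \<Longrightarrow> hp_cont (\<lambda>x y. norm (f x y))"
    "hp_cont v \<Longrightarrow> hp_cont w \<Longrightarrow> hp_cont (\<lambda>x y. v x y \<bullet> w x y)"
    "hp_cont p \<Longrightarrow> hp_cont (\<lambda>x y. fst (p x y))"
    "hp_cont p \<Longrightarrow> hp_cont (\<lambda>x y. snd (p x y))"
    "hp_cont (\<lambda>x y. c)"
  unfolding hp_cont_def by (intro continuous_intros; assumption)+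

lemma hp_cont_mult:
  fixes g h :: sfield
  shows "hp_cont g \<Longrightarrow> hp_cont h \<Longrightarrow> hp_cont (\<lambda>x y. g x y * h x y)"
    "hp_cont g \<Longrightarrow> hp_cont (\<lambda>x y. (g x y) ^ n)"
  unfolding hp_cont_def by (intro continuous_intros; assumption)+

lemma hp_cont_Pair:
  "hp_cont g \<Longrightarrow> hp_cont h \<Longrightarrow> hp_cont (\<lambda>x y. (g x y, h x y))"
  unfolding hp_cont_def by (intro continuous_intros; assumption)

lemmas hp_cont_rules = hp_cont_intros hp_cont_mult hp_cont_Pair

lemma hp_cont_cong:
  assumes "\<And>x y. y > 0 \<Longrightarrow> f x y = g x y"
  shows "hp_cont f \<longleftrightarrow> hp_cont g"
  unfolding hp_cont_def by (rule continuous_on_cong) (use assms in auto)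

lemma hp_cont_measurable:
  fixes f :: sfield
  assumes "hp_cont f"
  shows "set_borel_measurable lborel ({-pi..pi} \<times> {0<..}) (\<lambda>q. f (fst q) (snd q))"
  using set_measurable_continuous_on[OF strip_sets hp_cont_subset[OF assms]]
  by (auto simp: set_borel_measurable_def)

lemma hp_L1_cont: "hp_L1 f \<Longrightarrow> hp_cont f"
  by (simp add: hp_L1_def)

lemma hp_L1_bound:
  assumes "hp_cont f" "hp_L1 g" "\<And>x y. y > 0 \<Longrightarrow> \<bar>f x y\<bar> \<le> g x y"
  shows "hp_L1 f"
  unfolding hp_L1_def
proof
  show "set_integrable lborel ({-pi..pi} \<times> {0<..}) (\<lambda>q. f (fst q) (snd q))"
  proof (rule set_integrable_bound)
    show "set_integrable lborel ({-pi..pi} \<times> {0<..}) (\<lambda>q. g (fst q) (snd q))"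
      using assms(2) by (simp add: hp_L1_def)
    show "AE q\<in>{-pi..pi} \<times> {0<..} in lborel. norm (f (fst q) (snd q)) \<le> norm (g (fst q) (snd q))"
      using assms(3) by (auto intro!: AE_I2 order.trans[OF assms(3) abs_ge_self])
  qed (rule hp_cont_measurable[OF assms(1)])
qed (rule assms(1))

lemma hp_L1_add: "hp_L1 f \<Longrightarrow> hp_L1 g \<Longrightarrow> hp_L1 (\<lambda>x y. f x y + g x y)"
  unfolding hp_L1_def by (auto intro: hp_cont_rules set_integral_add)

lemma hp_L1_diff: "hp_L1 f \<Longrightarrow> hp_L1 g \<Longrightarrow> hp_L1 (\<lambda>x y. f x y - g x y)"
  unfolding hp_L1_def by (auto intro: hp_cont_rules set_integral_diff)

lemma hp_L1_cmult: "hp_L1 f \<Longrightarrow> hp_L1 (\<lambda>x y. c * f x y)"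
  unfolding hp_L1_def by (auto intro: hp_cont_rules set_integrable_mult_right)

lemma hp_int_add: "hp_L1 f \<Longrightarrow> hp_L1 g \<Longrightarrow> hp_int (\<lambda>x y. f x y + g x y) = hp_int f + hp_int g"
  unfolding hp_L1_def hp_int_def by (simp add: set_integral_add)

lemma hp_int_diff: "hp_L1 f \<Longrightarrow> hp_L1 g \<Longrightarrow> hp_int (\<lambda>x y. f x y - g x y) = hp_int f - hp_int g"
  unfolding hp_L1_def hp_int_def by (simp add: set_integral_diff)

lemma hp_int_cmult: "hp_int (\<lambda>x y. c * f x y) = c * hp_int f"
  unfolding hp_int_def by (simp add: set_integral_mult_right)

lemma hp_int_mono:
  "hp_L1 f \<Longrightarrow> hp_L1 g \<Longrightarrow> (\<And>x y. y > 0 \<Longrightarrow> f x y \<le> g x y) \<Longrightarrow> hp_int f \<le> hp_int g"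
  unfolding hp_L1_def hp_int_def by (intro set_integral_mono) auto

lemma hp_int_cong:
  "(\<And>x y. y > 0 \<Longrightarrow> f x y = g x y) \<Longrightarrow> hp_int f = hp_int g"
  unfolding hp_int_def by (intro set_lebesgue_integral_cong) auto

lemma hp_L1_cong:
  assumes "\<And>x y. y > 0 \<Longrightarrow> f x y = g x y"
  shows "hp_L1 f \<longleftrightarrow> hp_L1 g"
  using hp_cont_cong[of f g] set_integrable_cong[of lborel lborel "{-pi..pi} \<times> {0<..}" _
      "\<lambda>q. f (fst q) (snd q)" "\<lambda>q. g (fst q) (snd q)"] assms
  unfolding hp_L1_def by auto

lemma hp_int_nonneg: "(\<And>x y. y > 0 \<Longrightarrow> 0 \<le> f x y) \<Longrightarrow> 0 \<le> hp_int f"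
  unfolding hp_int_def set_lebesgue_integral_def
  by (intro integral_nonneg_AE AE_I2) (auto simp: indicator_def)

lemma hp_L2_cont: "hp_L2 f \<Longrightarrow> hp_cont f"
  by (simp add: hp_L2_def)

lemma hp_L2_L1: "hp_L2 f \<Longrightarrow> hp_L1 (\<lambda>x y. (norm (f x y))\<^sup>2)"
  by (simp add: hp_L2_def)

lemma hp_L2_bound:
  assumes "hp_cont f" "hp_L1 g" "\<And>x y. y > 0 \<Longrightarrow> (norm (f x y))\<^sup>2 \<le> g x y"
  shows "hp_L2 f"
  unfolding hp_L2_def
  by (intro conjI assms hp_L1_bound[OF _ assms(2)] hp_cont_rules) (use assms(3) in auto)

lemma inner_le_sum_squares: "\<bar>a \<bullet> b\<bar> \<le> ((norm a)\<^sup>2 + (norm b)\<^sup>2) / 2"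
  for a b :: "'a::real_inner"
  using Cauchy_Schwarz_ineq2[of a b] sum_squares_bound[of "norm a" "norm b"] by simp

lemma hp_L2_inner:
  fixes f g :: "real \<Rightarrow> real \<Rightarrow> 'a::real_inner"
  assumes "hp_L2 f" "hp_L2 g"
  shows "hp_L1 (\<lambda>x y. f x y \<bullet> g x y)"
proof (rule hp_L1_bound)
  show "hp_L1 (\<lambda>x y. 1/2 * ((norm (f x y))\<^sup>2 + (norm (g x y))\<^sup>2))"
    by (intro hp_L1_cmult hp_L1_add hp_L2_L1 assms)
  show "hp_cont (\<lambda>x y. f x y \<bullet> g x y)" by (intro hp_cont_rules hp_L2_cont assms)
qed (use inner_le_sum_squares in auto)

lemma norm_add_square_le: "(norm (a + b))\<^sup>2 \<le> 2 * ((norm a)\<^sup>2 + (norm b)\<^sup>2)"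
proof -
  have "(norm (a + b))\<^sup>2 \<le> (norm a + norm b)\<^sup>2" by (intro power_mono norm_triangle_ineq) simp
  also have "\<dots> \<le> 2 * ((norm a)\<^sup>2 + (norm b)\<^sup>2)"
    using sum_squares_bound[of "norm a" "norm b"] by (simp add: power2_sum)
  finally show ?thesis .
qed

lemma hp_L2_add:
  assumes "hp_L2 f" "hp_L2 g"
  shows "hp_L2 (\<lambda>x y. f x y + g x y)"
proof (rule hp_L2_bound)
  show "hp_L1 (\<lambda>x y. 2 * ((norm (f x y))\<^sup>2 + (norm (g x y))\<^sup>2))"
    by (intro hp_L1_cmult hp_L1_add hp_L2_L1 assms)
  show "hp_cont (\<lambda>x y. f x y + g x y)" by (intro hp_cont_rules hp_L2_cont assms)
qed (rule norm_add_square_le)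

lemma hp_L2_scaleR_bounded:
  assumes "hp_cont h" "hp_L2 f" "\<And>x y. y > 0 \<Longrightarrow> \<bar>h x y\<bar> \<le> B"
  shows "hp_L2 (\<lambda>x y. h x y *\<^sub>R f x y)"
proof (rule hp_L2_bound)
  show "hp_L1 (\<lambda>x y. B\<^sup>2 * (norm (f x y))\<^sup>2)" by (intro hp_L1_cmult hp_L2_L1 assms)
  show "hp_cont (\<lambda>x y. h x y *\<^sub>R f x y)" by (intro hp_cont_rules hp_L2_cont assms)
  show "(norm (h x y *\<^sub>R f x y))\<^sup>2 \<le> B\<^sup>2 * (norm (f x y))\<^sup>2" if "y > 0" for x y
    using power_mono[OF assms(3)[OF that, of x] abs_ge_zero, of 2] by (simp add: power_mult_distrib mult_right_mono)
qed

lemma hp_L2_cscale: "hp_L2 f \<Longrightarrow> hp_L2 (\<lambda>x y. c *\<^sub>R f x y)"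
  by (rule hp_L2_scaleR_bounded[where B="\<bar>c\<bar>"]) (auto intro: hp_cont_rules)

lemma hp_L2_diff:
  assumes "hp_L2 f" "hp_L2 g"
  shows "hp_L2 (\<lambda>x y. f x y - g x y)"
  using hp_L2_add[OF assms(1) hp_L2_cscale[OF assms(2), of "-1"]] by simp

lemma hp_L2_le:
  assumes "hp_cont f" "hp_L2 g" "\<And>x y. y > 0 \<Longrightarrow> norm (f x y) \<le> norm (g x y)"
  shows "hp_L2 f"
  by (rule hp_L2_bound[OF assms(1) hp_L2_L1[OF assms(2)]]) (simp add: assms(3) power_mono)

lemma norm_fst_snd_le: "norm (fst p) \<le> norm p" "norm (snd p) \<le> norm p"
  by (metis norm_fst_le prod.collapse, metis norm_snd_le prod.collapse)

lemma hp_L2_fst_snd: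
  assumes "hp_L2 f"
  shows "hp_L2 (\<lambda>x y. fst (f x y))" "hp_L2 (\<lambda>x y. snd (f x y))"
proof -
  show "hp_L2 (\<lambda>x y. fst (f x y))"
    by (rule hp_L2_le[OF _ assms]) (auto intro!: hp_cont_rules hp_L2_cont[OF assms] norm_fst_snd_le)
  show "hp_L2 (\<lambda>x y. snd (f x y))"
    by (rule hp_L2_le[OF _ assms]) (auto intro!: hp_cont_rules hp_L2_cont[OF assms] norm_fst_snd_le)
qed

section \<open>Exhaustion of the half-plane by boxes\<close>

lemma hp_box_eq_iterated:
  assumes "hp_cont f" "0 < a"
  shows "integral (cbox (-pi, a) (pi, b)) (\<lambda>q. f (fst q) (snd q))
      = integral {a..b} (\<lambda>y. integral {-pi..pi} (\<lambda>x. f x y) :: real)"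
proof -
  have c: "continuous_on (cbox (-pi, a) (pi, b)) (\<lambda>q. f (fst q) (snd q))"
    by (rule hp_cont_subset[OF assms(1)]) (use assms(2) in auto)
  show ?thesis
    using integral_prod_continuous[OF c] integral_swap_continuous[of "-pi" a pi b f] c
    by (simp add: split_beta)
qed

lemma hp_box_set_integral:
  fixes f :: sfield
  assumes "hp_cont f" "0 < a"
  shows "set_integrable lborel (cbox (-pi, a) (pi, b)) (\<lambda>q. f (fst q) (snd q))"
    and "set_lebesgue_integral lborel (cbox (-pi, a) (pi, b)) (\<lambda>q. f (fst q) (snd q))
      = integral (cbox (-pi, a) (pi, b)) (\<lambda>q. f (fst q) (snd q))"
proof -
  have c: "continuous_on (cbox (-pi, a) (pi, b)) (\<lambda>q. f (fst q) (snd q))"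
    by (rule hp_cont_subset[OF assms(1)]) (use assms(2) in auto)
  show *: "set_integrable lborel (cbox (-pi, a) (pi, b)) (\<lambda>q. f (fst q) (snd q))"
    unfolding set_integrable_def by (rule borel_integrable_compact[OF compact_cbox c])
  show "set_lebesgue_integral lborel (cbox (-pi, a) (pi, b)) (\<lambda>q. f (fst q) (snd q))
      = integral (cbox (-pi, a) (pi, b)) (\<lambda>q. f (fst q) (snd q))"
    by (rule set_borel_integral_eq_integral(2)[OF *])
qed

lemma hp_box_le:
  assumes "hp_L1 f" "\<And>x y. y > 0 \<Longrightarrow> 0 \<le> f x y" "0 < a"
  shows "integral (cbox (-pi, a) (pi, b)) (\<lambda>q. f (fst q) (snd q)) \<le> hp_int f"
proof -
  note c = hp_box_set_integral[OF hp_L1_cont[OF assms(1)] assms(3), of b]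
  have "set_lebesgue_integral lborel (cbox (-pi, a) (pi, b)) (\<lambda>q. f (fst q) (snd q)) \<le> hp_int f"
    using c(1) assms(1) unfolding hp_int_def set_lebesgue_integral_def set_integrable_def hp_L1_def
    by (intro integral_mono) (use assms in \<open>auto simp: indicator_def\<close>)
  then show ?thesis using c by simp
qed

text \<open>\<open>|f|\<close> on the strip dominates all truncations, and every point of the open
  strip eventually lies in the boxes. The sequences \<open>a\<close> and \<open>b\<close> need not
  be monotone, so that they can be chosen later along heights where a flux is small.\<close>

lemma hp_box_tendsto:
  assumes "hp_L1 f" and a: "\<And>n. 0 < a n" "a \<longlonglongrightarrow> 0" and b: "filterlim b at_top sequentially"
  shows "(\<lambda>n. integral (cbox (-pi, a n) (pi, b n)) (\<lambda>q. f (fst q) (snd q))) \<longlonglongrightarrow> hp_int f"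
proof -
  let ?f = "\<lambda>q. f (fst q) (snd q)"
  let ?H = "{-pi..pi} \<times> {0<..} :: (real \<times> real) set"
  have int: "integrable lborel (\<lambda>q. indicator ?H q *\<^sub>R ?f q)"
    using assms(1) by (simp add: hp_L1_def set_integrable_def)
  have "(\<lambda>n. \<integral>q. indicator (cbox (-pi, a n) (pi, b n)) q *\<^sub>R ?f q \<partial>lborel)
      \<longlonglongrightarrow> (\<integral>q. indicator ?H q *\<^sub>R ?f q \<partial>lborel)"
  proof (rule integral_dominated_convergence)
    show "integrable lborel (\<lambda>q. norm (indicator ?H q *\<^sub>R ?f q))" using int by simp
    show "(\<lambda>q. indicator ?H q *\<^sub>R ?f q) \<in> borel_measurable lborel" using int by simp
    show "(\<lambda>q. indicator (cbox (-pi, a n) (pi, b n)) q *\<^sub>R ?f q) \<in> borel_measurable lborel" for n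
      using hp_box_set_integral(1)[OF hp_L1_cont[OF assms(1)] a(1), of n "b n"]
      by (simp add: set_integrable_def)
    show "AE q in lborel. norm (indicator (cbox (-pi, a n) (pi, b n)) q *\<^sub>R ?f q) \<le> norm (indicator ?H q *\<^sub>R ?f q)" for n
      using a(1)[of n] by (intro AE_I2) (auto simp: indicator_def)
    show "AE q in lborel. (\<lambda>n. indicator (cbox (-pi, a n) (pi, b n)) q *\<^sub>R ?f q) \<longlonglongrightarrow> indicator ?H q *\<^sub>R ?f q"
    proof (intro AE_I2)
      fix q :: "real \<times> real"
      show "(\<lambda>n. indicator (cbox (-pi, a n) (pi, b n)) q *\<^sub>R ?f q) \<longlonglongrightarrow> indicator ?H q *\<^sub>R ?f q"
      proof (cases "snd q > 0")
        case True
        have "eventually (\<lambda>n. a n < snd q) sequentially" by (rule order_tendstoD(2)[OF a(2) True])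
        moreover have "eventually (\<lambda>n. b n \<ge> snd q) sequentially"
          using b by (simp add: filterlim_at_top)
        ultimately have "eventually (\<lambda>n. indicator (cbox (-pi, a n) (pi, b n)) q *\<^sub>R ?f q = indicator ?H q *\<^sub>R ?f q) sequentially"
          by eventually_elim (use True in \<open>auto simp: indicator_def mem_Times_iff cbox_Pair_eq\<close>)
        then show ?thesis by (rule tendsto_eventually)
      next
        case False
        then have "q \<notin> cbox (-pi, a n) (pi, b n)" for n
          using a(1)[of n] by (auto simp: mem_Times_iff cbox_Pair_eq)
        then show ?thesis using False by (auto simp: indicator_def)
      qed
    qed
  qed
  then show ?thesis
    using hp_box_set_integral(2)[OF hp_L1_cont[OF assms(1)] a(1)]
    by (simp add: set_lebesgue_integral_def hp_int_def)
qed

section \<open>Comparison with the extended-valued L2 norm\<close>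

lemma wall_null: "{-pi..pi} \<times> {0::real} \<in> null_sets (lborel :: (real \<times> real) measure)"
proof -
  have "emeasure (lborel \<Otimes>\<^sub>M lborel) ({-pi..pi} \<times> {0::real}) = emeasure lborel {-pi..pi} * emeasure lborel {0::real}"
    by (rule lborel.emeasure_pair_measure_Times) auto
  moreover have "{-pi..pi} \<times> {0::real} \<in> sets (lborel \<Otimes>\<^sub>M lborel)" by auto
  ultimately show ?thesis unfolding lborel_prod by (simp add: null_sets_def)
qed

text \<open>\<open>L2_norm\<close> integrates over the strip closed at \<open>y = 0\<close>, whereas
  regularity is available on the open one; they differ by a null set.\<close>

lemma L2_norm_eq_strip:
  "L2_norm f = ennsqrt (\<integral>\<^sup>+ q. ennreal (indicator ({-pi..pi} \<times> {0<..}) q *\<^sub>R (norm (f (fst q) (snd q)))\<^sup>2) \<partial>lborel)"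
proof -
  have "(\<integral>\<^sup>+ q \<in> {-pi..pi} \<times> {0..}. ennreal ((norm (f (fst q) (snd q)))\<^sup>2) \<partial>lborel)
      = (\<integral>\<^sup>+ q. ennreal (indicator ({-pi..pi} \<times> {0<..}) q *\<^sub>R (norm (f (fst q) (snd q)))\<^sup>2) \<partial>lborel)"
  proof (rule nn_integral_cong_AE)
    have "AE q in lborel. q \<notin> {-pi..pi} \<times> {0::real}" by (rule AE_not_in[OF wall_null])
    then show "AE q in lborel. ennreal ((norm (f (fst q) (snd q)))\<^sup>2) * indicator ({-pi..pi} \<times> {0..}) q
        = ennreal (indicator ({-pi..pi} \<times> {0<..}) q *\<^sub>R (norm (f (fst q) (snd q)))\<^sup>2)"
      by eventually_elim (auto simp: indicator_def mem_Times_iff)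
  qed
  then show ?thesis unfolding L2_norm_def by simp
qed

lemma ennsqrt_less_top: "ennsqrt a < top \<longleftrightarrow> a < top"
  by (auto simp: ennsqrt_def less_top)

lemma hp_L2_if_L2_norm:
  assumes "hp_cont f" "L2_norm f < \<infinity>"
  shows "hp_L2 f"
proof -
  have c: "hp_cont (\<lambda>x y. (norm (f x y))\<^sup>2)" by (intro hp_cont_rules assms)
  have "set_integrable lborel ({-pi..pi} \<times> {0<..}) (\<lambda>q. (norm (f (fst q) (snd q)))\<^sup>2)"
    unfolding set_integrable_def
  proof (rule integrableI_nonneg)
    show "(\<lambda>q. indicator ({-pi..pi} \<times> {0<..}) q *\<^sub>R (norm (f (fst q) (snd q)))\<^sup>2) \<in> borel_measurable lborel"
      using hp_cont_measurable[OF c] by (simp add: set_borel_measurable_def)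
    show "(\<integral>\<^sup>+ q. ennreal (indicator ({-pi..pi} \<times> {0<..}) q *\<^sub>R (norm (f (fst q) (snd q)))\<^sup>2) \<partial>lborel) < \<infinity>"
      using assms(2) unfolding L2_norm_eq_strip by (simp add: ennsqrt_less_top)
  qed simp
  with c assms show ?thesis by (simp add: hp_L2_def hp_L1_def)
qed

lemma L2_norm_eq:
  assumes "hp_L2 f"
  shows "L2_norm f = ennreal (sqrt (hp_int (\<lambda>x y. (norm (f x y))\<^sup>2)))"
proof -
  have "(\<integral>\<^sup>+ q. ennreal (indicator ({-pi..pi} \<times> {0<..}) q *\<^sub>R (norm (f (fst q) (snd q)))\<^sup>2) \<partial>lborel)
      = ennreal (hp_int (\<lambda>x y. (norm (f x y))\<^sup>2))"
    unfolding hp_int_def set_lebesgue_integral_def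
    by (rule nn_integral_eq_integral) (use assms in \<open>auto simp: hp_L2_def hp_L1_def set_integrable_def\<close>)
  moreover have "0 \<le> hp_int (\<lambda>x y. (norm (f x y))\<^sup>2)" by (rule hp_int_nonneg) simp
  ultimately show ?thesis unfolding L2_norm_eq_strip by (simp add: ennsqrt_def)
qed

lemma L2_norm_bound:
  assumes "hp_cont f" "L2_norm f \<le> ennreal B"
  shows "hp_L2 f" "hp_int (\<lambda>x y. (norm (f x y))\<^sup>2) \<le> B\<^sup>2"
proof -
  show *: "hp_L2 f" by (rule hp_L2_if_L2_norm[OF assms(1)]) (use assms(2) le_less_trans in fastforce)
  have nn: "0 \<le> hp_int (\<lambda>x y. (norm (f x y))\<^sup>2)" by (rule hp_int_nonneg) simp
  show "hp_int (\<lambda>x y. (norm (f x y))\<^sup>2) \<le> B\<^sup>2"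
  proof (cases "B \<ge> 0")
    case True
    then have "sqrt (hp_int (\<lambda>x y. (norm (f x y))\<^sup>2)) \<le> B"
      using assms(2) unfolding L2_norm_eq[OF *] by (simp add: ennreal_le_iff)
    then show ?thesis using nn real_le_lsqrt sqrt_le_D by blast
  next
    \<comment> \<open>A negative \<open>B\<close> makes \<open>ennreal B\<close> equal to 0, so the
      norm itself vanishes.\<close>
    case False
    then have "ennreal (sqrt (hp_int (\<lambda>x y. (norm (f x y))\<^sup>2))) = 0"
      using assms(2) unfolding L2_norm_eq[OF *] by (simp add: ennreal_neg)
    then have "hp_int (\<lambda>x y. (norm (f x y))\<^sup>2) = 0" using nn by simp
    then show ?thesis by simp
  qed
qed

text \<open>Cauchy-Schwarz against the constant 1, read off from the nonnegative integral of
  \<open>(f - m)^2\<close>, where \<open>m\<close> is the mean of \<open>f\<close>.\<close>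

lemma integral_square_le:
  fixes f :: "real \<Rightarrow> real"
  assumes f: "continuous_on {a..b} f" and "a < b"
  shows "(integral {a..b} f)\<^sup>2 \<le> (b - a) * integral {a..b} (\<lambda>x. (f x)\<^sup>2)"
proof -
  define m where "m = integral {a..b} f / (b - a)"
  have i: "f integrable_on {a..b}" "(\<lambda>x. (f x)\<^sup>2) integrable_on {a..b}"
    by (intro integrable_continuous_interval continuous_intros f)+
  have "0 \<le> integral {a..b} (\<lambda>x. (f x - m)\<^sup>2)"
    by (rule integral_nonneg) (auto intro!: integrable_continuous_interval continuous_intros f)
  also have "(\<lambda>x. (f x - m)\<^sup>2) = (\<lambda>x. ((f x)\<^sup>2 - (2 * m) * f x) + m\<^sup>2)"
    by (auto simp: power2_eq_square algebra_simps)
  also have "integral {a..b} \<dots> = integral {a..b} (\<lambda>x. (f x)\<^sup>2) - 2 * m * integral {a..b} f + (b - a) * m\<^sup>2"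
    using i \<open>a < b\<close>
    by (subst integral_add) (auto simp: integral_diff integrable_diff integrable_on_mult_right integrable_const_ivl)
  finally have "(b - a) * (2 * m * integral {a..b} f - (b - a) * m\<^sup>2) \<le> (b - a) * integral {a..b} (\<lambda>x. (f x)\<^sup>2)"
    using \<open>a < b\<close> by (intro mult_left_mono) auto
  moreover have "(b - a) * (2 * m * integral {a..b} f - (b - a) * m\<^sup>2) = (integral {a..b} f)\<^sup>2"
  proof -
    have m: "integral {a..b} f = (b - a) * m" using \<open>a < b\<close> by (simp add: m_def)
    show ?thesis unfolding m by (simp add: power2_eq_square algebra_simps)
  qed
  ultimately show ?thesis by simp
qed


section \<open>The divergence theorem on the half-plane\<close>

text \<open>The partial derivatives are arguments instead of values of \<open>dx\<close> and
  \<open>dy\<close>, so the sum and product rules below produce the derivatives of composite fluxes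
  as explicit terms.\<close>

definition hp_C1 :: "(real \<Rightarrow> real \<Rightarrow> 'a::real_normed_vector) \<Rightarrow> (real \<Rightarrow> real \<Rightarrow> 'a)
    \<Rightarrow> (real \<Rightarrow> real \<Rightarrow> 'a) \<Rightarrow> bool" where
  "hp_C1 f fx fy \<longleftrightarrow> hp_cont f \<and> hp_cont fx \<and> hp_cont fy \<and>
     (\<forall>x. \<forall>y>0. ((\<lambda>s. f s y) has_vector_derivative fx x y) (at x) \<and>
                (f x has_vector_derivative fy x y) (at y))"

lemma hp_C1D:
  assumes "hp_C1 f fx fy"
  shows "hp_cont f" "hp_cont fx" "hp_cont fy"
    "y > 0 \<Longrightarrow> ((\<lambda>s. f s y) has_vector_derivative fx x y) (at x)"
    "y > 0 \<Longrightarrow> (f x has_vector_derivative fy x y) (at y)"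
  using assms by (auto simp: hp_C1_def)

lemma hp_C1_add:
  assumes "hp_C1 f fx fy" "hp_C1 g gx gy"
  shows "hp_C1 (\<lambda>x y. f x y + g x y) (\<lambda>x y. fx x y + gx x y) (\<lambda>x y. fy x y + gy x y)"
  unfolding hp_C1_def
  by (intro conjI allI impI hp_cont_rules has_vector_derivative_add
      hp_C1D[OF assms(1)] hp_C1D[OF assms(2)])

lemma hp_C1_diff:
  assumes "hp_C1 f fx fy" "hp_C1 g gx gy"
  shows "hp_C1 (\<lambda>x y. f x y - g x y) (\<lambda>x y. fx x y - gx x y) (\<lambda>x y. fy x y - gy x y)"
  unfolding hp_C1_def
  by (intro conjI allI impI hp_cont_rules has_vector_derivative_diff
      hp_C1D[OF assms(1)] hp_C1D[OF assms(2)])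

lemma hp_C1_inner:
  fixes f g :: "real \<Rightarrow> real \<Rightarrow> 'a::real_inner"
  assumes "hp_C1 f fx fy" "hp_C1 g gx gy"
  shows "hp_C1 (\<lambda>x y. f x y \<bullet> g x y) (\<lambda>x y. f x y \<bullet> gx x y + fx x y \<bullet> g x y)
    (\<lambda>x y. f x y \<bullet> gy x y + fy x y \<bullet> g x y)"
  unfolding hp_C1_def
  by (intro conjI allI impI hp_cont_rules bounded_bilinear.has_vector_derivative[OF bounded_bilinear_inner]
      hp_C1D[OF assms(1)] hp_C1D[OF assms(2)])

lemma hp_C1_mult:
  assumes "hp_C1 f fx fy" "hp_C1 g gx gy"
  shows "hp_C1 (\<lambda>x y. f x y * g x y :: real) (\<lambda>x y. f x y * gx x y + fx x y * g x y)
    (\<lambda>x y. f x y * gy x y + fy x y * g x y)"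
  unfolding hp_C1_def
  by (intro conjI allI impI hp_cont_rules bounded_bilinear.has_vector_derivative[OF bounded_bilinear_mult]
      hp_C1D[OF assms(1)] hp_C1D[OF assms(2)])

lemma hp_C1_fst:
  assumes "hp_C1 f fx fy"
  shows "hp_C1 (\<lambda>x y. fst (f x y)) (\<lambda>x y. fst (fx x y)) (\<lambda>x y. fst (fy x y))"
  unfolding hp_C1_def
  by (intro conjI allI impI hp_cont_rules bounded_linear.has_vector_derivative[OF bounded_linear_fst]
      hp_C1D[OF assms(1)])

lemma hp_C1_snd:
  assumes "hp_C1 f fx fy"
  shows "hp_C1 (\<lambda>x y. snd (f x y)) (\<lambda>x y. snd (fx x y)) (\<lambda>x y. snd (fy x y))"
  unfolding hp_C1_def
  by (intro conjI allI impI hp_cont_rules bounded_linear.has_vector_derivative[OF bounded_linear_snd]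
      hp_C1D[OF assms(1)])

section \<open>Integrals over horizontal lines and the divergence theorem\<close>

lemma hp_cont_slice_x:
  assumes "hp_cont f" "y > 0"
  shows "continuous_on A (\<lambda>x. f x y)"
proof -
  have "continuous_on A ((\<lambda>q. f (fst q) (snd q)) \<circ> (\<lambda>x. (x, y)))"
    by (intro continuous_on_compose continuous_intros hp_cont_subset[OF assms(1)]) (use assms(2) in auto)
  then show ?thesis by (simp add: o_def)
qed

lemma hp_cont_swap:
  assumes "hp_cont f" "B \<subseteq> {0<..}"
  shows "continuous_on (B \<times> A) (\<lambda>(y, x). f x y)"
proof -
  have "continuous_on (B \<times> A) ((\<lambda>q. f (fst q) (snd q)) \<circ> (\<lambda>q. (snd q, fst q)))"
    by (intro continuous_on_compose continuous_intros hp_cont_subset[OF assms(1)]) (use assms(2) in auto)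
  then show ?thesis by (simp add: o_def split_beta)
qed

lemma hp_slice_continuous:
  fixes f :: sfield
  assumes "hp_cont f" "B \<subseteq> {0<..}"
  shows "continuous_on B (\<lambda>y. integral {-pi..pi} (\<lambda>x. f x y))"
  using integral_continuous_on_param[of B "-pi" pi "\<lambda>y x. f x y"] hp_cont_swap[OF assms] by simp

lemma hp_slice_integrable:
  fixes f :: sfield
  assumes "hp_cont f" "y > 0"
  shows "(\<lambda>x. f x y) integrable_on {-pi..pi}"
  by (intro integrable_continuous_interval hp_cont_slice_x assms)

lemma hp_slice_deriv:
  fixes b :: sfield
  assumes "hp_C1 b bx bt" "y > 0"
  shows "((\<lambda>y. integral {-pi..pi} (\<lambda>x. b x y)) has_vector_derivative integral {-pi..pi} (\<lambda>x. bt x y)) (at y)"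
proof -
  have "((\<lambda>y. integral (cbox (-pi) pi) (\<lambda>x. b x y)) has_vector_derivative
      integral (cbox (-pi) pi) (\<lambda>x. bt x y)) (at y within {0<..})"
  proof (rule leibniz_rule_vector_derivative)
    show "((\<lambda>y. b x y) has_vector_derivative bt x y) (at y within {0<..})" if "y \<in> {0<..}" for y x
      using hp_C1D(5)[OF assms(1), of y x] that has_vector_derivative_at_within by auto
    show "(\<lambda>x. b x y) integrable_on cbox (-pi) pi" if "y \<in> {0<..}" for y
      using hp_slice_integrable[OF hp_C1D(1)[OF assms(1)], of y] that by simp
    show "continuous_on ({0<..} \<times> cbox (-pi) pi) (\<lambda>(y, x). bt x y)"
      by (rule hp_cont_swap[OF hp_C1D(3)[OF assms(1)]]) simp
  qed (use assms(2) in auto)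
  moreover have "at y within {0<..} = at y" by (rule at_within_open) (use assms(2) in auto)
  ultimately show ?thesis by simp
qed

lemma hp_slice_dx_zero:
  fixes a :: sfield
  assumes "hp_C1 a ax ay" "y > 0" "a pi y = a (-pi) y"
  shows "integral {-pi..pi} (\<lambda>x. ax x y) = 0"
proof -
  have "((\<lambda>x. ax x y) has_integral a pi y - a (-pi) y) {-pi..pi}"
    by (rule fundamental_theorem_of_calculus)
      (auto intro: has_vector_derivative_at_within hp_C1D(4)[OF assms(1,2)])
  then show ?thesis using assms(3) by (simp add: integral_unique)
qed

text \<open>On a box the lateral fluxes cancel by periodicity, and the difference of the fluxes of
  \<open>b\<close> through top and bottom remains. Their convergence is asked along one sequence of
  heights at each end. Integrability is asked of the sum \<open>ax + bt\<close> alone: for the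
  pressure, the separate terms contain \<open>q\<close> itself, which is not known to be square
  integrable.\<close>

lemma hp_divergence:
  fixes a b :: sfield
  assumes a: "hp_C1 a ax ay" and per: "\<And>y. y > 0 \<Longrightarrow> a pi y = a (-pi) y"
    and b: "hp_C1 b bx bt"
    and D: "hp_L1 (\<lambda>x y. ax x y + bt x y)"
    and R: "filterlim R at_top sequentially"
      "(\<lambda>n. integral {-pi..pi} (\<lambda>x. b x (R n))) \<longlonglongrightarrow> 0"
    and r: "\<And>n. 0 < r n" "r \<longlonglongrightarrow> 0" "(\<lambda>n. integral {-pi..pi} (\<lambda>x. b x (r n))) \<longlonglongrightarrow> l"
  shows "hp_int (\<lambda>x y. ax x y + bt x y) = - l"
proof -
  let ?g = "\<lambda>y. integral {-pi..pi} (\<lambda>x. b x y)"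
  have box: "integral (cbox (-pi, s) (pi, t)) (\<lambda>q. ax (fst q) (snd q) + bt (fst q) (snd q)) = ?g t - ?g s"
    if "0 < s" "s \<le> t" for s t
  proof -
    have "integral (cbox (-pi, s) (pi, t)) (\<lambda>q. ax (fst q) (snd q) + bt (fst q) (snd q))
        = integral {s..t} (\<lambda>y. integral {-pi..pi} (\<lambda>x. ax x y + bt x y))"
      using hp_box_eq_iterated[OF hp_L1_cont[OF D] that(1)] by simp
    also have "\<dots> = integral {s..t} (\<lambda>y. integral {-pi..pi} (\<lambda>x. bt x y))"
    proof (rule integral_cong)
      fix y assume "y \<in> {s..t}"
      then have y: "y > 0" using that by auto
      show "integral {-pi..pi} (\<lambda>x. ax x y + bt x y) = integral {-pi..pi} (\<lambda>x. bt x y)"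
        using hp_slice_dx_zero[OF a y per[OF y]]
          hp_slice_integrable[OF hp_C1D(2)[OF a] y] hp_slice_integrable[OF hp_C1D(3)[OF b] y]
        by (simp add: integral_add)
    qed
    also have "\<dots> = ?g t - ?g s"
      by (intro integral_unique fundamental_theorem_of_calculus)
        (use that in \<open>auto intro!: has_vector_derivative_at_within hp_slice_deriv[OF b]\<close>)
    finally show ?thesis .
  qed
  have "eventually (\<lambda>n. r n \<le> R n) sequentially"
  proof -
    have "eventually (\<lambda>n. r n < 1) sequentially" using order_tendstoD(2)[OF r(2), of 1] by simp
    moreover have "eventually (\<lambda>n. 1 \<le> R n) sequentially" using R(1) by (simp add: filterlim_at_top)
    ultimately show ?thesis by eventually_elim simp
  qed
  then have ev: "eventually (\<lambda>n. integral (cbox (-pi, r n) (pi, R n)) (\<lambda>q. ax (fst q) (snd q) + bt (fst q) (snd q))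
      = ?g (R n) - ?g (r n)) sequentially"
    by eventually_elim (use box r(1) in auto)
  have "(\<lambda>n. ?g (R n) - ?g (r n)) \<longlonglongrightarrow> hp_int (\<lambda>x y. ax x y + bt x y)"
    using Lim_transform_eventually[OF hp_box_tendsto[OF D r(1,2) R(1)] ev] .
  moreover have "(\<lambda>n. ?g (R n) - ?g (r n)) \<longlonglongrightarrow> 0 - l" by (intro tendsto_diff R r)
  ultimately show ?thesis using LIMSEQ_unique by fastforce
qed

section \<open>Heights at which boundary fluxes vanish\<close>

lemma hp_slice_lower_bound:
  assumes "hp_L1 f" "\<And>x y. y > 0 \<Longrightarrow> 0 \<le> f x y" "0 < a" "a < b"
    and "\<And>y. y \<in> {a..b} \<Longrightarrow> c \<le> integral {-pi..pi} (\<lambda>x. f x y)"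
  shows "c * (b - a) \<le> hp_int f"
proof -
  have "c * (b - a) = integral {a..b} (\<lambda>y. c)" using assms(4) by simp
  also have "\<dots> \<le> integral {a..b} (\<lambda>y. integral {-pi..pi} (\<lambda>x. f x y))"
    by (intro integral_le assms integrable_const_ivl integrable_continuous_interval
        hp_slice_continuous[OF hp_L1_cont[OF assms(1)]]) (use assms(3) in auto)
  also have "\<dots> \<le> hp_int f"
    using hp_box_le[OF assms(1,2,3)] hp_box_eq_iterated[OF hp_L1_cont[OF assms(1)] assms(3)] by simp
  finally show ?thesis .
qed

text \<open>If \<open>|g|\<close> stayed above \<open>1 / (n + 1)\<close> at all large heights, so
  would the slice integrals of \<open>f\<close>, contradicting integrability over a strip of
  infinite height.\<close>

lemma hp_vanishing_far:
  assumes f: "hp_L1 f" "\<And>x y. y > 0 \<Longrightarrow> 0 \<le> f x y"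
    and g: "\<And>y. y > 0 \<Longrightarrow> \<bar>g y\<bar> \<le> integral {-pi..pi} (\<lambda>x. f x y)"
  obtains R where "filterlim R at_top sequentially" "(\<lambda>n. g (R n)) \<longlonglongrightarrow> (0::real)"
proof -
  have "\<exists>y\<ge>real n. \<bar>g y\<bar> \<le> 1 / real (Suc n)" for n
  proof (rule ccontr)
    assume *: "\<not> ?thesis"
    \<comment> \<open>A slab of height \<open>k\<close> contributes at least
      \<open>k / (n + 1) = |hp_int f| + 1\<close>.\<close>
    define k where "k = (\<bar>hp_int f\<bar> + 1) * real (Suc n)"
    have k: "k > 0" by (simp add: k_def)
    have "1 / real (Suc n) * ((real n + 1 + k) - (real n + 1)) \<le> hp_int f"
    proof (rule hp_slice_lower_bound[OF f])
      fix y assume "y \<in> {real n + 1..real n + 1 + k}"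
      then show "1 / real (Suc n) \<le> integral {-pi..pi} (\<lambda>x. f x y)"
        using * g[of y] by (smt (verit, best) atLeastAtMost_iff of_nat_0_le_iff)
    qed (use k in auto)
    then show False by (simp add: k_def)
  qed
  then obtain R where R: "\<And>n. R n \<ge> real n" "\<And>n. \<bar>g (R n)\<bar> \<le> 1 / real (Suc n)" by metis
  show ?thesis
  proof
    show "filterlim R at_top sequentially"
      by (rule filterlim_at_top_mono[OF filterlim_real_sequentially]) (use R in auto)
    show "(\<lambda>n. g (R n)) \<longlonglongrightarrow> 0"
      by (rule Lim_null_comparison[OF _ LIMSEQ_Suc[OF lim_inverse_n']]) (use R in auto)
  qed
qed

text \<open>If \<open>|g|\<close> stayed above \<open>e\<close> near the wall, the slice integrals
  of \<open>f\<close> would be at least \<open>e^2 / y^2\<close>, which is not integrable at 0. One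
  slab \<open>[d, 2 d]\<close> already gives the contradiction, its contribution being of order
  \<open>e^2 / d\<close>.\<close>

lemma hp_vanishing_near:
  assumes f: "hp_L1 f" "\<And>x y. y > 0 \<Longrightarrow> 0 \<le> f x y"
    and g: "\<And>y. y > 0 \<Longrightarrow> y \<le> 1 \<Longrightarrow> (g y)\<^sup>2 \<le> y\<^sup>2 * integral {-pi..pi} (\<lambda>x. f x y)"
  obtains r where "\<And>n. 0 < r n" "r \<longlonglongrightarrow> 0" "(\<lambda>n. g (r n)) \<longlonglongrightarrow> (0::real)"
proof -
  have "\<exists>y>0. y \<le> 1 / real (Suc n) \<and> \<bar>g y\<bar> \<le> 1 / real (Suc n)" for n
  proof (rule ccontr)
    assume *: "\<not> ?thesis"
    define e where "e = 1 / real (Suc n)"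
    have e: "e > 0" "e \<le> 1" by (auto simp: e_def)
    \<comment> \<open>The first entry keeps the slab where \<open>|g| > e\<close>; the second makes
      its contribution \<open>e^2 / (4 d)\<close> at least \<open>|hp_int f| + 1\<close>.\<close>
    define d where "d = min (e / 2) (e\<^sup>2 / (4 * (\<bar>hp_int f\<bar> + 1)))"
    have d: "d > 0" "2 * d \<le> e" "d \<le> e\<^sup>2 / (4 * (\<bar>hp_int f\<bar> + 1))" using e by (auto simp: d_def)
    have "e\<^sup>2 / (4 * d\<^sup>2) * (2 * d - d) \<le> hp_int f"
    proof (rule hp_slice_lower_bound[OF f])
      fix y assume y: "y \<in> {d..2 * d}"
      then have y': "y > 0" "y \<le> e" using d by auto
      then have "\<bar>g y\<bar> > e" using * by (auto simp: e_def not_le)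
      then have "e\<^sup>2 \<le> (g y)\<^sup>2" using e by (subst abs_le_square_iff[symmetric]) auto
      also have "\<dots> \<le> y\<^sup>2 * integral {-pi..pi} (\<lambda>x. f x y)" using g y' e by auto
      also have "\<dots> \<le> (2 * d)\<^sup>2 * integral {-pi..pi} (\<lambda>x. f x y)"
        using y y' f(2) by (intro mult_right_mono power_mono integral_nonneg hp_slice_integrable hp_L1_cont[OF f(1)]) auto
      finally show "e\<^sup>2 / (4 * d\<^sup>2) \<le> integral {-pi..pi} (\<lambda>x. f x y)"
        using d(1) by (simp add: divide_simps power_mult_distrib mult.commute)
    qed (use d in auto)
    then have "e\<^sup>2 / (4 * d) \<le> hp_int f" using d(1) by (simp add: power2_eq_square)
    then have "e\<^sup>2 \<le> 4 * d * hp_int f" using d(1) by (simp add: field_simps)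
    also have "\<dots> \<le> 4 * d * \<bar>hp_int f\<bar>" using d(1) by (intro mult_left_mono) auto
    also have "\<dots> < 4 * d * (\<bar>hp_int f\<bar> + 1)" using d(1) by (intro mult_strict_left_mono) auto
    also have "\<dots> \<le> e\<^sup>2" using d(3) by (simp add: field_simps)
    finally show False by simp
  qed
  then obtain r where r: "\<And>n. r n > 0" "\<And>n. r n \<le> 1 / real (Suc n)" "\<And>n. \<bar>g (r n)\<bar> \<le> 1 / real (Suc n)" by metis
  show ?thesis
  proof
    show "r \<longlonglongrightarrow> 0"
      by (rule Lim_null_comparison[OF _ LIMSEQ_Suc[OF lim_inverse_n']]) (use r in \<open>auto simp: abs_of_pos\<close>)
    show "(\<lambda>n. g (r n)) \<longlonglongrightarrow> 0"
      by (rule Lim_null_comparison[OF _ LIMSEQ_Suc[OF lim_inverse_n']]) (use r in auto)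
  qed (rule r)
qed


section \<open>A Sobolev bound\<close>

text \<open>The one-dimensional Sobolev argument. Somewhere on the period \<open>k\<close> is at
  most \<open>N + 1\<close>, since otherwise the integral of \<open>m\<close> would be at least
  \<open>2 pi (N + 1) > N\<close>; and the oscillation of \<open>k\<close> is at most the integral
  of \<open>|k'|\<close>, hence at most \<open>N\<close>.\<close>

lemma bound_by_integral:
  fixes k k' m :: "real \<Rightarrow> real"
  assumes k: "\<And>x. (k has_vector_derivative k' x) (at x)" "continuous_on UNIV k'" "continuous_on UNIV m"
    and m: "\<And>x. \<bar>k' x\<bar> \<le> m x" "\<And>x. k x \<le> m x" "integral {-pi..pi} m \<le> N"
    and x: "x \<in> {-pi..pi}"
  shows "k x \<le> 2 * N + 1"
proof -
  have m0: "0 \<le> m x" for x using m(1)[of x] by linarith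
  have im: "m integrable_on {s..t}" "k' integrable_on {s..t}" for s t
    by (auto intro!: integrable_continuous_interval continuous_on_subset[OF k(3)] continuous_on_subset[OF k(2)])
  have N0: "0 \<le> N" using integral_nonneg[OF im(1), of "-pi" pi] m0 m(3) by auto
  have "\<exists>z\<in>{-pi..pi}. k z \<le> N + 1"
  proof (rule ccontr)
    assume "\<not> ?thesis"
    then have "N + 1 \<le> m z" if "z \<in> {-pi..pi}" for z using m(2)[of z] that by force
    then have "integral {-pi..pi} (\<lambda>z. N + 1) \<le> integral {-pi..pi} m"
      by (intro integral_le im) auto
    then have "2 * pi * (N + 1) \<le> N" using m(3) by simp
    moreover have "1 * (N + 1) \<le> 2 * pi * (N + 1)"
      using N0 pi_gt3 by (intro mult_right_mono) auto
    ultimately show False by simp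
  qed
  then obtain z where z: "z \<in> {-pi..pi}" "k z \<le> N + 1" by blast
  have osc: "\<bar>k t - k s\<bar> \<le> N" if "s \<le> t" "s \<in> {-pi..pi}" "t \<in> {-pi..pi}" for s t
  proof -
    have "(k' has_integral (k t - k s)) {s..t}"
      by (rule fundamental_theorem_of_calculus) (use that in \<open>auto intro: has_vector_derivative_at_within[OF k(1)]\<close>)
    then have "k t - k s = integral {s..t} k'" by (simp add: integral_unique)
    also have "norm \<dots> \<le> integral {s..t} m"
      by (rule integral_norm_bound_integral) (use im m(1) in auto)
    also have "\<dots> \<le> integral {-pi..pi} m"
      by (rule integral_subset_le) (use im m0 that in auto)
    finally show ?thesis using m(3) by simp
  qed
  show ?thesis
  proof (cases "z \<le> x")
    case True
    then show ?thesis using osc[OF True z(1) x] z by linarith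
  next
    case False
    then show ?thesis using osc[OF _ x z(1)] z by auto
  qed
qed

lemma hp_cont_Times:
  assumes "hp_cont f" "B \<subseteq> {0<..}"
  shows "continuous_on (A \<times> B) (\<lambda>(x, y). f x y)"
  using hp_cont_subset[OF assms(1), of "A \<times> B"] assms(2) by (auto simp: split_beta)

lemma hp_cont_slice_y:
  assumes "hp_cont f" "A \<subseteq> {0<..}"
  shows "continuous_on A (f x)"
proof -
  have "continuous_on A ((\<lambda>q. f (fst q) (snd q)) \<circ> (\<lambda>y. (x, y)))"
    by (intro continuous_on_compose continuous_intros hp_cont_subset[OF assms(1)]) (use assms(2) in auto)
  then show ?thesis by (simp add: o_def)
qed

text \<open>
  \<open>\<bar>f\<bar>\<^sup>2\<close> is bounded by the integral \<open>k(x)\<close> of \<open>\<bar>f\<bar>\<^sup>2 + \<bar>\<partial>\<^sub>y f\<bar>\<^sup>2\<close> over the vertical line through \<open>x\<close>, and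
  both \<open>k\<close> and \<open>k'\<close> are integrable over a period; only the mixed second derivative enters.
\<close>

lemma hp_Sobolev_bounded:
  fixes f :: "real \<Rightarrow> real \<Rightarrow> 'a::real_inner"
  assumes f: "hp_C1 f fx fy" and fy: "hp_C1 fy fyx fyy"
    and L2: "hp_L2 f" "hp_L2 fx" "hp_L2 fy" "hp_L2 fyx"
    and wall: "\<And>x. (f x \<longlongrightarrow> 0) (at_right 0)"
  obtains B where "\<And>x y. x \<in> {-pi..pi} \<Longrightarrow> y > 0 \<Longrightarrow> norm (f x y) \<le> B"
proof -
  \<comment> \<open>\<open>F\<close> is the integrand of the function \<open>k\<close> described
    above; \<open>G\<close> dominates both \<open>F\<close> and \<open>|Fx|\<close>, so one
    integrable function controls \<open>k\<close> and its derivative.\<close>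
  define F where "F = (\<lambda>x y. f x y \<bullet> f x y + fy x y \<bullet> fy x y)"
  define Fx where "Fx = (\<lambda>x y. (f x y \<bullet> fx x y + fx x y \<bullet> f x y) + (fy x y \<bullet> fyx x y + fyx x y \<bullet> fy x y))"
  define G where "G = (\<lambda>x y. ((norm (f x y))\<^sup>2 + (norm (fx x y))\<^sup>2) + ((norm (fy x y))\<^sup>2 + (norm (fyx x y))\<^sup>2))"
  obtain Fy where F: "hp_C1 F Fx Fy"
    using hp_C1_add[OF hp_C1_inner[OF f f] hp_C1_inner[OF fy fy]] unfolding F_def Fx_def by blast
  have G: "hp_L1 G" unfolding G_def by (intro hp_L1_add hp_L2_L1 L2)
  have G0: "0 \<le> G x y" for x y by (simp add: G_def)
  have FxG: "\<bar>Fx x y\<bar> \<le> G x y" for x y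
    using inner_le_sum_squares[of "f x y" "fx x y"] inner_le_sum_squares[of "fy x y" "fyx x y"]
    by (simp add: Fx_def G_def inner_commute)
  have FG: "F x y \<le> G x y" for x y
    by (simp add: F_def G_def power2_norm_eq_inner)
  \<comment> \<open>The bound depends neither on \<open>d\<close> nor on \<open>t\<close>: the
    vertical segments stay off the wall, where derivatives need not be continuous, and can be
    stretched to it afterwards.\<close>
  have K: "integral {d..t} (F x) \<le> 2 * hp_int G + 1" if "0 < d" "d \<le> t" and x: "x \<in> {-pi..pi}" for d t x
  proof -
    have sub: "{d..t} \<subseteq> {0<..}" using that by auto
    note ci = integrable_continuous_interval[OF hp_cont_slice_y[OF _ sub]]
    show ?thesis
    proof (rule bound_by_integral[OF _ _ _ _ _ _ x, where k'="\<lambda>x. integral {d..t} (Fx x)"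
          and m="\<lambda>x. integral {d..t} (G x)"])
      fix x
      have "((\<lambda>x. integral (cbox d t) (F x)) has_vector_derivative integral (cbox d t) (Fx x)) (at x within UNIV)"
      proof (rule leibniz_rule_vector_derivative)
        show "((\<lambda>x. F x y) has_vector_derivative Fx x y) (at x within UNIV)" if "y \<in> cbox d t" for x y
          using hp_C1D(4)[OF F, of y x] that \<open>0 < d\<close> by auto
        show "F x integrable_on cbox d t" for x using ci[OF hp_C1D(1)[OF F]] by simp
        show "continuous_on (UNIV \<times> cbox d t) (\<lambda>(x, y). Fx x y)"
          using hp_cont_Times[OF hp_C1D(2)[OF F] sub] by simp
      qed auto
      then show "((\<lambda>x. integral {d..t} (F x)) has_vector_derivative integral {d..t} (Fx x)) (at x)" by simp
      show "\<bar>integral {d..t} (Fx x)\<bar> \<le> integral {d..t} (G x)"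
        using integral_norm_bound_integral[OF ci[OF hp_C1D(2)[OF F]] ci[OF hp_L1_cont[OF G]], of x x] FxG by auto
      show "integral {d..t} (F x) \<le> integral {d..t} (G x)"
        by (intro integral_le ci hp_C1D(1)[OF F] hp_L1_cont[OF G] FG)
    next
      show "continuous_on UNIV (\<lambda>x. integral {d..t} (Fx x))"
        using integral_continuous_on_param[of UNIV d t Fx] hp_cont_Times[OF hp_C1D(2)[OF F] sub] by simp
      show "continuous_on UNIV (\<lambda>x. integral {d..t} (G x))"
        using integral_continuous_on_param[of UNIV d t G] hp_cont_Times[OF hp_L1_cont[OF G] sub] by simp
      have "continuous_on (cbox (-pi, d) (pi, t)) (\<lambda>q. G (fst q) (snd q))"
        by (rule hp_cont_subset[OF hp_L1_cont[OF G]]) (use that in auto)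
      from integral_prod_continuous[OF this]
      show "integral {-pi..pi} (\<lambda>x. integral {d..t} (G x)) \<le> hp_int G"
        using hp_box_le[OF G _ that(1), of t] G0 by simp
    qed
  qed
  have "norm (f x y) \<le> sqrt (2 * hp_int G + 1)" if x: "x \<in> {-pi..pi}" and y: "y > 0" for x y
  proof -
    \<comment> \<open>The difference of the squares is the integral of twice the inner product of
      \<open>f\<close> and \<open>fy\<close>, which is pointwise at most \<open>F\<close>. As
      \<open>d\<close> tends to 0 the value at \<open>d\<close> disappears by the wall
      condition.\<close>
    have "(norm (f x y))\<^sup>2 \<le> (norm (f x d))\<^sup>2 + (2 * hp_int G + 1)" if d: "0 < d" "d \<le> y" for d
    proof -
      have sub: "{d..y} \<subseteq> {0<..}" using d by auto
      note ci = integrable_continuous_interval[OF hp_cont_slice_y[OF _ sub]]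
      note ff = hp_C1_inner[OF f f]
      have "((\<lambda>y. f x y \<bullet> fy x y + fy x y \<bullet> f x y) has_integral (f x y \<bullet> f x y - f x d \<bullet> f x d)) {d..y}"
        by (rule fundamental_theorem_of_calculus)
          (use d in \<open>auto intro: has_vector_derivative_at_within[OF hp_C1D(5)[OF ff]]\<close>)
      moreover have "integral {d..y} (\<lambda>y. f x y \<bullet> fy x y + fy x y \<bullet> f x y) \<le> integral {d..y} (F x)"
      proof (intro integral_le ci hp_C1D(1)[OF F] hp_C1D(3)[OF ff])
        show "f x y \<bullet> fy x y + fy x y \<bullet> f x y \<le> F x y" for y
          using inner_le_sum_squares[of "f x y" "fy x y"] by (simp add: F_def inner_commute power2_norm_eq_inner)
      qed
      ultimately have "f x y \<bullet> f x y - f x d \<bullet> f x d \<le> integral {d..y} (F x)"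
        by (simp add: integral_unique)
      with K[OF d x] show ?thesis by (simp add: power2_norm_eq_inner)
    qed
    then have "eventually (\<lambda>d. (norm (f x y))\<^sup>2 \<le> (norm (f x d))\<^sup>2 + (2 * hp_int G + 1)) (at_right 0)"
      using y by (intro eventually_at_rightI[of 0 y]) auto
    moreover have "((\<lambda>d. (norm (f x d))\<^sup>2 + (2 * hp_int G + 1)) \<longlongrightarrow> (norm (0::'a))\<^sup>2 + (2 * hp_int G + 1)) (at_right 0)"
      by (intro tendsto_intros wall)
    ultimately have "(norm (f x y))\<^sup>2 \<le> (norm (0::'a))\<^sup>2 + (2 * hp_int G + 1)"
      by (intro tendsto_lowerbound[OF _ _ trivial_limit_at_right_real])
    then show ?thesis by (intro real_le_rsqrt) simp
  qed
  then show ?thesis using that by blast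
qed

lemma periodic_x_reduce:
  assumes "periodic_x f"
  obtains x' where "x' \<in> {-pi..pi}" "\<And>y. y \<ge> 0 \<Longrightarrow> f x y = f x' y"
proof -
  have n: "f (x + real n * (2 * pi)) y = f x y" if "y \<ge> 0" for x y n
  proof (induction n)
    case (Suc n)
    have "f (x + real (Suc n) * (2 * pi)) y = f ((x + real n * (2 * pi)) + 2 * pi) y" by (simp add: algebra_simps)
    also have "\<dots> = f (x + real n * (2 * pi)) y" using assms that by (simp add: periodic_x_def)
    finally show ?case using Suc by simp
  qed simp
  have z: "f (x + of_int k * (2 * pi)) y = f x y" if "y \<ge> 0" for x y k
    using n[OF that, of x "nat k"] n[OF that, of "x + of_int k * (2 * pi)" "nat (- k)"]
    by (cases "k \<ge> 0") auto
  define a where "a = (x + pi) / (2 * pi)"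
  define k where "k = - \<lfloor>a\<rfloor>"
  have "x = a * (2 * pi) - pi" by (simp add: a_def)
  moreover have "of_int \<lfloor>a\<rfloor> * (2 * pi) \<le> a * (2 * pi)" by (intro mult_right_mono) auto
  moreover have "a * (2 * pi) \<le> (of_int \<lfloor>a\<rfloor> + 1) * (2 * pi)"
    using floor_correct[of a] by (intro mult_right_mono) auto
  ultimately have "x + of_int k * (2 * pi) \<in> {-pi..pi}" by (auto simp: k_def algebra_simps)
  then show ?thesis using that z by metis
qed


section \<open>Energy balance at a fixed time\<close>

lemma slice_continuous_closed:
  fixes f :: sfield
  assumes "continuous_on (UNIV \<times> {0..}) (\<lambda>q. f (fst q) (snd q))"
  shows "continuous_on {0..} (\<lambda>y. integral {-pi..pi} (\<lambda>x. f x y))"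
proof -
  have "continuous_on ({0..} \<times> cbox (-pi) pi) ((\<lambda>q. f (fst q) (snd q)) \<circ> (\<lambda>q. (snd q, fst q)))"
    by (intro continuous_on_compose continuous_intros continuous_on_subset[OF assms]) auto
  then show ?thesis
    using integral_continuous_on_param[of "{0..}" "-pi" pi "\<lambda>y x. f x y"] by (simp add: o_def split_beta)
qed

lemma slice_tendsto_wall:
  fixes f :: sfield
  assumes "continuous_on (UNIV \<times> {0..}) (\<lambda>q. f (fst q) (snd q))"
  shows "(\<lambda>n. integral {-pi..pi} (\<lambda>x. f x (1 / real (Suc n)))) \<longlonglongrightarrow> integral {-pi..pi} (\<lambda>x. f x 0)"
  by (rule continuous_on_tendsto_compose[OF slice_continuous_closed[OF assms] LIMSEQ_Suc[OF lim_inverse_n']])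
    auto

lemma hp_slice_abs_le:
  fixes f g :: sfield
  assumes "hp_cont f" "hp_cont g" "y > 0" "\<And>x. x \<in> {-pi..pi} \<Longrightarrow> \<bar>f x y\<bar> \<le> g x y"
  shows "\<bar>integral {-pi..pi} (\<lambda>x. f x y)\<bar> \<le> integral {-pi..pi} (\<lambda>x. g x y)"
  using integral_norm_bound_integral[OF hp_slice_integrable[OF assms(1,3)] hp_slice_integrable[OF assms(2,3)]] assms(4)
  by simp

text \<open>The situation at one positive time: \<open>u\<close> is the viscous flow,
  \<open>w\<close> the Euler flow, \<open>q\<close> the difference of their pressures.
  \<open>B\<close> bounds the Euler gradient, \<open>S\<close> the viscous shear on the wall,
  \<open>U\<close> the Euler slip velocity, \<open>W\<close> the Dirichlet energy of
  \<open>w\<close>. Continuity up to the wall is listed for \<open>u\<close>, \<open>uy\<close> and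
  \<open>w\<close>; the gradient of \<open>w\<close> need not have boundary values.\<close>

locale flow_pair =
  fixes u w ux uy uxx uxy uyx uyy wx wy :: vfield and q qx qy :: sfield and B S U W :: real
  assumes u: "hp_C1 u ux uy" and ux: "hp_C1 ux uxx uxy" and uy: "hp_C1 uy uyx uyy"
    and w: "hp_C1 w wx wy" and q: "hp_C1 q qx qy"
    and u_per: "periodic_x u"
    and per: "\<And>y. y > 0 \<Longrightarrow> w pi y = w (-pi) y"
      "\<And>y. y > 0 \<Longrightarrow> ux pi y = ux (-pi) y" "\<And>y. y > 0 \<Longrightarrow> q pi y = q (-pi) y"
    and closed: "continuous_on (UNIV \<times> {0..}) (\<lambda>q. u (fst q) (snd q))"
      "continuous_on (UNIV \<times> {0..}) (\<lambda>q. uy (fst q) (snd q))"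
      "continuous_on (UNIV \<times> {0..}) (\<lambda>q. w (fst q) (snd q))"
    and u_wall: "\<And>x. u x 0 = 0" and w_wall: "\<And>x. snd (w x 0) = 0"
    and u_div: "\<And>x y. y > 0 \<Longrightarrow> fst (ux x y) + snd (uy x y) = 0"
    and w_div: "\<And>x y. y > 0 \<Longrightarrow> fst (wx x y) + snd (wy x y) = 0"
    and L2: "hp_L2 u" "hp_L2 ux" "hp_L2 uy" "hp_L2 uxx" "hp_L2 uyx" "hp_L2 uyy"
      "hp_L2 w" "hp_L2 wx" "hp_L2 wy" "hp_L2 qx" "hp_L2 qy"
    and w_bound: "\<And>x y. y > 0 \<Longrightarrow> norm (wx x y) \<le> B" "\<And>x y. y > 0 \<Longrightarrow> norm (wy x y) \<le> B"
    and wall_bound: "\<And>x. x \<in> {-pi..pi} \<Longrightarrow> \<bar>fst (uy x 0)\<bar> \<le> S" "\<And>x. x \<in> {-pi..pi} \<Longrightarrow> \<bar>fst (w x 0)\<bar> \<le> U"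
    and W: "hp_int (\<lambda>x y. (norm (wx x y))\<^sup>2) + hp_int (\<lambda>x y. (norm (wy x y))\<^sup>2) \<le> W"
begin

definition "v x y = u x y - w x y"
definition "vx x y = ux x y - wx x y"
definition "vy x y = uy x y - wy x y"

lemma v: "hp_C1 v vx vy"
  using hp_C1_diff[OF u w] unfolding v_def[abs_def] vx_def[abs_def] vy_def[abs_def] .

lemma vL2: "hp_L2 v" "hp_L2 vx" "hp_L2 vy"
  unfolding v_def[abs_def] vx_def[abs_def] vy_def[abs_def] by (intro hp_L2_diff L2)+

lemma v_closed: "continuous_on (UNIV \<times> {0..}) (\<lambda>q. v (fst q) (snd q))"
  unfolding v_def[abs_def] by (intro continuous_intros closed)

lemma u_per': "y > 0 \<Longrightarrow> u pi y = u (-pi) y"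
  using u_per[unfolded periodic_x_def, rule_format, of y "-pi"] by simp

lemma v_per: "y > 0 \<Longrightarrow> v pi y = v (-pi) y"
  using u_per' per(1) by (simp add: v_def)

lemma v_div: "y > 0 \<Longrightarrow> fst (vx x y) + snd (vy x y) = 0"
  using u_div[of y x] w_div[of y x] by (simp add: vx_def vy_def)

lemma v_wall: "snd (v x 0) = 0"
  using u_wall w_wall by (simp add: v_def)

text \<open>With \<open>u\<close> and the gradient of \<open>v\<close> merely square integrable, the
  transport term would only be integrable and could not be paired with \<open>v\<close>; hence the
  uniform bound. No-slip is the wall condition of the Sobolev bound, and periodicity extends it from
  one period.\<close>

lemma u_bounded: obtains K where "\<And>x y. y > 0 \<Longrightarrow> norm (u x y) \<le> K"
proof -
  have "(u x \<longlongrightarrow> 0) (at_right 0)" for x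
  proof -
    have "continuous_on {0..} ((\<lambda>q. u (fst q) (snd q)) \<circ> (\<lambda>y. (x, y)))"
      by (intro continuous_on_compose continuous_intros continuous_on_subset[OF closed(1)]) auto
    then have "(u x \<longlongrightarrow> u x 0) (at 0 within {0..})" by (auto simp: o_def continuous_on_def)
    then show ?thesis using u_wall by (auto intro: tendsto_within_subset)
  qed
  from hp_Sobolev_bounded[OF u uy L2(1,2,3,5) this]
  obtain K where K: "\<And>x y. x \<in> {-pi..pi} \<Longrightarrow> y > 0 \<Longrightarrow> norm (u x y) \<le> K" by blast
  show ?thesis
  proof (rule that)
    fix x y :: real assume "y > 0"
    moreover obtain x' where "x' \<in> {-pi..pi}" "\<And>y. y \<ge> 0 \<Longrightarrow> u x y = u x' y"
      using periodic_x_reduce[OF u_per] by blast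
    ultimately show "norm (u x y) \<le> K" using K by auto
  qed
qed

lemma transport_L2: "hp_L2 (\<lambda>x y. fst (u x y) *\<^sub>R vx x y + snd (u x y) *\<^sub>R vy x y)"
proof -
  obtain K where K: "\<And>x y. y > 0 \<Longrightarrow> norm (u x y) \<le> K" using u_bounded by blast
  have "\<bar>fst (u x y)\<bar> \<le> K" "\<bar>snd (u x y)\<bar> \<le> K" if "y > 0" for x y
    using K[OF that, of x] norm_fst_snd_le[of "u x y"] by auto
  then show ?thesis
    by (intro hp_L2_add hp_L2_scaleR_bounded[where B=K] vL2 hp_cont_rules hp_C1D(1)[OF u])
qed

text \<open>The roles are reversed with respect to the transport term: \<open>v\<close> is square
  integrable and the gradient of \<open>w\<close> is bounded.\<close>

lemma stretching_L2: "hp_L2 (\<lambda>x y. fst (v x y) *\<^sub>R wx x y + snd (v x y) *\<^sub>R wy x y)"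
proof -
  have 1: "hp_L2 (\<lambda>x y. a x y *\<^sub>R b x y)" if a: "hp_L2 a" and b: "hp_cont b" "\<And>x y. y > 0 \<Longrightarrow> norm (b x y) \<le> B"
    for a :: sfield and b :: vfield
  proof (rule hp_L2_bound)
    show "hp_L1 (\<lambda>x y. B\<^sup>2 * (norm (a x y))\<^sup>2)" by (intro hp_L1_cmult hp_L2_L1 a)
    show "hp_cont (\<lambda>x y. a x y *\<^sub>R b x y)" by (intro hp_cont_rules hp_L2_cont a b)
    show "(norm (a x y *\<^sub>R b x y))\<^sup>2 \<le> B\<^sup>2 * (norm (a x y))\<^sup>2" if "y > 0" for x y
      using mult_right_mono[OF power_mono[OF b(2)[OF that, of x] norm_ge_zero, of 2] zero_le_power2[of "a x y"]]
      by (simp add: power_mult_distrib mult.commute)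
  qed
  show ?thesis
    by (intro hp_L2_add 1 hp_L2_fst_snd vL2 hp_C1D(2,3)[OF w] w_bound)
qed

text \<open>As \<open>div u = 0\<close>, twice the integrand is \<open>div (u |v|^2)\<close>. The
  flux through a line is at most \<open>K\<close> times the integral of \<open>|v|^2\<close>, so it
  vanishes along a sequence of large heights, and it is zero on the wall where
  \<open>u = 0\<close>.\<close>

lemma transport_zero: "hp_int (\<lambda>x y. v x y \<bullet> (fst (u x y) *\<^sub>R vx x y + snd (u x y) *\<^sub>R vy x y)) = 0"
proof -
  let ?I = "\<lambda>x y. v x y \<bullet> (fst (u x y) *\<^sub>R vx x y + snd (u x y) *\<^sub>R vy x y)"
  note vv = hp_C1_inner[OF v v]
  note a = hp_C1_mult[OF hp_C1_fst[OF u] vv]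
  note b = hp_C1_mult[OF hp_C1_snd[OF u] vv]
  let ?D = "\<lambda>x y. (fst (u x y) * (v x y \<bullet> vx x y + vx x y \<bullet> v x y) + fst (ux x y) * (v x y \<bullet> v x y)) +
     (snd (u x y) * (v x y \<bullet> vy x y + vy x y \<bullet> v x y) + snd (uy x y) * (v x y \<bullet> v x y))"
  have D: "?D x y = 2 * ?I x y" if "y > 0" for x y
  proof -
    have "?D x y = 2 * ?I x y + (fst (ux x y) + snd (uy x y)) * (v x y \<bullet> v x y)"
      by (simp add: inner_add_right inner_commute algebra_simps)
    then show ?thesis using u_div[OF that] by simp
  qed
  have I: "hp_L1 ?I" by (rule hp_L2_inner[OF vL2(1) transport_L2])
  have DL1: "hp_L1 ?D" using hp_L1_cong[of ?D "\<lambda>x y. 2 * ?I x y"] D hp_L1_cmult[OF I, of 2] by simp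
  obtain K where K: "\<And>x y. y > 0 \<Longrightarrow> norm (u x y) \<le> K" using u_bounded by blast
  have K0: "K \<ge> 0" using order.trans[OF norm_ge_zero K[of 1 0]] by simp
  have f: "hp_L1 (\<lambda>x y. K * (norm (v x y))\<^sup>2)" by (intro hp_L1_cmult hp_L2_L1 vL2)
  obtain R where R: "filterlim R at_top sequentially"
    "(\<lambda>n. integral {-pi..pi} (\<lambda>x. snd (u x (R n)) * (v x (R n) \<bullet> v x (R n)))) \<longlonglongrightarrow> 0"
  proof (rule hp_vanishing_far[OF f, where g="\<lambda>y. integral {-pi..pi} (\<lambda>x. snd (u x y) * (v x y \<bullet> v x y))"])
    show "0 \<le> K * (norm (v x y))\<^sup>2" for x y using K0 by simp
    show "\<bar>integral {-pi..pi} (\<lambda>x. snd (u x y) * (v x y \<bullet> v x y))\<bar> \<le> integral {-pi..pi} (\<lambda>x. K * (norm (v x y))\<^sup>2)"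
      if "y > 0" for y
    proof (rule hp_slice_abs_le[OF hp_C1D(1)[OF b] hp_L1_cont[OF f] that])
      fix x
      have "\<bar>snd (u x y)\<bar> \<le> K" using K[OF that, of x] norm_fst_snd_le(2)[of "u x y"] by auto
      then show "\<bar>snd (u x y) * (v x y \<bullet> v x y)\<bar> \<le> K * (norm (v x y))\<^sup>2"
        by (simp add: abs_mult power2_norm_eq_inner mult_right_mono)
    qed
  qed (rule that)
  have "continuous_on (UNIV \<times> {0..}) (\<lambda>q. snd (u (fst q) (snd q)) * (v (fst q) (snd q) \<bullet> v (fst q) (snd q)))"
    by (intro continuous_intros closed v_closed)
  note r = slice_tendsto_wall[OF this]
  have "hp_int ?D = - integral {-pi..pi} (\<lambda>x. snd (u x 0) * (v x 0 \<bullet> v x 0))"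
    by (rule hp_divergence[OF a _ b DL1 R _ LIMSEQ_Suc[OF lim_inverse_n'] r]) (auto simp: u_per' v_per)
  then have "hp_int ?D = 0" using u_wall by simp
  moreover have "hp_int ?D = 2 * hp_int ?I" using hp_int_cong[OF D] by (simp add: hp_int_cmult)
  ultimately show ?thesis by simp
qed

text \<open>
  Only the gradient of the pressure difference \<open>q\<close> is square integrable. As \<open>v\<^sub>2\<close> has mean zero in
  \<open>x\<close>, the flux of \<open>q v\<close> through a horizontal line depends on \<open>q\<close> only through its oscillation
  along the line, hence on \<open>\<partial>\<^sub>x q\<close>.
\<close>

lemma v2_mean_zero:
  assumes "y > 0"
  shows "integral {-pi..pi} (\<lambda>x. snd (v x y)) = 0"
proof -
  let ?m = "\<lambda>y. integral {-pi..pi} (\<lambda>x. snd (v x y))"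
  \<comment> \<open>The mean is constant in \<open>y\<close>: its derivative is minus the integral
    over a period of the \<open>x\<close>-derivative of the first component.\<close>
  have "?m y = ?m 0"
  proof (rule DERIV_isconst_end[OF assms])
    have "continuous_on (UNIV \<times> {0..}) (\<lambda>q. snd (v (fst q) (snd q)))" by (intro continuous_intros v_closed)
    from continuous_on_subset[OF slice_continuous_closed[OF this]]
    show "continuous_on {0..y} ?m" by auto
    fix t assume t: "0 < t" "t < y"
    have "integral {-pi..pi} (\<lambda>x. snd (vy x t)) = integral {-pi..pi} (\<lambda>x. - fst (vx x t))"
      using v_div[OF t(1)] by (intro integral_cong) (simp add: eq_neg_iff_add_eq_0 add.commute)
    also have "\<dots> = 0" using hp_slice_dx_zero[OF hp_C1_fst[OF v] t(1)] v_per[OF t(1)] by simp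
    finally show "DERIV ?m t :> 0"
      using hp_slice_deriv[OF hp_C1_snd[OF v] t(1)] by (simp add: has_real_derivative_iff_has_vector_derivative)
  qed
  then show ?thesis using v_wall by simp
qed

text \<open>The second component vanishes on the wall and its normal derivative is bounded near it,
  by \<open>k\<close> for the viscous flow (continuity on a compact set) and by \<open>B\<close> for
  the Euler flow. The mean value inequality uses derivatives at interior points only, so no trace of
  \<open>wy\<close> is involved.\<close>

lemma v2_linear:
  obtains K where "K \<ge> 0" "\<And>x y. x \<in> {-pi..pi} \<Longrightarrow> 0 < y \<Longrightarrow> y \<le> 1 \<Longrightarrow> \<bar>snd (v x y)\<bar> \<le> K * y"
proof -
  have "compact ((\<lambda>q. uy (fst q) (snd q)) ` ({-pi..pi} \<times> {0..1}))"
    by (intro compact_continuous_image continuous_on_subset[OF closed(2)] compact_Times compact_Icc) auto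
  then obtain k where k: "\<And>x y. x \<in> {-pi..pi} \<Longrightarrow> y \<in> {0..1} \<Longrightarrow> norm (uy x y) \<le> k"
  proof -
    assume "compact ((\<lambda>q. uy (fst q) (snd q)) ` ({-pi..pi} \<times> {0..1}))"
    then obtain k where "\<forall>z\<in>(\<lambda>q. uy (fst q) (snd q)) ` ({-pi..pi} \<times> {0..1}). norm z \<le> k"
      using compact_imp_bounded bounded_iff by blast
    then show ?thesis using that[of k] by force
  qed
  have k0: "k \<ge> 0" using order.trans[OF norm_ge_zero k[of 0 0]] by simp
  have B0: "B \<ge> 0" using order.trans[OF norm_ge_zero w_bound(1)[of 1 0]] by simp
  show ?thesis
  proof (rule that[of "k + B"])
    fix x y :: real assume x: "x \<in> {-pi..pi}" and y: "0 < y" "y \<le> 1"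
    have "continuous_on {0..y} ((\<lambda>q. snd (v (fst q) (snd q))) \<circ> (\<lambda>y. (x, y)))"
      by (intro continuous_on_compose continuous_intros continuous_on_subset[OF v_closed]) auto
    then have c: "continuous_on {0..y} (\<lambda>y. snd (v x y))" by (simp add: o_def)
    obtain t where t: "0 < t" "t < y" "norm (snd (v x y) - snd (v x 0)) \<le> norm ((y - 0) *\<^sub>R snd (vy x t))"
      using mvt_general[OF y(1) c, of "\<lambda>t h. h *\<^sub>R snd (vy x t)"] hp_C1D(5)[OF hp_C1_snd[OF v], of _ x]
      unfolding has_vector_derivative_def by auto
    have "norm (snd (vy x t)) \<le> norm (vy x t)" by (rule norm_fst_snd_le)
    also have "\<dots> \<le> norm (uy x t) + norm (wy x t)" unfolding vy_def by (rule norm_triangle_ineq4)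
    also have "\<dots> \<le> k + B" using k[OF x, of t] w_bound(2)[of t x] t y by auto
    finally have "y * norm (snd (vy x t)) \<le> y * (k + B)" using y by (intro mult_left_mono) auto
    moreover have "\<bar>snd (v x y)\<bar> \<le> y * norm (snd (vy x t))" using t(3) y v_wall by (simp add: abs_mult)
    ultimately show "\<bar>snd (v x y)\<bar> \<le> (k + B) * y" unfolding mult.commute[of "k + B" y] by (rule order.trans[rotated])
  qed (use k0 B0 in simp)
qed

text \<open>The majorant \<open>V\<close> is left open because it is chosen twice:
  \<open>|snd v|\<close> itself far from the wall, \<open>K * y\<close> near it.\<close>

lemma pressure_slice:
  assumes y: "y > 0" and V: "\<And>x. x \<in> {-pi..pi} \<Longrightarrow> \<bar>snd (v x y)\<bar> \<le> V x" "continuous_on {-pi..pi} V"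
  shows "\<bar>integral {-pi..pi} (\<lambda>x. q x y * snd (v x y))\<bar> \<le>
     integral {-pi..pi} (\<lambda>x. \<bar>qx x y\<bar>) * integral {-pi..pi} V"
proof -
  let ?Q = "integral {-pi..pi} (\<lambda>x. \<bar>qx x y\<bar>)"
  note cq = hp_cont_slice_x[OF hp_C1D(1)[OF q] y] and cqx = hp_cont_slice_x[OF hp_C1D(2)[OF q] y]
    and cv = hp_cont_slice_x[OF hp_C1D(1)[OF hp_C1_snd[OF v]] y]
  have Q: "\<bar>q x y - q (-pi) y\<bar> \<le> ?Q" if x: "x \<in> {-pi..pi}" for x
  proof -
    have "((\<lambda>x. qx x y) has_integral (q x y - q (-pi) y)) {-pi..x}"
      by (rule fundamental_theorem_of_calculus)
        (use x in \<open>auto intro: has_vector_derivative_at_within[OF hp_C1D(4)[OF q y]]\<close>)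
    then have "\<bar>q x y - q (-pi) y\<bar> = norm (integral {-pi..x} (\<lambda>x. qx x y))" by (simp add: integral_unique)
    also have "\<dots> \<le> integral {-pi..x} (\<lambda>x. \<bar>qx x y\<bar>)"
      by (intro integral_norm_bound_integral integrable_continuous_interval continuous_intros cqx) auto
    also have "\<dots> \<le> ?Q"
      using x by (intro integral_subset_le integrable_continuous_interval continuous_intros cqx) auto
    finally show ?thesis .
  qed
  have i: "(\<lambda>x. q x y * snd (v x y)) integrable_on {-pi..pi}" "(\<lambda>x. q (-pi) y * snd (v x y)) integrable_on {-pi..pi}"
    "(\<lambda>x. (q x y - q (-pi) y) * snd (v x y)) integrable_on {-pi..pi}" "(\<lambda>x. ?Q * V x) integrable_on {-pi..pi}"
    by (intro integrable_continuous_interval continuous_intros cq cv V)+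
  have "integral {-pi..pi} (\<lambda>x. q x y * snd (v x y))
      = integral {-pi..pi} (\<lambda>x. q x y * snd (v x y)) - integral {-pi..pi} (\<lambda>x. q (-pi) y * snd (v x y))"
    using v2_mean_zero[OF y] by simp
  also have "\<dots> = integral {-pi..pi} (\<lambda>x. (q x y - q (-pi) y) * snd (v x y))"
    using i by (simp add: integral_diff left_diff_distrib)
  also have "norm \<dots> \<le> integral {-pi..pi} (\<lambda>x. ?Q * V x)"
  proof (rule integral_norm_bound_integral[OF i(3,4)])
    fix x assume x: "x \<in> {-pi..pi}"
    show "norm ((q x y - q (-pi) y) * snd (v x y)) \<le> ?Q * V x"
      unfolding norm_mult using Q[OF x] V(1)[OF x] order.trans[OF abs_ge_zero Q[OF x]] by (intro mult_mono) auto
  qed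
  finally show ?thesis by simp
qed

text \<open>As \<open>div v = 0\<close>, the integrand is \<open>div (q v)\<close>. Its flux is at
  most the product of the line integrals of \<open>|qx|\<close> and \<open>|snd v|\<close>. Both are
  square integrable in \<open>y\<close>, which settles large heights; near the wall the linear decay
  of \<open>snd v\<close> brings in exactly the factor \<open>y^2\<close> that
  \<open>hp_vanishing_near\<close> asks for.\<close>

lemma pressure_zero: "hp_int (\<lambda>x y. v x y \<bullet> (qx x y, qy x y)) = 0"
proof -
  let ?I = "\<lambda>x y. v x y \<bullet> (qx x y, qy x y)"
  let ?g = "\<lambda>y. integral {-pi..pi} (\<lambda>x. q x y * snd (v x y))"
  note a = hp_C1_mult[OF q hp_C1_fst[OF v]]
  note b = hp_C1_mult[OF q hp_C1_snd[OF v]]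
  let ?D = "\<lambda>x y. (q x y * fst (vx x y) + qx x y * fst (v x y)) + (q x y * snd (vy x y) + qy x y * snd (v x y))"
  have D: "?D x y = ?I x y" if "y > 0" for x y
  proof -
    have "?D x y = ?I x y + q x y * (fst (vx x y) + snd (vy x y))"
      by (simp add: inner_prod_def algebra_simps)
    then show ?thesis using v_div[OF that] by simp
  qed
  have "hp_L2 (\<lambda>x y. (qx x y, qy x y))"
  proof (rule hp_L2_bound)
    show "hp_L1 (\<lambda>x y. (norm (qx x y))\<^sup>2 + (norm (qy x y))\<^sup>2)" by (intro hp_L1_add hp_L2_L1 L2)
    show "hp_cont (\<lambda>x y. (qx x y, qy x y))" by (intro hp_cont_rules hp_L2_cont L2)
  qed (simp add: norm_Pair)
  then have I: "hp_L1 ?I" by (rule hp_L2_inner[OF vL2(1)])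
  have DL1: "hp_L1 ?D" using hp_L1_cong[of ?D ?I] D I by simp
  note v2 = hp_L2_fst_snd(2)[OF vL2(1)]
  note cqx = hp_cont_slice_x[OF hp_C1D(2)[OF q]] and cv = hp_cont_slice_x[OF hp_C1D(1)[OF hp_C1_snd[OF v]]]
  have Qsq: "(integral {-pi..pi} (\<lambda>x. \<bar>qx x y\<bar>))\<^sup>2 \<le> 2 * pi * integral {-pi..pi} (\<lambda>x. (norm (qx x y))\<^sup>2)" if "y > 0" for y
    using integral_square_le[OF continuous_on_rabs[OF cqx[OF that]], of "-pi" pi] by simp
  have f: "hp_L1 (\<lambda>x y. pi * ((norm (qx x y))\<^sup>2 + (norm (snd (v x y)))\<^sup>2))"
    by (intro hp_L1_cmult hp_L1_add hp_L2_L1 L2 v2)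
  obtain R where R: "filterlim R at_top sequentially" "(\<lambda>n. ?g (R n)) \<longlonglongrightarrow> 0"
  proof (rule hp_vanishing_far[OF f, where g="?g"])
    fix y :: real assume y: "y > 0"
    let ?Q = "integral {-pi..pi} (\<lambda>x. \<bar>qx x y\<bar>)" and ?V = "integral {-pi..pi} (\<lambda>x. \<bar>snd (v x y)\<bar>)"
    have "\<bar>?g y\<bar> \<le> ?Q * ?V"
      by (rule pressure_slice[OF y]) (auto intro: continuous_intros cv[OF y])
    also have "\<dots> \<le> (?Q\<^sup>2 + ?V\<^sup>2) / 2" using sum_squares_bound[of ?Q ?V] by simp
    also have "\<dots> \<le> (2 * pi * integral {-pi..pi} (\<lambda>x. (norm (qx x y))\<^sup>2)
        + 2 * pi * integral {-pi..pi} (\<lambda>x. (norm (snd (v x y)))\<^sup>2)) / 2"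
      using Qsq[OF y] integral_square_le[OF continuous_on_rabs[OF cv[OF y]], of "-pi" pi]
      by (intro divide_right_mono add_mono) simp_all
    also have "\<dots> = integral {-pi..pi} (\<lambda>x. pi * ((norm (qx x y))\<^sup>2 + (norm (snd (v x y)))\<^sup>2))"
      using hp_slice_integrable[OF hp_L1_cont[OF hp_L2_L1[OF v2]] y]
        hp_slice_integrable[OF hp_L1_cont[OF hp_L2_L1[OF L2(10)]] y]
      by (simp add: integral_add algebra_simps)
    finally show "\<bar>?g y\<bar> \<le> integral {-pi..pi} (\<lambda>x. pi * ((norm (qx x y))\<^sup>2 + (norm (snd (v x y)))\<^sup>2))" .
  qed (auto intro: that)
  obtain K where K: "K \<ge> 0" "\<And>x y. x \<in> {-pi..pi} \<Longrightarrow> 0 < y \<Longrightarrow> y \<le> 1 \<Longrightarrow> \<bar>snd (v x y)\<bar> \<le> K * y"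
    using v2_linear by blast
  \<comment> \<open>\<open>2 pi K y\<close> is the line integral of the majorant of
    \<open>|snd v|\<close>; the last factor \<open>2 pi\<close> is the length from Cauchy-Schwarz
    for \<open>qx\<close>.\<close>
  define c where "c = (2 * pi * K)\<^sup>2 * (2 * pi)"
  have f': "hp_L1 (\<lambda>x y. c * (norm (qx x y))\<^sup>2)" by (intro hp_L1_cmult hp_L2_L1 L2)
  obtain r where r: "\<And>n. 0 < r n" "r \<longlonglongrightarrow> 0" "(\<lambda>n. ?g (r n)) \<longlonglongrightarrow> 0"
  proof (rule hp_vanishing_near[OF f', where g="?g"])
    fix y :: real assume y: "y > 0" "y \<le> 1"
    let ?Q = "integral {-pi..pi} (\<lambda>x. \<bar>qx x y\<bar>)"
    have "\<bar>?g y\<bar> \<le> ?Q * integral {-pi..pi} (\<lambda>x. K * y)"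
      by (rule pressure_slice[OF y(1)]) (use K y in auto)
    then have "\<bar>?g y\<bar> \<le> ?Q * (2 * pi * K * y)" by (simp add: algebra_simps)
    then have "\<bar>?g y\<bar>\<^sup>2 \<le> (?Q * (2 * pi * K * y))\<^sup>2" by (intro power_mono) auto
    then have "(?g y)\<^sup>2 \<le> ?Q\<^sup>2 * ((2 * pi * K)\<^sup>2 * y\<^sup>2)" by (simp only: power2_abs power_mult_distrib mult_ac)
    also have "\<dots> \<le> (2 * pi * integral {-pi..pi} (\<lambda>x. (norm (qx x y))\<^sup>2)) * ((2 * pi * K)\<^sup>2 * y\<^sup>2)"
      using Qsq[OF y(1)] by (intro mult_right_mono) auto
    also have "\<dots> = y\<^sup>2 * integral {-pi..pi} (\<lambda>x. c * (norm (qx x y))\<^sup>2)"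
      by (simp add: c_def algebra_simps)
    finally show "(?g y)\<^sup>2 \<le> y\<^sup>2 * integral {-pi..pi} (\<lambda>x. c * (norm (qx x y))\<^sup>2)" .
  qed (auto intro: that simp: c_def)
  have "hp_int ?D = - 0"
    by (rule hp_divergence[OF a _ b DL1 R r]) (auto simp: per(3) v_per)
  then show ?thesis using hp_int_cong[of ?D ?I, OF D] by simp
qed

text \<open>The flux of \<open>v . uy\<close> vanishes along a sequence of large heights, and has a
  limit at the wall because \<open>v\<close> and \<open>uy\<close> are continuous there. On the wall
  \<open>v = - w\<close> is tangential, so only the product of slip velocity and shear
  survives.\<close>

lemma viscous_bound: "hp_int (\<lambda>x y. v x y \<bullet> (uxx x y + uyy x y)) \<le> 2 * pi * (U * S) + W / 4"
proof -
  note a = hp_C1_inner[OF v ux]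
  note b = hp_C1_inner[OF v uy]
  let ?D = "\<lambda>x y. (v x y \<bullet> uxx x y + vx x y \<bullet> ux x y) + (v x y \<bullet> uyy x y + vy x y \<bullet> uy x y)"
  let ?I = "\<lambda>x y. v x y \<bullet> (uxx x y + uyy x y)"
  let ?G = "\<lambda>x y. vx x y \<bullet> ux x y + vy x y \<bullet> uy x y"
  let ?g = "\<lambda>y. integral {-pi..pi} (\<lambda>x. v x y \<bullet> uy x y)"
  have DL1: "hp_L1 ?D" by (intro hp_L1_add hp_L2_inner vL2 L2)
  have f: "hp_L1 (\<lambda>x y. ((norm (v x y))\<^sup>2 + (norm (uy x y))\<^sup>2) / 2)"
    using hp_L1_cmult[OF hp_L1_add[OF hp_L2_L1[OF vL2(1)] hp_L2_L1[OF L2(3)]], of "1/2"] by simp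
  obtain R where R: "filterlim R at_top sequentially" "(\<lambda>n. ?g (R n)) \<longlonglongrightarrow> 0"
  proof (rule hp_vanishing_far[OF f, where g="?g"])
    show "\<bar>?g y\<bar> \<le> integral {-pi..pi} (\<lambda>x. ((norm (v x y))\<^sup>2 + (norm (uy x y))\<^sup>2) / 2)" if "y > 0" for y
      by (rule hp_slice_abs_le[OF hp_C1D(1)[OF b] hp_L1_cont[OF f] that inner_le_sum_squares])
  qed (auto intro: that)
  have "continuous_on (UNIV \<times> {0..}) (\<lambda>q. v (fst q) (snd q) \<bullet> uy (fst q) (snd q))"
    by (intro continuous_intros closed v_closed)
  note r = slice_tendsto_wall[OF this]
  have D: "hp_int ?D = - ?g 0"
    by (rule hp_divergence[OF a _ b DL1 R _ LIMSEQ_Suc[OF lim_inverse_n'] r]) (auto simp: per v_per)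
  have wall: "- ?g 0 \<le> 2 * pi * (U * S)"
  proof -
    have eq: "v x 0 \<bullet> uy x 0 = - (fst (w x 0) * fst (uy x 0))" for x
      using w_wall u_wall by (simp add: v_def inner_prod_def)
    have "continuous_on {-pi..pi} ((\<lambda>q. v (fst q) (snd q) \<bullet> uy (fst q) (snd q)) \<circ> (\<lambda>x. (x, 0)))"
      by (intro continuous_on_compose continuous_intros continuous_on_subset[OF v_closed] continuous_on_subset[OF closed(2)]) auto
    then have c: "continuous_on {-pi..pi} (\<lambda>x. v x 0 \<bullet> uy x 0)" by (simp add: o_def)
    have "norm (?g 0) \<le> integral {-pi..pi} (\<lambda>x. U * S)"
    proof (rule integral_norm_bound_integral)
      fix x assume x: "x \<in> {-pi..pi}"
      have "\<bar>fst (w x 0)\<bar> * \<bar>fst (uy x 0)\<bar> \<le> U * S"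
        using wall_bound[OF x] order.trans[OF abs_ge_zero wall_bound(2)[OF x]] by (intro mult_mono) auto
      then show "norm (v x 0 \<bullet> uy x 0) \<le> U * S" by (simp add: eq abs_mult)
    qed (auto intro: integrable_continuous_interval c)
    also have "\<dots> = 2 * pi * (U * S)" by (simp add: mult_ac)
    finally show ?thesis by (intro order.trans[OF abs_ge_minus_self]) simp
  qed
  have diss: "- hp_int ?G \<le> W / 4"
  proof -
    have pw: "- (vx x y \<bullet> ux x y + vy x y \<bullet> uy x y) \<le> (1/4) * ((norm (wx x y))\<^sup>2 + (norm (wy x y))\<^sup>2)" for x y
    proof -
      \<comment> \<open>Expand \<open>|a - b / 2|^2 \<ge> 0\<close>: here the dissipation absorbs
        the cross term, at the price of a quarter of the Euler gradient squared.\<close>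
      have *: "b \<bullet> a - a \<bullet> a \<le> (1/4) * (norm b)\<^sup>2" for a b :: "real \<times> real"
      proof -
        have "0 \<le> (a - (1/2) *\<^sub>R b) \<bullet> (a - (1/2) *\<^sub>R b)" by (rule inner_ge_zero)
        then show ?thesis by (simp add: power2_norm_eq_inner inner_diff_left inner_diff_right inner_commute)
      qed
      from *[of "wx x y" "ux x y"] *[of "wy x y" "uy x y"] show ?thesis
        by (simp add: vx_def vy_def inner_diff_left algebra_simps)
    qed
    have "hp_int (\<lambda>x y. (-1) * ?G x y) \<le> hp_int (\<lambda>x y. (1/4) * ((norm (wx x y))\<^sup>2 + (norm (wy x y))\<^sup>2))"
    proof (rule hp_int_mono)
      show "(-1) * ?G x y \<le> (1/4) * ((norm (wx x y))\<^sup>2 + (norm (wy x y))\<^sup>2)" for x y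
        unfolding mult_minus1 by (rule pw)
    qed (intro hp_L1_cmult hp_L1_add hp_L2_inner hp_L2_L1 vL2 L2)+
    also have "\<dots> = (1/4) * (hp_int (\<lambda>x y. (norm (wx x y))\<^sup>2) + hp_int (\<lambda>x y. (norm (wy x y))\<^sup>2))"
      by (simp only: hp_int_cmult hp_int_add[OF hp_L2_L1[OF L2(8)] hp_L2_L1[OF L2(9)]])
    finally show ?thesis using W unfolding hp_int_cmult by simp
  qed
  have "hp_int ?D = hp_int (\<lambda>x y. ?I x y + ?G x y)" by (rule hp_int_cong) (simp add: inner_add_right)
  also have "\<dots> = hp_int ?I + hp_int ?G"
    by (intro hp_int_add hp_L1_add hp_L2_inner hp_L2_add vL2 L2)
  finally show ?thesis using D wall diss by simp
qed

lemma stretching_bound: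
  "- hp_int (\<lambda>x y. v x y \<bullet> (fst (v x y) *\<^sub>R wx x y + snd (v x y) *\<^sub>R wy x y))
    \<le> 2 * B * hp_int (\<lambda>x y. (norm (v x y))\<^sup>2)"
proof -
  let ?I = "\<lambda>x y. v x y \<bullet> (fst (v x y) *\<^sub>R wx x y + snd (v x y) *\<^sub>R wy x y)"
  have "hp_int (\<lambda>x y. (-1) * ?I x y) \<le> hp_int (\<lambda>x y. 2 * B * (norm (v x y))\<^sup>2)"
  proof (rule hp_int_mono)
    fix x y :: real assume y: "y > 0"
    have "\<bar>?I x y\<bar> \<le> norm (v x y) * norm (fst (v x y) *\<^sub>R wx x y + snd (v x y) *\<^sub>R wy x y)"
      by (rule Cauchy_Schwarz_ineq2)
    also have "\<dots> \<le> norm (v x y) * (norm (v x y) * B + norm (v x y) * B)"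
      using w_bound[OF y, of x] norm_fst_snd_le[of "v x y"]
      by (intro mult_left_mono norm_triangle_le add_mono) (auto intro: mult_mono)
    finally show "-1 * ?I x y \<le> 2 * B * (norm (v x y))\<^sup>2" by (simp add: power2_eq_square algebra_simps)
  next
    show "hp_L1 (\<lambda>x y. (-1) * ?I x y)" by (intro hp_L1_cmult hp_L2_inner vL2 stretching_L2)
    show "hp_L1 (\<lambda>x y. 2 * B * (norm (v x y))\<^sup>2)" by (intro hp_L1_cmult hp_L2_L1 vL2)
  qed
  then show ?thesis unfolding hp_int_cmult by simp
qed

text \<open>Time enters only through the field \<open>vt\<close>, prescribed by the difference of
  the two momentum equations; the estimate concerns a single instant.\<close>

lemma energy_rate:
  fixes vt :: vfield
  assumes "0 \<le> \<nu>"
    and vt: "\<And>x y. y > 0 \<Longrightarrow> vt x y = \<nu> *\<^sub>R (uxx x y + uyy x y)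
      - (fst (u x y) *\<^sub>R ux x y + snd (u x y) *\<^sub>R uy x y)
      + (fst (w x y) *\<^sub>R wx x y + snd (w x y) *\<^sub>R wy x y) - (qx x y, qy x y)"
  shows "hp_int (\<lambda>x y. v x y \<bullet> vt x y) \<le>
    \<nu> * (2 * pi * (U * S) + W / 4) + 2 * B * hp_int (\<lambda>x y. (norm (v x y))\<^sup>2)"
proof -
  let ?d = "\<lambda>x y. v x y \<bullet> (uxx x y + uyy x y)"
  let ?t = "\<lambda>x y. v x y \<bullet> (fst (u x y) *\<^sub>R vx x y + snd (u x y) *\<^sub>R vy x y)"
  let ?s = "\<lambda>x y. v x y \<bullet> (fst (v x y) *\<^sub>R wx x y + snd (v x y) *\<^sub>R wy x y)"
  let ?p = "\<lambda>x y. v x y \<bullet> (qx x y, qy x y)"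
  have "hp_L2 (\<lambda>x y. (qx x y, qy x y))"
  proof (rule hp_L2_bound)
    show "hp_L1 (\<lambda>x y. (norm (qx x y))\<^sup>2 + (norm (qy x y))\<^sup>2)" by (intro hp_L1_add hp_L2_L1 L2)
    show "hp_cont (\<lambda>x y. (qx x y, qy x y))" by (intro hp_cont_rules hp_L2_cont L2)
  qed (simp add: norm_Pair)
  then have p: "hp_L1 ?p" by (rule hp_L2_inner[OF vL2(1)])
  have d: "hp_L1 ?d" and t: "hp_L1 ?t" and s: "hp_L1 ?s"
    by (intro hp_L2_inner hp_L2_add vL2 L2 transport_L2 stretching_L2)+
  have "hp_int (\<lambda>x y. v x y \<bullet> vt x y) = hp_int (\<lambda>x y. \<nu> * ?d x y - ?t x y - ?s x y - ?p x y)"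
  proof (rule hp_int_cong)
    fix x y :: real assume y: "y > 0"
    \<comment> \<open>Regroup \<open>u . grad u - w . grad w\<close> as
      \<open>u . grad v + v . grad w\<close>: a part that integrates to zero against
      \<open>v\<close>, and a part without derivatives of \<open>v\<close>.\<close>
    have "vt x y = \<nu> *\<^sub>R (uxx x y + uyy x y) - (fst (u x y) *\<^sub>R vx x y + snd (u x y) *\<^sub>R vy x y)
        - (fst (v x y) *\<^sub>R wx x y + snd (v x y) *\<^sub>R wy x y) - (qx x y, qy x y)"
      unfolding vt[OF y] v_def vx_def vy_def by (simp add: algebra_simps)
    then show "v x y \<bullet> vt x y = \<nu> * ?d x y - ?t x y - ?s x y - ?p x y"
      by (simp only: inner_diff_right inner_scaleR_right)
  qed
  also have "\<dots> = \<nu> * hp_int ?d - hp_int ?t - hp_int ?s - hp_int ?p"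
    by (simp only: hp_int_diff[OF hp_L1_diff[OF hp_L1_diff[OF hp_L1_cmult[OF d] t] s] p]
        hp_int_diff[OF hp_L1_diff[OF hp_L1_cmult[OF d] t] s] hp_int_diff[OF hp_L1_cmult[OF d] t] hp_int_cmult)
  also have "\<dots> = \<nu> * hp_int ?d - hp_int ?s"
    using transport_zero pressure_zero by simp
  also have "\<dots> \<le> \<nu> * (2 * pi * (U * S) + W / 4) + 2 * B * hp_int (\<lambda>x y. (norm (v x y))\<^sup>2)"
    using mult_left_mono[OF viscous_bound assms(1)] stretching_bound by linarith
  finally show ?thesis .
qed

end


section \<open>The vorticity on the wall\<close>

text \<open>The sup norm runs over the interior of the complex domain, so the real points at which
  it is evaluated must be shown to lie in an open subset, here the open wedge.\<close>

lemma interior_Omega: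
  assumes "0 < \<mu>" "0 < y" "y < 1"
  shows "complex_of_real y \<in> interior (Omega \<mu>)"
proof -
  let ?O = "{z. 0 < Re z} \<inter> {z. Re z < 1} \<inter> {z. \<bar>Im z\<bar> < \<mu> * Re z}"
  have "open ?O" by (intro open_Int open_Collect_less continuous_intros)
  moreover have "?O \<subseteq> Omega \<mu>" by (auto simp: Omega_def)
  ultimately have "?O \<subseteq> interior (Omega \<mu>)" by (rule interior_maximal[rotated])
  moreover have "complex_of_real y \<in> ?O" using assms by simp
  ultimately show ?thesis by blast
qed

text \<open>Every value of \<open>weight\<close> is at least \<open>sqrt \<nu>\<close>, because
  \<open>sqrt \<nu> \<le> 1\<close>; rescaling its argument or adding a nonnegative term, as for
  small times, preserves that.\<close>

lemma weight_t_ge: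
  assumes "0 < \<nu>" "\<nu> < 1" "0 < t"
  shows "sqrt \<nu> \<le> weight_t \<beta> \<gamma> \<nu> t y"
proof -
  have "sqrt \<nu> \<le> 1" using assms by simp
  then have w: "sqrt \<nu> \<le> weight \<nu> z" for z by (auto simp: weight_def)
  then show ?thesis using w assms by (auto simp: weight_t_def intro: add_increasing2)
qed

lemma X_norm_deriv_le_triple_norm:
  assumes "0 < \<mu>" "\<mu> < \<mu>0 - \<gamma> * sqrt t"
  shows "X_norm_deriv \<epsilon>0 (weight_t \<beta> \<gamma> \<nu> t) \<mu> 0 0 f \<le> triple_norm \<alpha> \<beta> \<epsilon>0 \<mu>0 \<gamma> \<nu> t f"
proof -
  let ?X = "\<lambda>\<mu> (i, j). X_norm_deriv \<epsilon>0 (weight_t \<beta> \<gamma> \<nu> t) \<mu> i j f"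
  let ?S = "\<lambda>\<mu>. (\<Sum>p\<in>{(i, j). i + j \<le> 1}. ?X \<mu> p) +
        (\<Sum>(i, j)\<in>{(i, j). i + j = 2}.
           ennreal ((\<mu>0 - \<mu> - \<gamma> * sqrt t) powr (1/2 + \<alpha>)) *
           X_norm_deriv \<epsilon>0 (weight_t \<beta> \<gamma> \<nu> t) \<mu> i j f)"
  have fin: "finite {(i, j). i + j \<le> (1::nat)}"
    by (rule finite_subset[of _ "{..1} \<times> {..1}"]) auto
  have "X_norm_deriv \<epsilon>0 (weight_t \<beta> \<gamma> \<nu> t) \<mu> 0 0 f = ?X \<mu> (0, 0)" by simp
  also have "\<dots> \<le> (\<Sum>p\<in>{(i, j). i + j \<le> 1}. ?X \<mu> p)"
    by (rule member_le_sum) (use fin in auto)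
  also have "\<dots> \<le> ?S \<mu>" by (simp add: add_increasing2)
  also have "\<dots> \<le> Xt_norm \<alpha> \<beta> \<epsilon>0 \<mu>0 \<gamma> \<nu> t f"
    unfolding Xt_norm_def by (rule SUP_upper) (use assms in auto)
  also have "\<dots> \<le> triple_norm \<alpha> \<beta> \<epsilon>0 \<mu>0 \<gamma> \<nu> t f"
    unfolding triple_norm_def by (simp add: add_increasing2)
  finally show ?thesis .
qed

text \<open>Dividing by the weight turns the X norm into a bound on the absolutely summed
  coefficients, uniform in \<open>y\<close> and in the finite set \<open>F\<close>, which is the
  input of the Fejer argument.\<close>

lemma sum_fourier_le_triple_norm:
  assumes "0 < \<nu>" "\<nu> < 1" "0 < t" "\<gamma> * sqrt t < \<mu>0" "0 \<le> \<epsilon>0" "0 \<le> A" and y: "0 < y" "y < 1"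
    and le: "triple_norm \<alpha> \<beta> \<epsilon>0 \<mu>0 \<gamma> \<nu> t f \<le> ennreal A" and "finite F"
  shows "(\<Sum>\<xi>\<in>F. cmod (fourier f \<xi> y)) \<le> A / sqrt \<nu>"
proof -
  \<comment> \<open>The midpoint is an admissible radius because
    \<open>\<gamma> * sqrt t < \<mu>0\<close>.\<close>
  define \<mu> where "\<mu> = (\<mu>0 - \<gamma> * sqrt t) / 2"
  have \<mu>: "0 < \<mu>" "\<mu> < \<mu>0 - \<gamma> * sqrt t" using assms(4) by (auto simp: \<mu>_def)
  have X: "X_norm_deriv \<epsilon>0 (weight_t \<beta> \<gamma> \<nu> t) \<mu> 0 0 f \<le> ennreal A"
    using X_norm_deriv_le_triple_norm[OF \<mu>] le order.trans by blast
  \<comment> \<open>A finite norm forces an extension to exist, since \<open>X_norm_deriv\<close> is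
    infinite otherwise; although picked by choice, it agrees with the coefficient at real
    points.\<close>
  then have ext: "extensible \<mu> f"
    by (auto simp: X_norm_deriv_def top_unique split: if_splits)
  have ext': "extension \<mu> f \<xi> (of_real y) = fourier f \<xi> y" for \<xi>
  proof -
    have "is_extension \<mu> (fourier f \<xi>) (extension \<mu> f \<xi>)"
      unfolding extension_def by (rule someI_ex[OF ext[unfolded extensible_def, rule_format]])
    then show ?thesis using y \<mu> by (auto simp: is_extension_def)
  qed
  let ?L = "\<lambda>\<xi>. Linf_norm (weight_t \<beta> \<gamma> \<nu> t) \<mu> (\<lambda>z. exp_factor \<epsilon>0 \<mu> \<xi> z *\<^sub>R conormal 0 0 (extension \<mu> f) \<xi> z)"
  have L: "ennreal (sqrt \<nu> * cmod (fourier f \<xi> y)) \<le> ?L \<xi>" for \<xi>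
  proof -
    have e: "1 \<le> exp_factor \<epsilon>0 \<mu> \<xi> (of_real y)"
      using assms(5) by (simp add: exp_factor_def)
    have "sqrt \<nu> * cmod (fourier f \<xi> y)
        \<le> weight_t \<beta> \<gamma> \<nu> t y * (exp_factor \<epsilon>0 \<mu> \<xi> (of_real y) * cmod (fourier f \<xi> y))"
    proof (rule mult_mono)
      show "sqrt \<nu> \<le> weight_t \<beta> \<gamma> \<nu> t y" using weight_t_ge assms by blast
      then show "0 \<le> weight_t \<beta> \<gamma> \<nu> t y" using assms(1) by (meson order.trans real_sqrt_ge_zero less_imp_le)
      show "cmod (fourier f \<xi> y) \<le> exp_factor \<epsilon>0 \<mu> \<xi> (of_real y) * cmod (fourier f \<xi> y)"
        using mult_right_mono[OF e norm_ge_zero[of "fourier f \<xi> y"]] by simp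
    qed simp
    also have "\<dots> = weight_t \<beta> \<gamma> \<nu> t (Re (of_real y)) *
        cmod (exp_factor \<epsilon>0 \<mu> \<xi> (of_real y) *\<^sub>R conormal 0 0 (extension \<mu> f) \<xi> (of_real y))"
      using e by (simp add: conormal_def ext')
    finally have "ennreal (sqrt \<nu> * cmod (fourier f \<xi> y)) \<le> ennreal (weight_t \<beta> \<gamma> \<nu> t (Re (of_real y)) *
        cmod (exp_factor \<epsilon>0 \<mu> \<xi> (of_real y) *\<^sub>R conormal 0 0 (extension \<mu> f) \<xi> (of_real y)))"
      by (rule ennreal_leI)
    also have "\<dots> \<le> ?L \<xi>"
      unfolding Linf_norm_def by (rule SUP_upper) (rule interior_Omega[OF \<mu>(1) y])
    finally show ?thesis .
  qed
  have "ennreal (\<Sum>\<xi>\<in>F. sqrt \<nu> * cmod (fourier f \<xi> y)) = (\<Sum>\<xi>\<in>F. ennreal (sqrt \<nu> * cmod (fourier f \<xi> y)))"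
    using assms(1) by (intro sum_ennreal[symmetric]) simp
  also have "\<dots> \<le> (\<Sum>\<xi>\<in>F. ?L \<xi>)" by (intro sum_mono L)
  also have "\<dots> \<le> (\<Sum>\<^sub>\<infinity>\<xi>. ?L \<xi>)"
    by (subst nonneg_infsum_complete) (use \<open>finite F\<close> in \<open>auto intro!: SUP_upper\<close>)
  also have "\<dots> \<le> ennreal A" using X ext by (simp add: X_norm_deriv_def X_norm_def)
  finally have "(\<Sum>\<xi>\<in>F. sqrt \<nu> * cmod (fourier f \<xi> y)) \<le> A" using assms(6) by (simp add: ennreal_le_iff)
  then have "sqrt \<nu> * (\<Sum>\<xi>\<in>F. cmod (fourier f \<xi> y)) \<le> A" by (simp add: sum_distrib_left)
  then show ?thesis using assms(1) by (simp add: pos_le_divide_eq mult.commute)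
qed

lemma fourier_eq_integral:
  assumes "continuous_on {-pi..pi} (\<lambda>x. f x y)"
  shows "fourier f \<xi> y = integral {-pi..pi} (\<lambda>x. f x y *\<^sub>R cis (- of_int \<xi> * x)) / (2 * pi)"
proof -
  have eq: "complex_of_real (f x y) * exp (- \<i> * of_int \<xi> * of_real x) = f x y *\<^sub>R cis (- of_int \<xi> * x)" for x
    by (simp add: cis_conv_exp scaleR_conv_of_real mult_ac)
  have "set_integrable lborel {-pi..pi} (\<lambda>x. f x y *\<^sub>R cis (- of_int \<xi> * x))"
    by (intro borel_integrable_atLeastAtMost' continuous_intros assms)
  from set_borel_integral_eq_integral(2)[OF this] show ?thesis
    unfolding fourier_def eq by simp
qed

text \<open>The coefficient bound holds for \<open>0 < y < 1\<close> and the Fejer argument inside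
  the period; continuity of \<open>f\<close> carries the estimate to the wall and to the end points
  of the period.\<close>

lemma wall_bound_triple_norm:
  assumes "0 < \<nu>" "\<nu> < 1" "0 < t" "\<gamma> * sqrt t < \<mu>0" "0 \<le> \<epsilon>0" "0 \<le> A"
    and le: "triple_norm \<alpha> \<beta> \<epsilon>0 \<mu>0 \<gamma> \<nu> t f \<le> ennreal A"
    and cont: "continuous_on (UNIV \<times> {0..}) (\<lambda>q. f (fst q) (snd q))"
    and x: "x \<in> {-pi..pi}"
  shows "\<bar>f x 0\<bar> \<le> A / sqrt \<nu>"
proof -
  have int: "\<bar>f z y\<bar> \<le> A / sqrt \<nu>" if z: "z \<in> {-pi<..<pi}" and y: "0 < y" "y < 1" for z y
  proof -
    have "continuous_on {-pi..pi} ((\<lambda>q. f (fst q) (snd q)) \<circ> (\<lambda>x. (x, y)))"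
      by (intro continuous_on_compose continuous_intros continuous_on_subset[OF cont]) (use y in auto)
    then have c: "continuous_on {-pi..pi} (\<lambda>x. f x y)" by (simp add: o_def)
    show ?thesis
      by (rule abs_le_sum_fourier_coefficients[OF c fourier_eq_integral[where f=f and y=y, OF c]
            sum_fourier_le_triple_norm[OF assms(1-6) y le] z])
  qed
  define e where "e = (\<lambda>n. 1 / real (Suc n))"
  have e: "e \<longlonglongrightarrow> 0" unfolding e_def by (rule LIMSEQ_Suc[OF lim_inverse_n'])
  have e01: "0 < e n" "e n \<le> 1" for n by (auto simp: e_def)
  \<comment> \<open>Shrinking \<open>x\<close> by the factor \<open>1 - e n / 2\<close> gives points
    strictly inside the period even for \<open>x = pi\<close> or \<open>x = - pi\<close>, and the
    height \<open>e n / 2\<close> is at most \<open>1 / 2\<close>.\<close>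
  have lim: "(\<lambda>n. (x * (1 - e n / 2), e n / 2)) \<longlonglongrightarrow> (x, 0)"
    by (rule tendsto_eq_intros e refl | simp)+
  have "(\<lambda>n. f (x * (1 - e n / 2)) (e n / 2)) \<longlonglongrightarrow> f x 0"
    using continuous_on_tendsto_compose[OF cont lim] e01 by (simp add: less_imp_le)
  then have "(\<lambda>n. \<bar>f (x * (1 - e n / 2)) (e n / 2)\<bar>) \<longlonglongrightarrow> \<bar>f x 0\<bar>"
    by (rule tendsto_rabs)
  moreover have "\<bar>f (x * (1 - e n / 2)) (e n / 2)\<bar> \<le> A / sqrt \<nu>" for n
  proof (rule int)
    have "\<bar>x * (1 - e n / 2)\<bar> \<le> pi * (1 - e n / 2)"
      using x e01[of n] by (auto simp: abs_mult intro!: mult_mono)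
    also have "\<dots> < pi * 1" using e01[of n] by (intro mult_strict_left_mono) auto
    finally show "x * (1 - e n / 2) \<in> {-pi<..<pi}" by auto
  qed (use e01[of n] in auto)
  ultimately show ?thesis by (meson LIMSEQ_le_const2)
qed


section \<open>Energy estimate in time\<close>

text \<open>\<open>E\<close> is only continuous, so the hypothesis is in integrated form. Its
  right-hand side \<open>\<phi>\<close> is differentiable and dominates \<open>E\<close>;
  \<open>\<psi>\<close> does not increase from \<open>s\<close> to \<open>t\<close>, because
  \<open>\<phi>' = K E + c \<le> K \<phi> + c\<close> and
  \<open>exp (- K (b - s)) \<le> 1\<close>.\<close>

lemma gronwall:
  fixes E :: "real \<Rightarrow> real"
  assumes "s \<le> t" and E: "continuous_on {s..t} E" and "0 \<le> K" "0 \<le> c"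
    and le: "\<And>b. b \<in> {s..t} \<Longrightarrow> E b \<le> E s + integral {s..b} (\<lambda>r. K * E r + c)"
  shows "E t \<le> (E s + c * (t - s)) * exp (K * (t - s))"
proof (cases "s = t")
  case False
  then have st: "s < t" using assms by simp
  define \<phi> where "\<phi> = (\<lambda>b. E s + integral {s..b} (\<lambda>r. K * E r + c))"
  define \<psi> where "\<psi> = (\<lambda>b. \<phi> b * exp (- K * (b - s)) - c * (b - s))"
  have \<phi>: "(\<phi> has_real_derivative (K * E b + c)) (at b within {s..t})" if "b \<in> {s..t}" for b
  proof -
    have "((\<lambda>b. integral {s..b} (\<lambda>r. K * E r + c)) has_real_derivative (K * E b + c)) (at b within {s..t})"
      by (rule integral_has_real_derivative[OF _ that]) (intro continuous_intros E)
    then show ?thesis unfolding \<phi>_def by (auto intro!: derivative_eq_intros)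
  qed
  have \<psi>: "(\<psi> has_derivative (*) ((K * E b + c) * exp (- K * (b - s)) - K * \<phi> b * exp (- K * (b - s)) - c)) (at b within {s..t})"
    if "b \<in> {s..t}" for b
    unfolding \<psi>_def has_field_derivative_def[symmetric]
    by (auto intro!: derivative_eq_intros \<phi>[OF that] simp: algebra_simps)
  obtain b where b: "b \<in> {s<..<t}" "\<psi> t - \<psi> s =
      ((K * E b + c) * exp (- K * (b - s)) - K * \<phi> b * exp (- K * (b - s)) - c) * (t - s)"
    using mvt_simple[OF st \<psi>] by auto
  have "(K * E b + c) * exp (- K * (b - s)) - K * \<phi> b * exp (- K * (b - s)) - c
      = K * (E b - \<phi> b) * exp (- K * (b - s)) + c * (exp (- K * (b - s)) - 1)" by (simp add: algebra_simps)
  also have "\<dots> \<le> 0 + 0"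
  proof (rule add_mono)
    have "E b - \<phi> b \<le> 0" using le[of b] b by (auto simp: \<phi>_def)
    then show "K * (E b - \<phi> b) * exp (- K * (b - s)) \<le> 0"
      using assms(3) by (simp add: mult_nonneg_nonpos mult_nonpos_nonneg)
    have "exp (- K * (b - s)) \<le> 1" using assms(3) b by simp
    then show "c * (exp (- K * (b - s)) - 1) \<le> 0" using assms(4) by (simp add: mult_nonneg_nonpos)
  qed
  finally have "\<psi> t - \<psi> s \<le> 0" unfolding b(2) using st by (simp add: mult_nonpos_nonneg)
  then have "\<phi> t * exp (- K * (t - s)) \<le> E s + c * (t - s)" by (simp add: \<psi>_def \<phi>_def)
  then have "\<phi> t * exp (- K * (t - s)) * exp (K * (t - s)) \<le> (E s + c * (t - s)) * exp (K * (t - s))"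
    by (intro mult_right_mono) auto
  moreover have "\<phi> t * exp (- K * (t - s)) * exp (K * (t - s)) = \<phi> t"
    by (simp add: mult.assoc flip: exp_add)
  moreover have "E t \<le> \<phi> t" using le[of t] assms(1) by (simp add: \<phi>_def)
  ultimately show ?thesis by linarith
qed simp

text \<open>
  The time derivative is only bounded in \<open>L\<^sup>2\<close>, not continuous, so the energy is differentiated on
  compact boxes and the integrated identity is passed to the limit.
\<close>

lemma energy_increment:
  fixes v vt :: "real \<Rightarrow> vfield"
  assumes "s < t"
    and deriv: "\<And>\<tau> x y. \<tau> \<in> {s..t} \<Longrightarrow> y > 0 \<Longrightarrow>
      ((\<lambda>\<tau>. v \<tau> x y) has_vector_derivative vt \<tau> x y) (at \<tau> within {s..t})"
    and cont: "continuous_on ({s..t} \<times> UNIV \<times> {0<..}) (\<lambda>(\<tau>, x, y). v \<tau> x y)"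
      "continuous_on ({s..t} \<times> UNIV \<times> {0<..}) (\<lambda>(\<tau>, x, y). vt \<tau> x y)"
    and L2: "\<And>\<tau>. \<tau> \<in> {s..t} \<Longrightarrow> hp_L2 (v \<tau>)" "\<And>\<tau>. \<tau> \<in> {s..t} \<Longrightarrow> hp_L2 (vt \<tau>)"
    and N: "\<And>\<tau>. \<tau> \<in> {s..t} \<Longrightarrow> hp_int (\<lambda>x y. (norm (v \<tau> x y))\<^sup>2) \<le> N"
      "\<And>\<tau>. \<tau> \<in> {s..t} \<Longrightarrow> hp_int (\<lambda>x y. (norm (vt \<tau> x y))\<^sup>2) \<le> N"
  shows "\<And>b. b \<in> {s..t} \<Longrightarrow> ((\<lambda>\<tau>. 2 * hp_int (\<lambda>x y. v \<tau> x y \<bullet> vt \<tau> x y)) has_integral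
      hp_int (\<lambda>x y. (norm (v b x y))\<^sup>2) - hp_int (\<lambda>x y. (norm (v s x y))\<^sup>2)) {s..b}"
proof -
  define r where "r = (\<lambda>n. 1 / real (Suc n))"
  define R where "R = (\<lambda>n. real (Suc n))"
  have r: "\<And>n. 0 < r n" "r \<longlonglongrightarrow> 0" unfolding r_def by (simp, rule LIMSEQ_Suc[OF lim_inverse_n'])
  have R: "filterlim R at_top sequentially"
    unfolding R_def using filterlim_compose[OF filterlim_real_sequentially filterlim_Suc] by simp
  define bx where "bx = (\<lambda>n. cbox (-pi, r n) (pi, R n))"
  have bx_sub: "bx n \<subseteq> UNIV \<times> {0<..}" for n unfolding bx_def using r(1)[of n] by auto
  define En where "En = (\<lambda>n \<tau>. integral (bx n) (\<lambda>q. v \<tau> (fst q) (snd q) \<bullet> v \<tau> (fst q) (snd q)))"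
  define In where "In = (\<lambda>n \<tau>. integral (bx n) (\<lambda>q. v \<tau> (fst q) (snd q) \<bullet> vt \<tau> (fst q) (snd q)
      + vt \<tau> (fst q) (snd q) \<bullet> v \<tau> (fst q) (snd q)))"
  have c: "continuous_on ({s..t} \<times> bx n) (\<lambda>p. v (fst p) (fst (snd p)) (snd (snd p)))"
    "continuous_on ({s..t} \<times> bx n) (\<lambda>p. vt (fst p) (fst (snd p)) (snd (snd p)))" for n
    using bx_sub[of n] by (auto intro!: continuous_on_subset[OF cont(1)[unfolded split_beta]]
        continuous_on_subset[OF cont(2)[unfolded split_beta]])
  have vv: "hp_L1 (\<lambda>x y. v \<tau> x y \<bullet> v \<tau> x y)" and vvt: "hp_L1 (\<lambda>x y. v \<tau> x y \<bullet> vt \<tau> x y + vt \<tau> x y \<bullet> v \<tau> x y)"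
    if "\<tau> \<in> {s..t}" for \<tau>
    by (intro hp_L1_add hp_L2_inner L2 that)+
  have En: "(En n has_vector_derivative In n \<tau>) (at \<tau> within {s..t})" if "\<tau> \<in> {s..t}" for n \<tau>
    unfolding En_def In_def bx_def
  proof (rule leibniz_rule_vector_derivative)
    show "((\<lambda>\<tau>. v \<tau> (fst q) (snd q) \<bullet> v \<tau> (fst q) (snd q)) has_vector_derivative
       v \<tau> (fst q) (snd q) \<bullet> vt \<tau> (fst q) (snd q) + vt \<tau> (fst q) (snd q) \<bullet> v \<tau> (fst q) (snd q)) (at \<tau> within {s..t})"
      if "\<tau> \<in> {s..t}" "q \<in> cbox (-pi, r n) (pi, R n)" for \<tau> q
      by (intro bounded_bilinear.has_vector_derivative[OF bounded_bilinear_inner] deriv)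
        (use that bx_sub[of n] in \<open>auto simp: bx_def\<close>)
    show "(\<lambda>q. v \<tau> (fst q) (snd q) \<bullet> v \<tau> (fst q) (snd q)) integrable_on cbox (-pi, r n) (pi, R n)"
      if "\<tau> \<in> {s..t}" for \<tau>
      by (rule set_borel_integral_eq_integral(1)[OF hp_box_set_integral(1)[OF hp_L1_cont[OF vv[OF that]] r(1)]])
    show "continuous_on ({s..t} \<times> cbox (-pi, r n) (pi, R n)) (\<lambda>(\<tau>, q). v \<tau> (fst q) (snd q) \<bullet> vt \<tau> (fst q) (snd q)
        + vt \<tau> (fst q) (snd q) \<bullet> v \<tau> (fst q) (snd q))"
      unfolding split_beta by (intro continuous_intros c[unfolded bx_def])
  qed (use that in auto)
  have Elim: "(\<lambda>n. En n \<tau>) \<longlonglongrightarrow> hp_int (\<lambda>x y. (norm (v \<tau> x y))\<^sup>2)" if "\<tau> \<in> {s..t}" for \<tau>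
    using hp_box_tendsto[OF vv[OF that] r R] by (simp add: En_def bx_def power2_norm_eq_inner)
  have Ilim: "(\<lambda>n. In n \<tau>) \<longlonglongrightarrow> 2 * hp_int (\<lambda>x y. v \<tau> x y \<bullet> vt \<tau> x y)" if "\<tau> \<in> {s..t}" for \<tau>
  proof -
    have "hp_int (\<lambda>x y. v \<tau> x y \<bullet> vt \<tau> x y + vt \<tau> x y \<bullet> v \<tau> x y) = 2 * hp_int (\<lambda>x y. v \<tau> x y \<bullet> vt \<tau> x y)"
      unfolding hp_int_cmult[symmetric] by (rule hp_int_cong) (simp add: inner_commute)
    then show ?thesis using hp_box_tendsto[OF vvt[OF that] r R] by (simp add: In_def bx_def)
  qed
  \<comment> \<open>Uniform in \<open>n\<close> and \<open>\<tau>\<close>, so the constant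
    \<open>2 * N\<close> dominates when the boxes grow under the time integral.\<close>
  have Ibound: "norm (In n \<tau>) \<le> 2 * N" if "\<tau> \<in> {s..t}" for n \<tau>
  proof -
    let ?f = "\<lambda>x y. (norm (v \<tau> x y))\<^sup>2 + (norm (vt \<tau> x y))\<^sup>2"
    have f: "hp_L1 ?f" by (intro hp_L1_add hp_L2_L1 L2 that)
    have "norm (In n \<tau>) \<le> integral (bx n) (\<lambda>q. ?f (fst q) (snd q))"
      unfolding In_def bx_def
    proof (rule integral_norm_bound_integral)
      show "norm (v \<tau> (fst q) (snd q) \<bullet> vt \<tau> (fst q) (snd q) + vt \<tau> (fst q) (snd q) \<bullet> v \<tau> (fst q) (snd q))
        \<le> ?f (fst q) (snd q)" for q
        using inner_le_sum_squares[of "v \<tau> (fst q) (snd q)" "vt \<tau> (fst q) (snd q)"] by (simp add: inner_commute)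
    qed (rule set_borel_integral_eq_integral(1)[OF hp_box_set_integral(1)[OF hp_L1_cont[OF vvt[OF that]] r(1)]]
        set_borel_integral_eq_integral(1)[OF hp_box_set_integral(1)[OF hp_L1_cont[OF f] r(1)]])+
    also have "\<dots> \<le> hp_int ?f"
      unfolding bx_def by (rule hp_box_le[OF f _ r(1)]) simp
    also have "\<dots> \<le> 2 * N" using hp_int_add[OF hp_L2_L1[OF L2(1)] hp_L2_L1[OF L2(2)]] N that by fastforce
    finally show ?thesis .
  qed
  fix b assume b: "b \<in> {s..t}"
  have In_int: "(In n has_integral (En n b - En n s)) {s..b}" for n
    by (rule fundamental_theorem_of_calculus)
      (use b in \<open>auto intro: has_vector_derivative_within_subset[OF En]\<close>)
  let ?I = "\<lambda>\<tau>. 2 * hp_int (\<lambda>x y. v \<tau> x y \<bullet> vt \<tau> x y)"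
  have dc: "In n integrable_on {s..b}" "(\<lambda>_. 2 * N) integrable_on {s..b}"
    "\<tau> \<in> {s..b} \<Longrightarrow> norm (In n \<tau>) \<le> 2 * N" "\<tau> \<in> {s..b} \<Longrightarrow> (\<lambda>n. In n \<tau>) \<longlonglongrightarrow> ?I \<tau>" for n \<tau>
    using has_integral_integrable[OF In_int] Ibound[of \<tau> n] Ilim[of \<tau>] b by (auto intro: integrable_const_ivl)
  have "(\<lambda>n. integral {s..b} (In n)) \<longlonglongrightarrow> integral {s..b} ?I"
    by (rule dominated_convergence(2)[OF dc])
  moreover have "(\<lambda>n. integral {s..b} (In n)) \<longlonglongrightarrow>
      hp_int (\<lambda>x y. (norm (v b x y))\<^sup>2) - hp_int (\<lambda>x y. (norm (v s x y))\<^sup>2)"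
    unfolding integral_unique[OF In_int] using b by (intro tendsto_diff Elim) auto
  ultimately have eq: "integral {s..b} ?I =
      hp_int (\<lambda>x y. (norm (v b x y))\<^sup>2) - hp_int (\<lambda>x y. (norm (v s x y))\<^sup>2)"
    by (rule LIMSEQ_unique)
  show "(?I has_integral hp_int (\<lambda>x y. (norm (v b x y))\<^sup>2) - hp_int (\<lambda>x y. (norm (v s x y))\<^sup>2)) {s..b}"
    unfolding eq[symmetric] by (rule integrable_integral[OF dominated_convergence(1)[OF dc]])
qed

lemma energy_gronwall:
  fixes v vt :: "real \<Rightarrow> vfield"
  assumes "s < t"
    and deriv: "\<And>\<tau> x y. \<tau> \<in> {s..t} \<Longrightarrow> y > 0 \<Longrightarrow>
      ((\<lambda>\<tau>. v \<tau> x y) has_vector_derivative vt \<tau> x y) (at \<tau> within {s..t})"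
    and cont: "continuous_on ({s..t} \<times> UNIV \<times> {0<..}) (\<lambda>(\<tau>, x, y). v \<tau> x y)"
      "continuous_on ({s..t} \<times> UNIV \<times> {0<..}) (\<lambda>(\<tau>, x, y). vt \<tau> x y)"
    and L2: "\<And>\<tau>. \<tau> \<in> {s..t} \<Longrightarrow> hp_L2 (v \<tau>)" "\<And>\<tau>. \<tau> \<in> {s..t} \<Longrightarrow> hp_L2 (vt \<tau>)"
    and N: "\<And>\<tau>. \<tau> \<in> {s..t} \<Longrightarrow> hp_int (\<lambda>x y. (norm (v \<tau> x y))\<^sup>2) \<le> N"
      "\<And>\<tau>. \<tau> \<in> {s..t} \<Longrightarrow> hp_int (\<lambda>x y. (norm (vt \<tau> x y))\<^sup>2) \<le> N"
    and "0 \<le> K" "0 \<le> c"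
    and rate: "\<And>\<tau>. \<tau> \<in> {s..t} \<Longrightarrow>
      2 * hp_int (\<lambda>x y. v \<tau> x y \<bullet> vt \<tau> x y) \<le> K * hp_int (\<lambda>x y. (norm (v \<tau> x y))\<^sup>2) + c"
  shows "hp_int (\<lambda>x y. (norm (v t x y))\<^sup>2) \<le>
    (hp_int (\<lambda>x y. (norm (v s x y))\<^sup>2) + c * (t - s)) * exp (K * (t - s))"
proof -
  define E where "E = (\<lambda>\<tau>. hp_int (\<lambda>x y. (norm (v \<tau> x y))\<^sup>2))"
  define I where "I = (\<lambda>\<tau>. 2 * hp_int (\<lambda>x y. v \<tau> x y \<bullet> vt \<tau> x y))"
  have inc: "(I has_integral (E b - E s)) {s..b}" if "b \<in> {s..t}" for b
    unfolding I_def E_def by (rule energy_increment[OF assms(1-8) that]) 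
  \<comment> \<open>Continuity of the energy comes out of the increment identity, which presents
    \<open>E\<close> as \<open>E s\<close> plus an indefinite integral.\<close>
  have "continuous_on {s..t} (\<lambda>b. E s + integral {s..b} I)"
    using has_integral_integrable[OF inc[of t]] assms(1)
    by (intro continuous_intros indefinite_integral_continuous_1) auto
  moreover have "E b = E s + integral {s..b} I" if "b \<in> {s..t}" for b
    using integral_unique[OF inc[OF that]] by simp
  ultimately have cE: "continuous_on {s..t} E" by (metis (no_types, lifting) continuous_on_eq)
  have "E t \<le> (E s + c * (t - s)) * exp (K * (t - s))"
  proof (rule gronwall[OF _ cE assms(9,10)])
    fix b assume b: "b \<in> {s..t}"
    have "integral {s..b} I \<le> integral {s..b} (\<lambda>r. K * E r + c)"
    proof (rule integral_le)
      show "I integrable_on {s..b}" by (rule has_integral_integrable[OF inc[OF b]])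
      show "(\<lambda>r. K * E r + c) integrable_on {s..b}"
        using b by (intro integrable_continuous_interval continuous_intros continuous_on_subset[OF cE]) auto
      show "I r \<le> K * E r + c" if "r \<in> {s..b}" for r
        unfolding I_def E_def by (rule rate) (use that b in auto)
    qed
    then show "E b \<le> E s + integral {s..b} (\<lambda>r. K * E r + c)"
      using integral_unique[OF inc[OF b]] by simp
  qed (use assms(1) in simp)
  then show ?thesis by (simp add: E_def)
qed

section \<open>Fixed-time regularity and L2 bounds of solutions\<close>

lemma continuous_time_slice:
  assumes "continuous_on (J \<times> UNIV \<times> Y) (\<lambda>(t, x, y). F t x y)" "t \<in> J"
  shows "continuous_on (UNIV \<times> Y) (\<lambda>q. F t (fst q) (snd q))"
proof -
  have "continuous_on (UNIV \<times> Y) ((\<lambda>(t, x, y). F t x y) \<circ> (\<lambda>q. (t, fst q, snd q)))"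
    by (intro continuous_on_compose continuous_intros continuous_on_subset[OF assms(1)]) (use assms(2) in auto)
  then show ?thesis by (simp add: o_def split_beta)
qed

lemma hp_cont_time_slice:
  assumes "continuous_on (J \<times> UNIV \<times> Y) (\<lambda>(t, x, y). F t x y)" "t \<in> J" "{0<..} \<subseteq> Y"
  shows "hp_cont (F t)"
  unfolding hp_cont_def
  by (rule continuous_on_subset[OF continuous_time_slice[OF assms(1,2)]]) (use assms(3) in auto)

lemma C1_space_hp_C1:
  assumes C: "C1_space J Y f" and t: "t \<in> J" and Y: "{0<..} \<subseteq> Y"
  shows "hp_C1 (f t) (dx (f t)) (dy (f t))"
  unfolding hp_C1_def
proof (intro conjI allI impI)
  show "hp_cont (f t)" "hp_cont (dx (f t))" "hp_cont (dy (f t))"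
    using C hp_cont_time_slice[OF _ t Y] by (auto simp: C1_space_def)
  fix x y :: real assume y: "y > 0"
  have d: "(\<lambda>s. f t s y) differentiable (at x)" "f t x differentiable (at y within {0..})"
    using C t Y y by (auto simp: C1_space_def)
  show "((\<lambda>s. f t s y) has_vector_derivative dx (f t) x y) (at x)"
    using d(1) unfolding dx_def vector_derivative_works .
  have "at y within {0..} = at y" by (rule at_within_interior) (use y in \<open>simp add: interior_real_atLeast\<close>)
  then show "(f t x has_vector_derivative dy (f t) x y) (at y)"
    using d(2) unfolding dy_def vector_derivative_works by simp
qed

text \<open>The chain rule for translation by \<open>2 * pi\<close> at \<open>-pi\<close>; it makes
  the lateral fluxes of the Laplacian cancel.\<close>

lemma periodic_dx:
  assumes "periodic_x f" "y > 0" "hp_C1 f (dx f) fy"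
  shows "dx f pi y = dx f (-pi) y"
proof -
  have "((\<lambda>s. s + 2 * pi) has_vector_derivative 1) (at (-pi))" by (auto intro!: derivative_eq_intros)
  moreover have "((\<lambda>s. f s y) has_vector_derivative dx f pi y) (at (- pi + 2 * pi))"
    using hp_C1D(4)[OF assms(3,2), of pi] by simp
  ultimately have "((\<lambda>s. f s y) \<circ> (\<lambda>s. s + 2 * pi) has_vector_derivative 1 *\<^sub>R dx f pi y) (at (-pi))"
    by (rule vector_diff_chain_at)
  moreover have "(\<lambda>s. f s y) \<circ> (\<lambda>s. s + 2 * pi) = (\<lambda>s. f s y)"
    using assms(1,2) by (auto simp: periodic_x_def fun_eq_iff)
  ultimately have "((\<lambda>s. f s y) has_vector_derivative dx f pi y) (at (-pi))" by (simp only: scaleR_one)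
  from vector_derivative_at[OF this] show ?thesis unfolding dx_def[of f "-pi" y] by (rule sym)
qed

lemma locally_bounded_L2_D:
  assumes "locally_bounded_L2 J F" "compact K" "K \<subseteq> J" "\<And>t. t \<in> K \<Longrightarrow> hp_cont (F t)"
  obtains N where "\<And>t. t \<in> K \<Longrightarrow> hp_L2 (F t)" "\<And>t. t \<in> K \<Longrightarrow> hp_int (\<lambda>x y. (norm (F t x y))\<^sup>2) \<le> N"
proof -
  obtain B :: real where B: "\<forall>t\<in>K. L2_norm (F t) \<le> ennreal B"
    using assms(1)[unfolded locally_bounded_L2_def, rule_format, OF conjI[OF assms(2,3)]] by (elim exE)
  show ?thesis
    by (rule that[of "B\<^sup>2"]) (rule L2_norm_bound[OF assms(4)]; use B in blast)+
qed

lemma locally_bounded_L2_hp_L2: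
  assumes "locally_bounded_L2 J F" "t \<in> J" "hp_cont (F t)"
  shows "hp_L2 (F t)"
  by (rule locally_bounded_L2_D[OF assms(1), of "{t}"]) (use assms(2,3) in auto)

lemma hp_int_norm_add_le:
  assumes "hp_L2 f" "hp_L2 g"
  shows "hp_int (\<lambda>x y. (norm (f x y + g x y))\<^sup>2) \<le>
    2 * (hp_int (\<lambda>x y. (norm (f x y))\<^sup>2) + hp_int (\<lambda>x y. (norm (g x y))\<^sup>2))"
proof -
  have "hp_int (\<lambda>x y. (norm (f x y + g x y))\<^sup>2) \<le> hp_int (\<lambda>x y. 2 * ((norm (f x y))\<^sup>2 + (norm (g x y))\<^sup>2))"
    by (intro hp_int_mono hp_L1_cmult hp_L1_add hp_L2_L1 hp_L2_add assms norm_add_square_le)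
  then show ?thesis unfolding hp_int_cmult hp_int_add[OF hp_L2_L1[OF assms(1)] hp_L2_L1[OF assms(2)]] .
qed

lemma hp_int_norm_diff_le:
  assumes "hp_L2 f" "hp_L2 g"
  shows "hp_int (\<lambda>x y. (norm (f x y - g x y))\<^sup>2) \<le>
    2 * (hp_int (\<lambda>x y. (norm (f x y))\<^sup>2) + hp_int (\<lambda>x y. (norm (g x y))\<^sup>2))"
  using hp_int_norm_add_le[OF assms(1) hp_L2_cscale[OF assms(2), of "-1"]] by simp

lemma continuous_L2_hp_L2:
  assumes "continuous_L2 J f" "t \<in> J" "hp_cont (f t)"
  shows "hp_L2 (f t)"
  using assms hp_L2_if_L2_norm by (auto simp: continuous_L2_def)

lemma continuous_L2_eventually:
  assumes f: "continuous_L2 J f" "\<And>t. t \<in> J \<Longrightarrow> hp_cont (f t)" and t: "t \<in> J" and "\<epsilon> > 0"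
  shows "eventually (\<lambda>s. hp_int (\<lambda>x y. (norm (f s x y - f t x y))\<^sup>2) \<le> \<epsilon>\<^sup>2) (at t within J)"
proof -
  have "((\<lambda>s. L2_norm (\<lambda>x y. f s x y - f t x y)) \<longlongrightarrow> 0) (at t within J)"
    using f(1) t by (auto simp: continuous_L2_def)
  then have "eventually (\<lambda>s. L2_norm (\<lambda>x y. f s x y - f t x y) < ennreal \<epsilon>) (at t within J)"
    by (rule order_tendstoD(2)) (use \<open>\<epsilon> > 0\<close> in simp)
  moreover have "eventually (\<lambda>s. s \<in> J) (at t within J)" by (simp add: eventually_at_filter)
  ultimately show ?thesis
  proof eventually_elim
    case (elim s)
    show ?case
      by (rule L2_norm_bound(2)[OF _ less_imp_le[OF elim(1)]]) (intro hp_cont_rules f(2) elim(2) t)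
  qed
qed

text \<open>Continuity in L2 bounds the energy near each time, and bisection glues the local bounds
  over the compact interval. The predicate repeats \<open>t \<in> {a..b}\<close> because the small
  intervals of the bisection principle may stick out of it.\<close>

lemma continuous_L2_bounded:
  fixes f :: "real \<Rightarrow> real \<Rightarrow> real \<Rightarrow> 'a::real_normed_vector"
  assumes f: "continuous_L2 {a..b} f" "\<And>t. t \<in> {a..b} \<Longrightarrow> hp_cont (f t)" and "a \<le> b"
  obtains N where "\<And>t. t \<in> {a..b} \<Longrightarrow> hp_int (\<lambda>x y. (norm (f t x y))\<^sup>2) \<le> N"
proof -
  let ?F = "\<lambda>t. hp_int (\<lambda>x y. (norm (f t x y))\<^sup>2)"
  have "\<exists>N. \<forall>t. a \<le> t \<and> t \<le> b \<and> t \<in> {a..b} \<longrightarrow> ?F t \<le> N"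
  proof (rule Bolzano[OF assms(3), where P="\<lambda>c d. \<exists>N. \<forall>t. c \<le> t \<and> t \<le> d \<and> t \<in> {a..b} \<longrightarrow> ?F t \<le> N"])
    fix c d e
    assume "\<exists>N. \<forall>t. c \<le> t \<and> t \<le> d \<and> t \<in> {a..b} \<longrightarrow> ?F t \<le> N" "\<exists>N. \<forall>t. d \<le> t \<and> t \<le> e \<and> t \<in> {a..b} \<longrightarrow> ?F t \<le> N"
    then obtain N1 N2 where N: "\<And>t. c \<le> t \<Longrightarrow> t \<le> d \<Longrightarrow> t \<in> {a..b} \<Longrightarrow> ?F t \<le> N1"
      "\<And>t. d \<le> t \<Longrightarrow> t \<le> e \<Longrightarrow> t \<in> {a..b} \<Longrightarrow> ?F t \<le> N2" by blast
    show "\<exists>N. \<forall>t. c \<le> t \<and> t \<le> e \<and> t \<in> {a..b} \<longrightarrow> ?F t \<le> N"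
    proof (intro exI[of _ "max N1 N2"] allI impI)
      fix t assume "c \<le> t \<and> t \<le> e \<and> t \<in> {a..b}"
      then show "?F t \<le> max N1 N2" using N[of t] by (cases "t \<le> d") (auto simp: le_max_iff_disj)
    qed
  next
    fix x assume "a \<le> x" "x \<le> b"
    then have x: "x \<in> {a..b}" by simp
    obtain d where d: "d > 0" "\<And>s. s \<in> {a..b} \<Longrightarrow> s \<noteq> x \<Longrightarrow> dist s x < d \<Longrightarrow>
        hp_int (\<lambda>z y. (norm (f s z y - f x z y))\<^sup>2) \<le> 1\<^sup>2"
      using continuous_L2_eventually[OF f(1) f(2) x zero_less_one] unfolding eventually_at by auto
    have L2: "hp_L2 (f s)" if "s \<in> {a..b}" for s using continuous_L2_hp_L2[OF f(1) that f(2)[OF that]] .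
    \<comment> \<open>The filter \<open>at x within {a..b}\<close> leaves out \<open>s = x\<close>,
      which is therefore treated separately.\<close>
    have "?F s \<le> 2 * (1 + ?F x) + ?F x" if s: "s \<in> {a..b}" "dist s x < d" for s
    proof (cases "s = x")
      case True
      have "0 \<le> ?F x" by (rule hp_int_nonneg) simp
      with True show ?thesis by simp
    next
      case False
      have "?F s \<le> 2 * (hp_int (\<lambda>z y. (norm (f s z y - f x z y))\<^sup>2) + ?F x)"
        using hp_int_norm_add_le[OF hp_L2_diff[OF L2[OF s(1)] L2[OF x]] L2[OF x]] by simp
      moreover have "0 \<le> ?F x" by (rule hp_int_nonneg) simp
      ultimately show ?thesis using d(2)[OF s(1) False s(2)] by simp
    qed
    then show "\<exists>d>0. \<forall>c e. c \<le> x \<and> x \<le> e \<and> e - c < d \<longrightarrow>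
        (\<exists>N. \<forall>t. c \<le> t \<and> t \<le> e \<and> t \<in> {a..b} \<longrightarrow> ?F t \<le> N)"
      using d(1) by (intro exI[of _ d]) (auto simp: dist_real_def intro!: exI[of _ "2 * (1 + ?F x) + ?F x"])
  qed
  then show ?thesis using that by auto
qed

lemma energy_estimate:
  fixes u w :: "real \<Rightarrow> vfield"
  assumes ns: "navier_stokes_solution \<nu> T u0 u" and eu: "euler_solution T u0 w"
    and "0 < T" "0 \<le> \<nu>" "0 \<le> B" "0 \<le> U" "0 \<le> S" "0 \<le> W"
    and B: "\<And>t x y. t \<in> {0..T} \<Longrightarrow> y > 0 \<Longrightarrow> norm (dx (w t) x y) \<le> B \<and> norm (dy (w t) x y) \<le> B"
    and U: "\<And>t x. t \<in> {0..T} \<Longrightarrow> x \<in> {-pi..pi} \<Longrightarrow> \<bar>fst (w t x 0)\<bar> \<le> U"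
    and W: "\<And>t. t \<in> {0..T} \<Longrightarrow>
      hp_int (\<lambda>x y. (norm (dx (w t) x y))\<^sup>2) + hp_int (\<lambda>x y. (norm (dy (w t) x y))\<^sup>2) \<le> W"
    and S: "\<And>t x. t \<in> {0<..T} \<Longrightarrow> x \<in> {-pi..pi} \<Longrightarrow> \<bar>vorticity (u t) x 0\<bar> \<le> S"
    and t: "t \<in> {0..T}"
  shows "L2_norm (\<lambda>x y. u t x y - w t x y)
    \<le> ennreal (sqrt (2 * \<nu> * (2 * pi * (U * S) + W / 4) * T * exp (4 * B * T)))"
proof -
  \<comment> \<open>The factor 2 is that of \<open>d/dt |v|^2 = 2 v . vt\<close>; for the same
    reason the rate \<open>2 B\<close> becomes \<open>4 B\<close>.\<close>
  define c where "c = 2 * \<nu> * (2 * pi * (U * S) + W / 4)"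
  have c0: "0 \<le> c" using assms(3-8) by (simp add: c_def)
  let ?v = "\<lambda>t x y. u t x y - w t x y"
  let ?vt = "\<lambda>t x y. dt {0<..T} u t x y - dt {0..T} w t x y"
  let ?E = "\<lambda>t. hp_int (\<lambda>x y. (norm (?v t x y))\<^sup>2)"
  obtain p where p: "\<And>t. t \<in> {0<..T} \<Longrightarrow> periodic_x (p t)" "C1_space {0<..T} {0..} p"
      "locally_bounded_L2 {0<..T} (\<lambda>t. gradient (p t))"
      "\<And>t x y. t \<in> {0<..T} \<Longrightarrow> y \<ge> 0 \<Longrightarrow> dt {0<..T} u t x y - \<nu> *\<^sub>R laplacian (u t) x y
             + convection (u t) x y + gradient (p t) x y = 0"
    using ns unfolding navier_stokes_solution_def by blast
  obtain pb where pb: "\<And>t. t \<in> {0..T} \<Longrightarrow> periodic_x (pb t)" "C1_space {0..T} {0<..} pb"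
      "locally_bounded_L2 {0..T} (\<lambda>t. gradient (pb t))"
      "\<And>t x y. t \<in> {0..T} \<Longrightarrow> y > 0 \<Longrightarrow> dt {0..T} w t x y + convection (w t) x y + gradient (pb t) x y = 0"
    using eu unfolding euler_solution_def by blast
  have u: "\<And>t. t \<in> {0..T} \<Longrightarrow> periodic_x (u t)" "\<And>x y. y \<ge> 0 \<Longrightarrow> u 0 x y = u0 x y"
      "continuous_L2 {0..T} u" "C1_spacetime {0<..T} {0..} u" "C1_space {0<..T} {0..} (\<lambda>t. dx (u t))"
      "C1_space {0<..T} {0..} (\<lambda>t. dy (u t))"
      "\<And>t x y. t \<in> {0<..T} \<Longrightarrow> y \<ge> 0 \<Longrightarrow> divergence (u t) x y = 0"
      "\<And>t x. t \<in> {0<..T} \<Longrightarrow> u t x 0 = 0"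
    and uL: "locally_bounded_L2 {0<..T} (dt {0<..T} u)" "locally_bounded_L2 {0<..T} (\<lambda>t. dx (u t))"
      "locally_bounded_L2 {0<..T} (\<lambda>t. dy (u t))" "locally_bounded_L2 {0<..T} (\<lambda>t. dx (dx (u t)))"
      "locally_bounded_L2 {0<..T} (\<lambda>t. dx (dy (u t)))" "locally_bounded_L2 {0<..T} (\<lambda>t. dy (dy (u t)))"
    using ns unfolding navier_stokes_solution_def by blast+
  have w: "\<And>t. t \<in> {0..T} \<Longrightarrow> periodic_x (w t)" "\<And>x y. y \<ge> 0 \<Longrightarrow> w 0 x y = u0 x y"
      "continuous_L2 {0..T} w" "continuous_on ({0..T} \<times> UNIV \<times> {0..}) (\<lambda>(t, x, y). w t x y)"
      "C1_spacetime {0..T} {0<..} w"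
      "\<And>t x y. t \<in> {0..T} \<Longrightarrow> y > 0 \<Longrightarrow> divergence (w t) x y = 0"
      "\<And>t x. t \<in> {0..T} \<Longrightarrow> snd (w t x 0) = 0"
    and wL: "locally_bounded_L2 {0..T} (dt {0..T} w)" "locally_bounded_L2 {0..T} (\<lambda>t. dx (w t))"
      "locally_bounded_L2 {0..T} (\<lambda>t. dy (w t))"
    using eu unfolding euler_solution_def by blast+
  have u_space: "C1_space {0<..T} {0..} u" and w_space: "C1_space {0..T} {0<..} w"
    using u(4) w(5) by (auto simp: C1_spacetime_def)
  have Y: "{0<..} \<subseteq> {0::real..}" "{0<..} \<subseteq> {0::real<..}" by auto
  have w_cont: "hp_cont (w t)" if "t \<in> {0..T}" for t by (rule hp_cont_time_slice[OF w(4) that Y(1)])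
  \<comment> \<open>The classical regularity of the viscous solution starts after time 0. At time 0
    both solutions equal \<open>u0\<close> for \<open>y \<ge> 0\<close>, so continuity is inherited
    from the Euler flow.\<close>
  have u_cont: "hp_cont (u t)" if "t \<in> {0..T}" for t
  proof (cases "t = 0")
    case True
    have "hp_cont (u 0) \<longleftrightarrow> hp_cont (w 0)" by (rule hp_cont_cong) (simp add: u(2) w(2))
    then show ?thesis using True w_cont that by simp
  next
    case False
    then show ?thesis using hp_C1D(1)[OF C1_space_hp_C1[OF u_space _ Y(1)], of t] that by simp
  qed
  have u_L2: "hp_L2 (u t)" and w_L2: "hp_L2 (w t)" if "t \<in> {0..T}" for t
    using continuous_L2_hp_L2 u(3) w(3) u_cont w_cont that by blast+
  have v_L2: "hp_L2 (?v t)" if "t \<in> {0..T}" for t by (intro hp_L2_diff u_L2 w_L2 that)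
  have dtu_cont: "hp_cont (dt {0<..T} u t)" if "t \<in> {0<..T}" for t
    using u(4) hp_cont_time_slice[OF _ that Y(1)] by (auto simp: C1_spacetime_def)
  have dtw_cont: "hp_cont (dt {0..T} w t)" if "t \<in> {0..T}" for t
    using w(5) hp_cont_time_slice[OF _ that Y(2)] by (auto simp: C1_spacetime_def)

  have rate: "2 * hp_int (\<lambda>x y. ?v t x y \<bullet> ?vt t x y) \<le> 4 * B * ?E t + c" if t: "t \<in> {0<..T}" for t
  proof -
    have t': "t \<in> {0..T}" using t by auto
    note Cu = C1_space_hp_C1[OF u_space t Y(1)] and Cux = C1_space_hp_C1[OF u(5) t Y(1)]
      and Cuy = C1_space_hp_C1[OF u(6) t Y(1)] and Cw = C1_space_hp_C1[OF w_space t' Y(2)]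
      and Cp = C1_space_hp_C1[OF p(2) t Y(1)] and Cpb = C1_space_hp_C1[OF pb(2) t' Y(2)]
    have grad: "gradient f = (\<lambda>x y. (dx f x y, dy f x y))" for f by (auto simp: gradient_def fun_eq_iff)
    have gp: "hp_L2 (gradient (p t))"
      by (rule locally_bounded_L2_hp_L2[OF p(3) t]) (unfold grad, intro hp_cont_rules hp_C1D[OF Cp])
    have gpb: "hp_L2 (gradient (pb t))"
      by (rule locally_bounded_L2_hp_L2[OF pb(3) t']) (unfold grad, intro hp_cont_rules hp_C1D[OF Cpb])
    have per_pi: "f pi y = f (-pi) y" if "periodic_x f" "y > 0" for f :: "real \<Rightarrow> real \<Rightarrow> 'b" and y
      using that(1)[unfolded periodic_x_def, rule_format, of y "-pi"] that(2) by simp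
    have fp: "flow_pair (u t) (w t) (dx (u t)) (dy (u t)) (dx (dx (u t))) (dy (dx (u t)))
        (dx (dy (u t))) (dy (dy (u t))) (dx (w t)) (dy (w t)) (\<lambda>x y. p t x y - pb t x y)
        (\<lambda>x y. dx (p t) x y - dx (pb t) x y) (\<lambda>x y. dy (p t) x y - dy (pb t) x y) B S U W"
    proof (unfold_locales, goal_cases)
      case 1 show ?case by (rule Cu)
    next
      case 2 show ?case by (rule Cux)
    next
      case 3 show ?case by (rule Cuy)
    next
      case 4 show ?case by (rule Cw)
    next
      case 5 show ?case by (rule hp_C1_diff[OF Cp Cpb])
    next
      case 6 show ?case by (rule u(1)[OF t'])
    next
      case (7 y) then show ?case by (rule per_pi[OF w(1)[OF t']])
    next
      case (8 y) show ?case by (rule periodic_dx[OF u(1)[OF t'] 8 Cu])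
    next
      case (9 y) then show ?case using per_pi[OF p(1)[OF t]] per_pi[OF pb(1)[OF t']] by simp
    next
      case 10 show ?case using continuous_time_slice[OF _ t] u_space by (auto simp: C1_space_def)
    next
      case 11 show ?case using continuous_time_slice[OF _ t] u_space by (auto simp: C1_space_def)
    next
      case 12 show ?case by (rule continuous_time_slice[OF w(4) t'])
    next
      case (13 x) show ?case by (rule u(8)[OF t])
    next
      case (14 x) show ?case by (rule w(7)[OF t'])
    next
      case (15 x y) then show ?case using u(7)[OF t, of y x] by (simp add: divergence_def)
    next
      case (16 x y) then show ?case using w(6)[OF t', of y x] by (simp add: divergence_def)
    next
      case 17 show ?case by (rule u_L2[OF t'])
    next
      case 18 show ?case by (rule locally_bounded_L2_hp_L2[OF uL(2) t hp_C1D(2)[OF Cu]])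
    next
      case 19 show ?case by (rule locally_bounded_L2_hp_L2[OF uL(3) t hp_C1D(3)[OF Cu]])
    next
      case 20 show ?case by (rule locally_bounded_L2_hp_L2[OF uL(4) t hp_C1D(2)[OF Cux]])
    next
      case 21 show ?case by (rule locally_bounded_L2_hp_L2[OF uL(5) t hp_C1D(2)[OF Cuy]])
    next
      case 22 show ?case by (rule locally_bounded_L2_hp_L2[OF uL(6) t hp_C1D(3)[OF Cuy]])
    next
      case 23 show ?case by (rule w_L2[OF t'])
    next
      case 24 show ?case by (rule locally_bounded_L2_hp_L2[OF wL(2) t' hp_C1D(2)[OF Cw]])
    next
      case 25 show ?case by (rule locally_bounded_L2_hp_L2[OF wL(3) t' hp_C1D(3)[OF Cw]])
    next
      case 26 show ?case using hp_L2_diff[OF hp_L2_fst_snd(1)[OF gp] hp_L2_fst_snd(1)[OF gpb]] by (simp add: grad)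
    next
      case 27 show ?case using hp_L2_diff[OF hp_L2_fst_snd(2)[OF gp] hp_L2_fst_snd(2)[OF gpb]] by (simp add: grad)
    next
      case (28 x y) then show ?case using B[OF t'] by blast
    next
      case (29 x y) then show ?case using B[OF t'] by blast
    next
      case (30 x)
      \<comment> \<open>As \<open>u\<close> is zero along the whole wall, so is its tangential
        derivative, and the vorticity there is minus the shear.\<close>
      have "dx (u t) x 0 = 0" by (simp add: dx_def u(8)[OF t])
      then show ?case using S[OF t 30] by (simp add: vorticity_def)
    next
      case (31 x) then show ?case by (rule U[OF t'])
    next
      case 32 show ?case by (rule W[OF t'])
    qed
    have "hp_int (\<lambda>x y. flow_pair.v (u t) (w t) x y \<bullet> ?vt t x y)
      \<le> \<nu> * (2 * pi * (U * S) + W / 4) + 2 * B * hp_int (\<lambda>x y. (norm (flow_pair.v (u t) (w t) x y))\<^sup>2)"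
    proof (rule flow_pair.energy_rate[OF fp assms(4)])
      fix x y :: real assume y: "y > 0"
      have "dt {0<..T} u t x y = \<nu> *\<^sub>R laplacian (u t) x y - convection (u t) x y - gradient (p t) x y"
        using p(4)[OF t less_imp_le[OF y], of x] by (simp add: algebra_simps eq_neg_iff_add_eq_0)
      moreover have "dt {0..T} w t x y = - convection (w t) x y - gradient (pb t) x y"
        using pb(4)[OF t' y, of x] by (simp add: algebra_simps eq_neg_iff_add_eq_0)
      moreover have "(dx (p t) x y - dx (pb t) x y, dy (p t) x y - dy (pb t) x y)
          = gradient (p t) x y - gradient (pb t) x y" by (simp add: gradient_def)
      ultimately show "?vt t x y = \<nu> *\<^sub>R (dx (dx (u t)) x y + dy (dy (u t)) x y)
          - (fst (u t x y) *\<^sub>R dx (u t) x y + snd (u t x y) *\<^sub>R dy (u t) x y)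
          + (fst (w t x y) *\<^sub>R dx (w t) x y + snd (w t x y) *\<^sub>R dy (w t) x y)
          - (dx (p t) x y - dx (pb t) x y, dy (p t) x y - dy (pb t) x y)"
        by (simp add: laplacian_def convection_def)
    qed
    then show ?thesis unfolding flow_pair.v_def[OF fp] c_def by linarith
  qed

  \<comment> \<open>The time derivative of \<open>u\<close> is bounded in L2 on compact subsets of
    \<open>{0<..T}\<close>, so the constant \<open>N\<close> below may blow up as \<open>s\<close>
    tends to 0. It justifies the energy identity and does not appear in the conclusion.\<close>
  have step: "?E t \<le> (?E s + c * T) * exp (4 * B * T)" if s: "0 < s" "s < t" "t \<le> T" for s t
  proof -
    have J: "{s..t} \<subseteq> {0<..T}" "{s..t} \<subseteq> {0..T}" using s by auto
    obtain Nu where Nu: "\<And>\<tau>. \<tau> \<in> {0..T} \<Longrightarrow> hp_int (\<lambda>x y. (norm (u \<tau> x y))\<^sup>2) \<le> Nu"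
      using continuous_L2_bounded[OF u(3) u_cont] \<open>0 < T\<close> by (metis less_imp_le)
    obtain Nw where Nw: "\<And>\<tau>. \<tau> \<in> {0..T} \<Longrightarrow> hp_int (\<lambda>x y. (norm (w \<tau> x y))\<^sup>2) \<le> Nw"
      using continuous_L2_bounded[OF w(3) w_cont] \<open>0 < T\<close> by (metis less_imp_le)
    obtain Nu' where Nu': "\<And>\<tau>. \<tau> \<in> {s..t} \<Longrightarrow> hp_L2 (dt {0<..T} u \<tau>)"
        "\<And>\<tau>. \<tau> \<in> {s..t} \<Longrightarrow> hp_int (\<lambda>x y. (norm (dt {0<..T} u \<tau> x y))\<^sup>2) \<le> Nu'"
      using locally_bounded_L2_D[OF uL(1) compact_Icc J(1)] dtu_cont J(1) by (metis subsetD)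
    obtain Nw' where Nw': "\<And>\<tau>. \<tau> \<in> {s..t} \<Longrightarrow> hp_L2 (dt {0..T} w \<tau>)"
        "\<And>\<tau>. \<tau> \<in> {s..t} \<Longrightarrow> hp_int (\<lambda>x y. (norm (dt {0..T} w \<tau> x y))\<^sup>2) \<le> Nw'"
      using locally_bounded_L2_D[OF wL(1) compact_Icc J(2)] dtw_cont J(2) by (metis subsetD)
    have "?E t \<le> (?E s + c * (t - s)) * exp (4 * B * (t - s))"
    proof (rule energy_gronwall[OF s(2), where vt="?vt" and N="max (2 * (Nu + Nw)) (2 * (Nu' + Nw'))"])
      fix \<tau> assume \<tau>: "\<tau> \<in> {s..t}"
      then have \<tau>': "\<tau> \<in> {0<..T}" "\<tau> \<in> {0..T}" using J by auto
      show "((\<lambda>\<tau>. ?v \<tau> x y) has_vector_derivative ?vt \<tau> x y) (at \<tau> within {s..t})" if "y > 0" for x y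
      proof (intro has_vector_derivative_diff)
        have "(\<lambda>s. u s x y) differentiable (at \<tau> within {0<..T})"
          using u(4) \<tau>' that by (auto simp: C1_spacetime_def)
        then show "((\<lambda>\<tau>. u \<tau> x y) has_vector_derivative dt {0<..T} u \<tau> x y) (at \<tau> within {s..t})"
          unfolding dt_def vector_derivative_works by (rule has_vector_derivative_within_subset[OF _ J(1)])
        have "(\<lambda>s. w s x y) differentiable (at \<tau> within {0..T})"
          using w(5) \<tau>' that by (auto simp: C1_spacetime_def)
        then show "((\<lambda>\<tau>. w \<tau> x y) has_vector_derivative dt {0..T} w \<tau> x y) (at \<tau> within {s..t})"
          unfolding dt_def vector_derivative_works by (rule has_vector_derivative_within_subset[OF _ J(2)])
      qed
      show "hp_L2 (?v \<tau>)" by (rule v_L2[OF \<tau>'(2)])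
      show "hp_L2 (?vt \<tau>)" by (intro hp_L2_diff Nu' Nw' \<tau>)
      show "?E \<tau> \<le> max (2 * (Nu + Nw)) (2 * (Nu' + Nw'))"
        by (intro max.coboundedI1 order.trans[OF hp_int_norm_diff_le[OF u_L2[OF \<tau>'(2)] w_L2[OF \<tau>'(2)]]]
            mult_left_mono add_mono Nu Nw \<tau>') simp
      show "hp_int (\<lambda>x y. (norm (?vt \<tau> x y))\<^sup>2) \<le> max (2 * (Nu + Nw)) (2 * (Nu' + Nw'))"
        by (intro max.coboundedI2 order.trans[OF hp_int_norm_diff_le[OF Nu'(1)[OF \<tau>] Nw'(1)[OF \<tau>]]]
            mult_left_mono add_mono Nu'(2) Nw'(2) \<tau>) simp
      show "2 * hp_int (\<lambda>x y. ?v \<tau> x y \<bullet> ?vt \<tau> x y) \<le> 4 * B * ?E \<tau> + c" by (rule rate[OF \<tau>'(1)])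
    next
      have D: "{s..t} \<times> UNIV \<times> {0<..} \<subseteq> {0<..T} \<times> (UNIV :: real set) \<times> {0::real..}"
        "{s..t} \<times> UNIV \<times> {0<..} \<subseteq> {0..T} \<times> (UNIV :: real set) \<times> {0::real<..}"
        using J by auto
      have cu: "continuous_on ({0<..T} \<times> UNIV \<times> {0..}) (\<lambda>(t, x, y). u t x y)"
        "continuous_on ({0<..T} \<times> UNIV \<times> {0..}) (\<lambda>(t, x, y). dt {0<..T} u t x y)"
        using u(4) by (auto simp: C1_spacetime_def C1_space_def)
      have cw: "continuous_on ({0..T} \<times> UNIV \<times> {0<..}) (\<lambda>(t, x, y). w t x y)"
        "continuous_on ({0..T} \<times> UNIV \<times> {0<..}) (\<lambda>(t, x, y). dt {0..T} w t x y)"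
        using w(5) by (auto simp: C1_spacetime_def C1_space_def)
      show "continuous_on ({s..t} \<times> UNIV \<times> {0<..}) (\<lambda>(\<tau>, x, y). ?v \<tau> x y)"
        using continuous_on_diff[OF continuous_on_subset[OF cu(1) D(1)] continuous_on_subset[OF cw(1) D(2)]]
        by (simp add: split_beta)
      show "continuous_on ({s..t} \<times> UNIV \<times> {0<..}) (\<lambda>(\<tau>, x, y). ?vt \<tau> x y)"
        using continuous_on_diff[OF continuous_on_subset[OF cu(2) D(1)] continuous_on_subset[OF cw(2) D(2)]]
        by (simp add: split_beta)
    qed (use \<open>0 \<le> B\<close> c0 in auto)
    also have "\<dots> \<le> (?E s + c * T) * exp (4 * B * T)"
      using s c0 \<open>0 \<le> B\<close> hp_int_nonneg[of "\<lambda>x y. (norm (?v s x y))\<^sup>2"]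
      by (intro mult_mono add_mono mult_left_mono exp_le_cancel_iff[THEN iffD2] order.refl) auto
    finally show ?thesis .
  qed

  \<comment> \<open>Both solutions start from \<open>u0\<close>, so for \<open>y > 0\<close> the
    difference at time \<open>s\<close> is \<open>(u s - u 0) - (w s - w 0)\<close>, and continuity
    in L2 makes both brackets small.\<close>
  have small: "eventually (\<lambda>s. ?E s \<le> 4 * \<epsilon>\<^sup>2) (at_right 0)" if "\<epsilon> > 0" for \<epsilon>
  proof -
    have 0: "0 \<in> {0..T}" using \<open>0 < T\<close> by simp
    have "eventually (\<lambda>s. hp_int (\<lambda>x y. (norm (u s x y - u 0 x y))\<^sup>2) \<le> \<epsilon>\<^sup>2 \<and>
        hp_int (\<lambda>x y. (norm (w s x y - w 0 x y))\<^sup>2) \<le> \<epsilon>\<^sup>2) (at 0 within {0..T})"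
    proof (rule eventually_conj)
      show "eventually (\<lambda>s. hp_int (\<lambda>x y. (norm (u s x y - u 0 x y))\<^sup>2) \<le> \<epsilon>\<^sup>2) (at 0 within {0..T})"
        by (rule continuous_L2_eventually[OF u(3) _ 0 that]) (rule u_cont)
      show "eventually (\<lambda>s. hp_int (\<lambda>x y. (norm (w s x y - w 0 x y))\<^sup>2) \<le> \<epsilon>\<^sup>2) (at 0 within {0..T})"
        by (rule continuous_L2_eventually[OF w(3) _ 0 that]) (rule w_cont)
    qed
    then have ev: "eventually (\<lambda>s. hp_int (\<lambda>x y. (norm (u s x y - u 0 x y))\<^sup>2) \<le> \<epsilon>\<^sup>2 \<and>
        hp_int (\<lambda>x y. (norm (w s x y - w 0 x y))\<^sup>2) \<le> \<epsilon>\<^sup>2) (at_right 0)"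
      using \<open>0 < T\<close> by (simp add: at_within_Icc_at_right)
    moreover have "eventually (\<lambda>s. s \<in> {0..T}) (at_right 0)"
      using \<open>0 < T\<close> by (intro eventually_at_rightI[of 0 T]) auto
    ultimately show ?thesis
    proof eventually_elim
      case (elim s)
      have "?E s = hp_int (\<lambda>x y. (norm ((u s x y - u 0 x y) - (w s x y - w 0 x y)))\<^sup>2)"
        by (rule hp_int_cong) (simp add: u(2) w(2))
      also have "\<dots> \<le> 2 * (hp_int (\<lambda>x y. (norm (u s x y - u 0 x y))\<^sup>2) + hp_int (\<lambda>x y. (norm (w s x y - w 0 x y))\<^sup>2))"
        by (rule hp_int_norm_diff_le) (intro hp_L2_diff u_L2 w_L2 elim(2) 0)+
      also have "\<dots> \<le> 2 * (\<epsilon>\<^sup>2 + \<epsilon>\<^sup>2)"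
        by (intro mult_left_mono add_mono conjunct1[OF elim(1)] conjunct2[OF elim(1)]) simp
      also have "\<dots> = 4 * \<epsilon>\<^sup>2" by simp
      finally show ?case .
    qed
  qed

  have "?E t \<le> c * T * exp (4 * B * T)"
  proof (cases "t = 0")
    case True
    have "?E 0 = hp_int (\<lambda>x y. 0)" by (rule hp_int_cong) (simp add: u(2) w(2))
    also have "\<dots> = 0" by (simp add: hp_int_def)
    finally show ?thesis using True c0 \<open>0 < T\<close> by simp
  next
    case False
    then have t0: "0 < t" "t \<le> T" using t by auto
    \<comment> \<open>For fixed \<open>\<epsilon>\<close> the starting time \<open>s\<close> is sent
      to 0; \<open>\<epsilon>\<close> itself is removed afterwards.\<close>
    have bound: "?E t \<le> (4 * \<epsilon>\<^sup>2 + c * T) * exp (4 * B * T)" if "\<epsilon> > 0" for \<epsilon>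
    proof -
      have "eventually (\<lambda>s. s \<in> {0<..<t}) (at_right 0)" using t0 by (intro eventually_at_rightI[of 0 t]) auto
      with small[OF that] have "eventually (\<lambda>s. ?E t \<le> (4 * \<epsilon>\<^sup>2 + c * T) * exp (4 * B * T)) (at_right (0::real))"
      proof eventually_elim
        case (elim s)
        then have "?E t \<le> (?E s + c * T) * exp (4 * B * T)" using step t0 by simp
        also have "\<dots> \<le> (4 * \<epsilon>\<^sup>2 + c * T) * exp (4 * B * T)"
          using elim(1) by (intro mult_right_mono) auto
        finally show ?case .
      qed
      then show ?thesis by simp
    qed
    have "((\<lambda>\<epsilon>. (4 * \<epsilon>\<^sup>2 + c * T) * exp (4 * B * T)) \<longlongrightarrow> (4 * 0\<^sup>2 + c * T) * exp (4 * B * T)) (at_right 0)"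
      by (intro tendsto_intros)
    moreover have "eventually (\<lambda>\<epsilon>. ?E t \<le> (4 * \<epsilon>\<^sup>2 + c * T) * exp (4 * B * T)) (at_right 0)"
      using bound by (intro eventually_at_rightI[of 0 1]) auto
    ultimately have "?E t \<le> (4 * 0\<^sup>2 + c * T) * exp (4 * B * T)"
      by (intro tendsto_lowerbound[OF _ _ trivial_limit_at_right_real])
    then show ?thesis by simp
  qed
  then show ?thesis
    unfolding L2_norm_eq[OF v_L2[OF t]] c_def by (intro ennreal_leI real_sqrt_le_mono)
qed


section \<open>The inviscid limit\<close>

text \<open>\<open>U\<close> comes from compactness of the time interval times one period of the
  wall, \<open>w\<close> being continuous up to \<open>y = 0\<close>; \<open>W\<close> from local
  boundedness in L2, since \<open>{0..T}\<close> is itself compact.\<close>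

lemma euler_solution_bounds:
  assumes eu: "euler_solution T u0 w" and "0 < T"
  obtains B U W where "0 \<le> B" "0 \<le> U" "0 \<le> W"
    "\<And>t x y. t \<in> {0..T} \<Longrightarrow> y > 0 \<Longrightarrow> norm (dx (w t) x y) \<le> B \<and> norm (dy (w t) x y) \<le> B"
    "\<And>t x. t \<in> {0..T} \<Longrightarrow> x \<in> {-pi..pi} \<Longrightarrow> \<bar>fst (w t x 0)\<bar> \<le> U"
    "\<And>t. t \<in> {0..T} \<Longrightarrow>
      hp_int (\<lambda>x y. (norm (dx (w t) x y))\<^sup>2) + hp_int (\<lambda>x y. (norm (dy (w t) x y))\<^sup>2) \<le> W"
proof -
  have 0: "0 \<in> {0..T}" using \<open>0 < T\<close> by simp
  have w: "continuous_on ({0..T} \<times> UNIV \<times> {0..}) (\<lambda>(t, x, y). w t x y)" "C1_spacetime {0..T} {0<..} w"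
      "locally_bounded_L2 {0..T} (\<lambda>t. dx (w t))" "locally_bounded_L2 {0..T} (\<lambda>t. dy (w t))"
    and ex: "\<exists>B. \<forall>t\<in>{0..T}. \<forall>x. \<forall>y>0. norm (dx (w t) x y) \<le> B \<and> norm (dy (w t) x y) \<le> B"
    using eu unfolding euler_solution_def by blast+
  obtain B where B: "\<And>t x y. t \<in> {0..T} \<Longrightarrow> y > 0 \<Longrightarrow> norm (dx (w t) x y) \<le> B \<and> norm (dy (w t) x y) \<le> B"
    using ex by blast
  have B0: "0 \<le> B" using order.trans[OF norm_ge_zero conjunct1[OF B[OF 0 zero_less_one]]] .
  have "compact ((\<lambda>(t, x, y). w t x y) ` ({0..T} \<times> {-pi..pi} \<times> {0}))"
    by (intro compact_continuous_image continuous_on_subset[OF w(1)] compact_Times compact_Icc) auto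
  then obtain U where U: "\<forall>z\<in>(\<lambda>(t, x, y). w t x y) ` ({0..T} \<times> {-pi..pi} \<times> {0}). norm z \<le> U"
    using compact_imp_bounded bounded_iff by blast
  have U': "\<bar>fst (w t x 0)\<bar> \<le> U" if "t \<in> {0..T}" "x \<in> {-pi..pi}" for t x
  proof -
    have "norm (w t x 0) \<le> U" using U that by force
    then show ?thesis using norm_fst_snd_le(1)[of "w t x 0"] by simp
  qed
  have U0: "0 \<le> U" using order.trans[OF abs_ge_zero U'[OF 0, of 0]] by simp
  have C: "hp_C1 (w t) (dx (w t)) (dy (w t))" if "t \<in> {0..T}" for t
    using w(2) that by (intro C1_space_hp_C1[where J="{0..T}" and Y="{0<..}"]) (auto simp: C1_spacetime_def)
  obtain W1 where W1: "\<And>t. t \<in> {0..T} \<Longrightarrow> hp_int (\<lambda>x y. (norm (dx (w t) x y))\<^sup>2) \<le> W1"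
    using locally_bounded_L2_D[OF w(3) compact_Icc order.refl hp_C1D(2)[OF C]] by metis
  obtain W2 where W2: "\<And>t. t \<in> {0..T} \<Longrightarrow> hp_int (\<lambda>x y. (norm (dy (w t) x y))\<^sup>2) \<le> W2"
    using locally_bounded_L2_D[OF w(4) compact_Icc order.refl hp_C1D(3)[OF C]] by metis
  have W: "hp_int (\<lambda>x y. (norm (dx (w t) x y))\<^sup>2) + hp_int (\<lambda>x y. (norm (dy (w t) x y))\<^sup>2) \<le> W1 + W2"
    if "t \<in> {0..T}" for t
    using W1[OF that] W2[OF that] by (rule add_mono)
  have "0 \<le> hp_int (\<lambda>x y. (norm (dx (w 0) x y))\<^sup>2)" "0 \<le> hp_int (\<lambda>x y. (norm (dy (w 0) x y))\<^sup>2)"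
    by (rule hp_int_nonneg, simp)+
  with W[OF 0] have "0 \<le> W1 + W2" by linarith
  then show ?thesis by (rule that[OF B0 U0 _ B U' W])
qed

theorem theorem2p3:
  fixes \<alpha> \<beta> \<epsilon>0 \<mu>0 M C \<gamma> T :: real
    and u0 :: vfield
    and u :: "real \<Rightarrow> real \<Rightarrow> vfield"
    and ubar :: "real \<Rightarrow> vfield"
  assumes "\<beta> \<in> {0<..<1/4}" and "\<alpha> \<in> {0<..<1/2}" and "\<epsilon>0 \<in> {0<..<1}" and "\<mu>0 \<in> {0<..<1/10}"
    and "0 \<le> M"
    and "initial_norm \<epsilon>0 \<mu>0 (vorticity u0) \<le> ennreal M"
    and "0 < T" and "0 < \<gamma>" and "0 < C"
    and "\<gamma> * sqrt T < \<mu>0"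
    and "\<And>\<nu>. \<nu> \<in> {0<..<1} \<Longrightarrow> navier_stokes_solution \<nu> T u0 (u \<nu>)"
    and "\<And>\<nu>. \<nu> \<in> {0<..<1} \<Longrightarrow>
           (SUP t\<in>{0..T}. triple_norm \<alpha> \<beta> \<epsilon>0 \<mu>0 \<gamma> \<nu> t (vorticity (u \<nu> t))) \<le> ennreal (C * M)"
    and "euler_solution T u0 ubar"
  shows "((\<lambda>\<nu>. SUP t\<in>{0..T}. L2_norm (\<lambda>x y. u \<nu> t x y - ubar t x y)) \<longlongrightarrow> 0) (at_right 0)"
proof -
  obtain B U W where BUW: "0 \<le> B" "0 \<le> U" "0 \<le> W"
    and bounds: "\<And>t x y. t \<in> {0..T} \<Longrightarrow> y > 0 \<Longrightarrow> norm (dx (ubar t) x y) \<le> B \<and> norm (dy (ubar t) x y) \<le> B"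
    "\<And>t x. t \<in> {0..T} \<Longrightarrow> x \<in> {-pi..pi} \<Longrightarrow> \<bar>fst (ubar t x 0)\<bar> \<le> U"
    "\<And>t. t \<in> {0..T} \<Longrightarrow>
      hp_int (\<lambda>x y. (norm (dx (ubar t) x y))\<^sup>2) + hp_int (\<lambda>x y. (norm (dy (ubar t) x y))\<^sup>2) \<le> W"
    using euler_solution_bounds[OF assms(13,7)] by metis
  have A: "0 \<le> C * M" using assms by simp
  \<comment> \<open>The energy bound with \<open>S = C * M / sqrt \<nu>\<close>: the viscous factor
    turns this into \<open>sqrt \<nu>\<close>, so \<open>b \<nu>\<close> is of order
    \<nu>^(1/4).\<close>
  define b where "b = (\<lambda>\<nu>. sqrt ((4 * pi * U * (C * M) * sqrt \<nu> + \<nu> * W / 2) * T * exp (4 * B * T)))"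
  have main: "(SUP t\<in>{0..T}. L2_norm (\<lambda>x y. u \<nu> t x y - ubar t x y)) \<le> ennreal (b \<nu>)" if \<nu>: "\<nu> \<in> {0<..<1}" for \<nu>
  proof (rule SUP_least)
    fix t assume t: "t \<in> {0..T}"
    note ns = assms(11)[OF \<nu>]
    have S: "\<bar>vorticity (u \<nu> t) x 0\<bar> \<le> C * M / sqrt \<nu>" if t: "t \<in> {0<..T}" and x: "x \<in> {-pi..pi}" for t x
    proof (rule wall_bound_triple_norm[OF _ _ _ _ _ A _ _ x])
      \<comment> \<open>The radius \<open>\<mu>0 - \<gamma> * sqrt t\<close> must stay positive up
        to time \<open>T\<close>: over an empty range of radii the supremum in
        \<open>Xt_norm\<close> would be 0 and carry no information.\<close>
      have "sqrt t \<le> sqrt T" using t by simp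
      then have "\<gamma> * sqrt t \<le> \<gamma> * sqrt T" using assms(8) by (intro mult_left_mono) auto
      then show "\<gamma> * sqrt t < \<mu>0" using assms(10) by linarith
      have "triple_norm \<alpha> \<beta> \<epsilon>0 \<mu>0 \<gamma> \<nu> t (vorticity (u \<nu> t))
          \<le> (SUP t\<in>{0..T}. triple_norm \<alpha> \<beta> \<epsilon>0 \<mu>0 \<gamma> \<nu> t (vorticity (u \<nu> t)))"
        by (rule SUP_upper) (use t in auto)
      then show "triple_norm \<alpha> \<beta> \<epsilon>0 \<mu>0 \<gamma> \<nu> t (vorticity (u \<nu> t)) \<le> ennreal (C * M)"
        using assms(12)[OF \<nu>] order.trans by blast
      have "C1_space {0<..T} {0..} (u \<nu>)"
        using ns unfolding navier_stokes_solution_def C1_spacetime_def by blast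
      then have d: "continuous_on ({0<..T} \<times> UNIV \<times> {0..}) (\<lambda>(t, x, y). dx (u \<nu> t) x y)"
        "continuous_on ({0<..T} \<times> UNIV \<times> {0..}) (\<lambda>(t, x, y). dy (u \<nu> t) x y)"
        by (auto simp: C1_space_def)
      show "continuous_on (UNIV \<times> {0..}) (\<lambda>q. vorticity (u \<nu> t) (fst q) (snd q))"
        unfolding vorticity_def
        by (intro continuous_intros continuous_time_slice[OF d(1) t] continuous_time_slice[OF d(2) t])
    qed (use \<nu> t assms(3) in auto)
    have "L2_norm (\<lambda>x y. u \<nu> t x y - ubar t x y)
      \<le> ennreal (sqrt (2 * \<nu> * (2 * pi * (U * (C * M / sqrt \<nu>)) + W / 4) * T * exp (4 * B * T)))"
      by (rule energy_estimate[OF ns assms(13,7) _ BUW(1,2) _ BUW(3) bounds S t])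
        (use \<nu> A in auto)
    also have "2 * \<nu> * (2 * pi * (U * (C * M / sqrt \<nu>)) + W / 4) = 4 * pi * U * (C * M) * sqrt \<nu> + \<nu> * W / 2"
    proof -
      define r where "r = sqrt \<nu>"
      have r: "r > 0" "\<nu> = r * r" using \<nu> by (auto simp: r_def)
      have "2 * (r * r) * (2 * pi * (U * (C * M / r)) + W / 4) = 4 * pi * U * (C * M) * r + r * r * W / 2"
        using r(1) by (simp add: field_simps)
      then show ?thesis unfolding r_def[symmetric] r(2)[symmetric] .
    qed
    finally show "L2_norm (\<lambda>x y. u \<nu> t x y - ubar t x y) \<le> ennreal (b \<nu>)" by (simp add: b_def)
  qed
  have "(b \<longlongrightarrow> sqrt ((4 * pi * U * (C * M) * sqrt 0 + 0 * W / 2) * T * exp (4 * B * T))) (at_right 0)"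
    unfolding b_def by (intro tendsto_intros) auto
  then have lim: "((\<lambda>\<nu>. ennreal (b \<nu>)) \<longlongrightarrow> ennreal 0) (at_right 0)" by (intro tendsto_ennrealI) simp
  have ev: "eventually (\<lambda>\<nu>. (SUP t\<in>{0..T}. L2_norm (\<lambda>x y. u \<nu> t x y - ubar t x y)) \<le> ennreal (b \<nu>)) (at_right 0)"
    using main by (intro eventually_at_rightI[of 0 1]) auto
  show ?thesis
    by (rule tendsto_sandwich[OF _ ev tendsto_const lim[unfolded ennreal_0]]) simp
qed

end
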